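(* Let $f(t,x):=\mathbb{E}\big[\exp\big(\int_t^T\sum_{i=1}^3u_i(s)p_i(X_s)ds+v(T)q(X_T)\big)\mid X_t=x\big]$ on $[0,T]\times\mathbb{R}$. If $f$ does not vanish, let $\log f$ be the continuous function on $[0,T]\times\mathbb{R}$ with $\exp(\log f)=f$ and $\log f(T,0)=v(T)q(0)$. Then \[ \phi_k(t):=\frac1{k!}\partial_x^k\log f(T-t,x)\Big|_{x=0},\quad t\ge0, \] solves the system \[ \phi_k'(t)=\sum_{i=1}^3u_i(T-t)(p_i)_k+bk\phi_k(t)+a(k+1)\phi_{k+1}(t)+\tfrac{c^2(k+2)(k+1)}{2}\phi_{k+2}(t)+\tfrac{c^2}{2}(\widetilde\phi(t)*\widetilde\phi(t))_k,\quad \widetilde\phi_k(t)=(k+1)\phi_{k+1}(t), \] with $\phi_k(0)=v(T)q_k$, $k\ge0$.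
   Context: Let $W$ be a Brownian motion; $a,b\in\mathbb{R}$, $c\ne0$, $T>0$; $dX_t=(a+bX_t)dt+c\,dW_t$. $(r)_k$ or $r_k$ denotes the coefficient of $x^k$ of a power series $r$; $(\alpha*\beta)_k=\sum_{l=0}^k\alpha_l\beta_{k-l}$. Negligible to double factorial: $\limsup_k(|p_k|(k-1)!!)^{1/k}=0$, $(-1)!!=0!!=1$. Standing assumptions: $u_1,u_2,u_3,v:[0,T]\to\mathbb{C}$ continuous with $\Re(u_1)\le0$, $\Re(u_2)=\Re(u_3)=\Re(v)=0$; $p_1=p^2$ for a real-coefficient power series $p$ negligible to double factorial; $p_2,p_3,q$ real-coefficient power series negligible to double factorial. *)

theory Defs
  imports "HOL-Probability.Probability"
begin

fun dfact :: "nat \<Rightarrow> nat" where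
  "dfact 0 = 1"
| "dfact (Suc 0) = 1"
| "dfact (Suc (Suc n)) = Suc (Suc n) * dfact n"

text \<open>The factor (k-1)!! with the convention (-1)!! = 0!! = 1.\<close>
definition dfact_pred :: "nat \<Rightarrow> real" where
  "dfact_pred k = (if k = 0 then 1 else real (dfact (k - 1)))"

definition negligible_dfact :: "(nat \<Rightarrow> real) \<Rightarrow> bool" where
  "negligible_dfact p \<longleftrightarrow>
     limsup (\<lambda>k. ereal (root k (\<bar>p k\<bar> * dfact_pred k))) = 0"

definition conv :: "(nat \<Rightarrow> 'a::comm_semiring_1) \<Rightarrow> (nat \<Rightarrow> 'a) \<Rightarrow> nat \<Rightarrow> 'a" where
  "conv \<alpha> \<beta> k = (\<Sum>l\<le>k. \<alpha> l * \<beta> (k - l))"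

definition pser :: "(nat \<Rightarrow> real) \<Rightarrow> real \<Rightarrow> real" where
  "pser p x = (\<Sum>k. p k * x ^ k)"

definition brownian_motion :: "'w measure \<Rightarrow> (real \<Rightarrow> 'w \<Rightarrow> real) \<Rightarrow> bool" where
  "brownian_motion M W \<longleftrightarrow>
     prob_space M \<and>
     (\<forall>t\<ge>0. W t \<in> borel_measurable M) \<and>
     (\<forall>\<omega>\<in>space M. W 0 \<omega> = 0 \<and> continuous_on {0..} (\<lambda>t. W t \<omega>)) \<and>
     (\<forall>s t. 0 \<le> s \<longrightarrow> s < t \<longrightarrow>
        distributed M lborel (\<lambda>\<omega>. W t \<omega> - W s \<omega>)
          (\<lambda>y. ennreal (normal_density 0 (sqrt (t - s)) y))) \<and>
     (\<forall>(ts::nat \<Rightarrow> real) n. 0 \<le> ts 0 \<longrightarrow> (\<forall>i<n. ts i < ts (Suc i)) \<longrightarrow>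
        prob_space.indep_vars M (\<lambda>_. borel)
          (\<lambda>i \<omega>. W (ts (Suc i)) \<omega> - W (ts i) \<omega>) {..<n})"

text \<open>Pathwise solution of dX = (a + b X) ds + c dw on [t, \<infinity>) started at X_t = x,
  driven by the path w: the unique continuous y with
  y s = x + \<integral>_t^s (a + b y r) dr + c (w s - w t) for s \<ge> t (set to x for s < t).\<close>
definition ou_path :: "real \<Rightarrow> real \<Rightarrow> real \<Rightarrow> (real \<Rightarrow> real) \<Rightarrow> real \<Rightarrow> real \<Rightarrow> real \<Rightarrow> real" where
  "ou_path a b c w t x = (THE y. continuous_on {t..} y \<and>
      (\<forall>s\<ge>t. y s = x + integral {t..s} (\<lambda>r. a + b * y r) + c * (w s - w t)) \<and>
      (\<forall>s<t. y s = x))"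

definition fk_fun :: "'w measure \<Rightarrow> (real \<Rightarrow> 'w \<Rightarrow> real) \<Rightarrow> real \<Rightarrow> real \<Rightarrow> real \<Rightarrow> real
    \<Rightarrow> (real \<Rightarrow> complex) \<Rightarrow> (real \<Rightarrow> complex) \<Rightarrow> (real \<Rightarrow> complex) \<Rightarrow> (real \<Rightarrow> complex)
    \<Rightarrow> (nat \<Rightarrow> real) \<Rightarrow> (nat \<Rightarrow> real) \<Rightarrow> (nat \<Rightarrow> real) \<Rightarrow> (nat \<Rightarrow> real)
    \<Rightarrow> real \<Rightarrow> real \<Rightarrow> complex" where
  "fk_fun M W a b c T u1 u2 u3 v p1 p2 p3 q t x =
     integral\<^sup>L M (\<lambda>\<omega>. let X = ou_path a b c (\<lambda>s. W s \<omega>) t x in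
        exp (integral {t..T} (\<lambda>s. u1 s * of_real (pser p1 (X s)) + u2 s * of_real (pser p2 (X s))
                                 + u3 s * of_real (pser p3 (X s)))
             + v T * of_real (pser q (X T))))"

definition nderiv :: "nat \<Rightarrow> (real \<Rightarrow> 'b::real_normed_vector) \<Rightarrow> real \<Rightarrow> 'b" where
  "nderiv k g = ((\<lambda>h x. vector_derivative h (at x)) ^^ k) g"

end

theory Submission
  imports Defs
begin

text \<open>
  Writing \<open>V\<close> for the potential \<open>\<Sum> u\<^sub>i p\<^sub>i\<close>, the exponent has real part at most \<open>0\<close>, while all derivatives of
  the power series grow slower than \<open>exp (\<epsilon> x\<^sup>2)\<close> for every \<open>\<epsilon> > 0\<close>. Doob's inequality gives a random
  variable \<open>Z\<close> that bounds \<open>|W|\<close> on \<open>[0, T]\<close> and has \<open>E exp (\<epsilon> Z\<^sup>2) < \<infinity>\<close> for some \<open>\<epsilon> > 0\<close>; it dominates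
  every derivative of the integrand in \<open>x\<close>, so \<open>f\<close> is smooth in \<open>x\<close> with jointly continuous derivatives.
  The Markov property together with a second-order Taylor expansion over a short time step yields the
  backward equation \<open>\<partial>\<^sub>t f + (a + b x) \<partial>\<^sub>x f + c\<^sup>2/2 \<partial>\<^sub>x\<^sup>2 f + V f = 0\<close>. Dividing by \<open>f\<close> gives
  \<open>\<partial>\<^sub>t L + (a + b x) \<partial>\<^sub>x L + c\<^sup>2/2 (\<partial>\<^sub>x\<^sup>2 L + (\<partial>\<^sub>x L)\<^sup>2) + V = 0\<close> for \<open>L = log f\<close>, and the system is its
  sequence of Taylor coefficients at \<open>x = 0\<close>.
\<close>

text \<open>Up to geometric factors \<open>(k-1)!!\<close> is \<open>sqrt (k!)\<close>, so a
  negligible series is entire and grows more slowly than \<open>exp (e * x^2)\<close> for each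
  \<open>e > 0\<close>. This is what Brownian motion tolerates: \<open>exp (e * Z^2)\<close> is
  integrable for small \<open>e\<close> only, so the growth must be beaten with \<open>e\<close> at
  will.

  The diffusion is solved path by path by variation of constants. It is affine in its starting point
  with slope \<open>exp (b * (s - t))\<close>, hence derivatives in \<open>x\<close> can be computed
  inside the expectation, and conditioning on \<open>X_t = x\<close> becomes starting the flow at
  \<open>(t, x)\<close>. The Markov property is then the flow identity plus independence of past and
  future increments.

  Beforehand \<open>f\<close> is only known to be continuous in time, and its derivative is wanted
  on all of \<open>[0, T]\<close>. Therefore the short-time expansion lets both end points of the
  step move and uses only space derivatives, which are jointly continuous.

  A continuous logarithm of \<open>f\<close> is unique up to a constant in \<open>2 * pi * i\<close>
  times the integers. Such a constant is invisible in the equation and shows only in the initial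
  values; the normalisation at \<open>(T, 0)\<close> removes it.\<close>

section \<open>Power series of order two and type zero\<close>

text \<open>A bound for every \<open>e\<close> in place of a limsup of roots: any factor
  \<open>const ^ k\<close> is absorbed by shrinking \<open>e\<close>, which makes stability under
  derivatives and products easy. \<open>sqrt (fact k)\<close> is chosen because it splits along
  binomial coefficients.\<close>

definition subgauss_coeffs :: "(nat \<Rightarrow> real) \<Rightarrow> bool" where
  "subgauss_coeffs p \<longleftrightarrow> (\<forall>e>0. \<exists>C\<ge>0. \<forall>k. \<bar>p k\<bar> * sqrt (fact k) \<le> C * e ^ k)"

lemma subgauss_coeffsD:
  assumes "subgauss_coeffs p" "e > 0"
  obtains C where "C \<ge> 0" "\<And>k. \<bar>p k\<bar> * sqrt (fact k) \<le> C * e ^ k"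
  using assms unfolding subgauss_coeffs_def by blast

lemma dfact_le_Suc: "dfact n \<le> dfact (Suc n)"
proof (induction n rule: dfact.induct)
  case (3 n)
  then show ?case using mult_le_mono[of "Suc (Suc n)" "Suc (Suc (Suc n))" "dfact n" "dfact (Suc n)"]
    by (simp only: dfact.simps)
qed auto

lemma dfact_mult_dfact_Suc: "dfact (Suc n) * dfact n = fact (Suc n)"
proof (induction n)
  case (Suc n)
  have "dfact (Suc (Suc n)) * dfact (Suc n) = Suc (Suc n) * (dfact (Suc n) * dfact n)"
    by (simp only: dfact.simps mult.assoc mult.commute[of "dfact n"])
  then show ?case using Suc by (simp only: fact_Suc[of "Suc n"] of_nat_id)
qed auto

text \<open>With \<open>k = n + 1\<close> the product of \<open>(n+1)!!\<close> and
  \<open>n!!\<close> is \<open>k!\<close>, and \<open>(n+1)!!\<close> is at most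
  \<open>2 ^ (n+1)\<close> times \<open>n!!\<close>. The crude power of 2 disappears later in the
  choice of \<open>e\<close>.\<close>

lemma sqrt_fact_le_dfact_pred: "sqrt (fact k) \<le> 2 ^ k * dfact_pred k"
proof (cases k)
  case (Suc n)
  have le: "dfact (Suc n) \<le> 2 ^ Suc n * dfact n"
  proof (cases n)
    case (Suc m)
    have "dfact (Suc n) = Suc n * dfact m" using Suc by simp
    also have "\<dots> \<le> Suc n * dfact n" using dfact_le_Suc[of m] Suc by (intro mult_le_mono) auto
    also have "\<dots> \<le> 2 ^ Suc n * dfact n"
      by (intro mult_le_mono less_imp_le[OF less_exp]) auto
    finally show ?thesis .
  qed auto
  have "fact k \<le> 2 ^ k * (real (dfact n))\<^sup>2"
  proof -
    have "fact k = dfact (Suc n) * dfact n" by (simp only: dfact_mult_dfact_Suc Suc)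
    also have "\<dots> \<le> 2 ^ Suc n * dfact n * dfact n" using le by (intro mult_le_mono) auto
    finally have "real (fact k) \<le> real (2 ^ Suc n * dfact n * dfact n)" by (rule of_nat_mono)
    then show ?thesis using Suc by (simp add: power2_eq_square algebra_simps)
  qed
  also have "\<dots> \<le> (2 ^ k)\<^sup>2 * (real (dfact n))\<^sup>2"
    by (intro mult_right_mono) (auto simp: power2_eq_square)
  finally have "fact k \<le> (2 ^ k * real (dfact n))\<^sup>2" by (simp add: power_mult_distrib)
  then have "sqrt (fact k) \<le> 2 ^ k * real (dfact n)" by (intro real_le_lsqrt) auto
  then show ?thesis using Suc by (simp add: dfact_pred_def)
qed (simp add: dfact_pred_def)

lemma bounded_ratio_if_eventually:
  fixes f g :: "nat \<Rightarrow> real"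
  assumes "\<forall>\<^sub>F k in sequentially. f k \<le> g k" "\<And>k. g k > 0"
  shows "\<exists>C\<ge>0. \<forall>k. f k \<le> C * g k"
proof -
  obtain N where N: "\<And>k. k \<ge> N \<Longrightarrow> f k \<le> g k" using assms(1) by (auto simp: eventually_sequentially)
  \<comment> \<open>The 1 covers the tail, the sum covers the finitely many ratios before
    it.\<close>
  define C where "C = 1 + (\<Sum>k<N. \<bar>f k\<bar> / g k)"
  have nn: "(\<Sum>k<N. \<bar>f k\<bar> / g k) \<ge> 0" by (intro sum_nonneg) (simp add: assms(2) less_imp_le)
  have "f k \<le> C * g k" for k
  proof (cases "k < N")
    case True
    have "\<bar>f k\<bar> / g k \<le> (\<Sum>k<N. \<bar>f k\<bar> / g k)"
      using True by (intro member_le_sum) (auto simp: assms(2) less_imp_le)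
    then have "\<bar>f k\<bar> / g k \<le> C" by (simp add: C_def)
    then show ?thesis using assms(2)[of k] by (simp add: field_simps)
  next
    case False
    then have "f k \<le> 1 * g k" using N by simp
    also have "\<dots> \<le> C * g k" using nn assms(2)[of k] by (intro mult_right_mono) (auto simp: C_def)
    finally show ?thesis .
  qed
  moreover have "C \<ge> 0" using nn by (simp add: C_def)
  ultimately show ?thesis by blast
qed

lemma negligible_dfact_imp_subgauss_coeffs:
  assumes "negligible_dfact p"
  shows "subgauss_coeffs p"
  unfolding subgauss_coeffs_def
proof (intro allI impI)
  fix e :: real assume e: "e > 0"
  \<comment> \<open>The half pays for the factor \<open>2 ^ k\<close> in
    \<open>sqrt_fact_le_dfact_pred\<close>.\<close>
  have "limsup (\<lambda>k. ereal (root k (\<bar>p k\<bar> * dfact_pred k))) < ereal (e / 2)"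
    using assms e by (simp add: negligible_dfact_def)
  then have "\<forall>\<^sub>F k in sequentially. ereal (root k (\<bar>p k\<bar> * dfact_pred k)) < ereal (e / 2)"
    by (rule Limsup_lessD)
  moreover have "\<forall>\<^sub>F k in sequentially. (k::nat) > 0" by (rule eventually_gt_at_top)
  ultimately have "\<forall>\<^sub>F k in sequentially. \<bar>p k\<bar> * sqrt (fact k) \<le> e ^ k"
  proof eventually_elim
    case (elim k)
    have nn: "\<bar>p k\<bar> * dfact_pred k \<ge> 0" by (simp add: dfact_pred_def)
    have "\<bar>p k\<bar> * sqrt (fact k) \<le> \<bar>p k\<bar> * (2 ^ k * dfact_pred k)"
      by (intro mult_left_mono sqrt_fact_le_dfact_pred) auto
    also have "\<dots> = 2 ^ k * root k (\<bar>p k\<bar> * dfact_pred k) ^ k"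
      using elim nn by (simp add: mult_ac)
    also have "\<dots> \<le> 2 ^ k * (e / 2) ^ k"
      using elim nn by (intro mult_left_mono power_mono) auto
    finally show ?case by (simp add: power_divide)
  qed
  then show "\<exists>C\<ge>0. \<forall>k. \<bar>p k\<bar> * sqrt (fact k) \<le> C * e ^ k"
    by (rule bounded_ratio_if_eventually) (use e in simp)
qed

text \<open>The factor \<open>k + 1\<close> brought down by differentiation is at most
  \<open>2 ^ (k + 1)\<close>, which is absorbed by using the hypothesis at
  \<open>e / 2\<close>.\<close>

lemma subgauss_coeffs_diffs:
  assumes "subgauss_coeffs p"
  shows "subgauss_coeffs (diffs p)"
  unfolding subgauss_coeffs_def
proof (intro allI impI)
  fix e :: real assume e: "e > 0"
  obtain C where C: "C \<ge> 0" "\<And>k. \<bar>p k\<bar> * sqrt (fact k) \<le> C * (e / 2) ^ k"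
    using subgauss_coeffsD[OF assms, of "e / 2"] e by auto
  have "\<bar>diffs p k\<bar> * sqrt (fact k) \<le> (C * e) * e ^ k" for k
  proof -
    have k: "real (Suc k) \<le> 2 ^ Suc k" using less_exp[of "Suc k"] by (metis less_imp_le of_nat_le_iff of_nat_numeral of_nat_power)
    have "\<bar>diffs p k\<bar> * sqrt (fact k) \<le> Suc k * (\<bar>p (Suc k)\<bar> * sqrt (fact (Suc k)))"
      unfolding diffs_def
      by (auto simp: abs_mult mult.assoc simp del: of_nat_Suc intro!: mult_left_mono real_sqrt_le_mono fact_mono)
    also have "\<dots> \<le> 2 ^ Suc k * (C * (e / 2) ^ Suc k)"
      using C(1) e k by (intro mult_mono C(2)) auto
    also have "\<dots> = (C * e) * e ^ k" by (simp add: power_divide)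
    finally show ?thesis .
  qed
  then show "\<exists>C\<ge>0. \<forall>k. \<bar>diffs p k\<bar> * sqrt (fact k) \<le> C * e ^ k" using C(1) e by (intro exI[of _ "C * e"]) auto
qed

lemma subgauss_coeffs_funpow_diffs:
  "subgauss_coeffs p \<Longrightarrow> subgauss_coeffs ((diffs ^^ k) p)"
  by (induction k) (auto intro: subgauss_coeffs_diffs)

text \<open>\<open>sqrt (fact k)\<close> is the product of the square roots of
  \<open>fact l\<close>, \<open>fact (k - l)\<close> and \<open>k choose l\<close>; the binomials of
  row \<open>k\<close> add up to \<open>2 ^ k\<close>, which \<open>e / 2\<close> absorbs.\<close>

lemma subgauss_coeffs_conv:
  assumes "subgauss_coeffs p" "subgauss_coeffs q"
  shows "subgauss_coeffs (conv p q)"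
  unfolding subgauss_coeffs_def
proof (intro allI impI)
  fix e :: real assume e: "e > 0"
  obtain C where C: "C \<ge> 0" "\<And>k. \<bar>p k\<bar> * sqrt (fact k) \<le> C * (e / 2) ^ k"
    using subgauss_coeffsD[OF assms(1), of "e / 2"] e by auto
  obtain D where D: "D \<ge> 0" "\<And>k. \<bar>q k\<bar> * sqrt (fact k) \<le> D * (e / 2) ^ k"
    using subgauss_coeffsD[OF assms(2), of "e / 2"] e by auto
  have "\<bar>conv p q k\<bar> * sqrt (fact k) \<le> (C * D) * e ^ k" for k
  proof -
    have "\<bar>conv p q k\<bar> * sqrt (fact k) \<le> (\<Sum>l\<le>k. \<bar>p l\<bar> * \<bar>q (k - l)\<bar>) * sqrt (fact k)"
      unfolding conv_def by (intro mult_right_mono order_trans[OF sum_abs]) (auto simp: abs_mult)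
    also have "\<dots> = (\<Sum>l\<le>k. (\<bar>p l\<bar> * sqrt (fact l)) * (\<bar>q (k - l)\<bar> * sqrt (fact (k - l))) * sqrt (real (k choose l)))"
      unfolding sum_distrib_right
    proof (intro sum.cong refl)
      fix l assume "l \<in> {..k}"
      then have "fact k = fact l * fact (k - l) * real (k choose l)"
        by (simp add: binomial_fact)
      then have "sqrt (fact k) = sqrt (fact l) * sqrt (fact (k - l)) * sqrt (real (k choose l))"
        by (simp add: real_sqrt_mult)
      then show "\<bar>p l\<bar> * \<bar>q (k - l)\<bar> * sqrt (fact k) =
         (\<bar>p l\<bar> * sqrt (fact l)) * (\<bar>q (k - l)\<bar> * sqrt (fact (k - l))) * sqrt (real (k choose l))"
        by (simp add: mult_ac)
    qed
    also have "\<dots> \<le> (\<Sum>l\<le>k. (C * (e / 2) ^ l) * (D * (e / 2) ^ (k - l)) * real (k choose l))"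
    proof (intro sum_mono)
      fix l assume "l \<in> {..k}"
      then have "1 \<le> real (k choose l)" using zero_less_binomial[of l k] by (simp add: Suc_le_eq)
      then have "sqrt (real (k choose l)) \<le> real (k choose l)"
        using mult_left_mono[of 1 "real (k choose l)" "real (k choose l)"]
        by (intro real_le_lsqrt) (auto simp: power2_eq_square)
      then show "(\<bar>p l\<bar> * sqrt (fact l)) * (\<bar>q (k - l)\<bar> * sqrt (fact (k - l))) * sqrt (real (k choose l))
          \<le> (C * (e / 2) ^ l) * (D * (e / 2) ^ (k - l)) * real (k choose l)"
        using C(1) D(1) e by (intro mult_mono[OF mult_mono[OF C(2) D(2)]]) auto
    qed
    also have "\<dots> = (\<Sum>l\<le>k. C * D * (e / 2) ^ k * real (k choose l))"
      by (intro sum.cong refl) (simp add: mult_ac flip: power_add)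
    also have "\<dots> = C * D * (e / 2) ^ k * real (\<Sum>l\<le>k. k choose l)"
      by (simp add: sum_distrib_left)
    also have "\<dots> = (C * D) * e ^ k" by (simp add: choose_row_sum power_divide)
    finally show ?thesis .
  qed
  then show "\<exists>C\<ge>0. \<forall>k. \<bar>conv p q k\<bar> * sqrt (fact k) \<le> C * e ^ k" using C(1) D(1) by (intro exI[of _ "C * D"]) auto
qed

text \<open>\<open>y\<^sup>k / sqrt k! \<le> 1 + (y\<^sup>2)\<^sup>k / k! \<le> 2 exp (y\<^sup>2)\<close>; the factor \<open>(1/2)\<^sup>k\<close> makes the terms summable.\<close>

lemma subgauss_coeffs_term_bound:
  assumes "subgauss_coeffs p" "l > 0"
  obtains C where "C \<ge> 0" "\<And>k x. \<bar>p k * x ^ k\<bar> \<le> C * exp (l * x\<^sup>2) * (1/2) ^ k"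
proof -
  define e where "e = sqrt l / 2"
  have e: "e > 0" using assms by (simp add: e_def)
  obtain C where C: "C \<ge> 0" "\<And>k. \<bar>p k\<bar> * sqrt (fact k) \<le> C * e ^ k"
    using subgauss_coeffsD[OF assms(1) e] by auto
  have "\<bar>p k * x ^ k\<bar> \<le> (2 * C) * exp (l * x\<^sup>2) * (1/2) ^ k" for k x
  proof -
    define y where "y = sqrt l * \<bar>x\<bar>"
    have y: "y \<ge> 0" "y\<^sup>2 = l * x\<^sup>2" using assms by (auto simp: y_def power_mult_distrib)
    define z where "z = y ^ k / sqrt (fact k)"
    have "z\<^sup>2 = (y\<^sup>2) ^ k / fact k" by (simp add: z_def power_divide power_mult[symmetric] mult.commute)
    also have "\<dots> \<le> exp (y\<^sup>2)" 
      using sum_le_suminf[OF summable_exp_generic[of "y\<^sup>2"], of "{k}"]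
      by (simp add: exp_def divide_inverse_commute)
    finally have z2: "z\<^sup>2 \<le> exp (l * x\<^sup>2)" using y by simp
    have "z \<le> 1 + z\<^sup>2" using zero_le_power2[of "z - 1/2"] by (simp add: power2_eq_square algebra_simps)
    also have "\<dots> \<le> 2 * exp (l * x\<^sup>2)" using z2 assms by (smt (verit) one_le_exp_iff zero_le_mult_iff zero_le_power2)
    finally have z: "z \<le> 2 * exp (l * x\<^sup>2)" .
    have "\<bar>p k * x ^ k\<bar> = (\<bar>p k\<bar> * sqrt (fact k)) * (\<bar>x\<bar> ^ k / sqrt (fact k))"
      by (simp add: abs_mult power_abs)
    also have "\<dots> \<le> (C * e ^ k) * (\<bar>x\<bar> ^ k / sqrt (fact k))" by (intro mult_right_mono C) auto
    also have "\<dots> = C * (1/2) ^ k * z"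
      by (simp add: z_def y_def e_def power_mult_distrib power_divide)
    also have "\<dots> \<le> C * (1/2) ^ k * (2 * exp (l * x\<^sup>2))" using C(1) by (intro mult_left_mono z) auto
    finally show ?thesis by (simp add: mult_ac)
  qed
  then show thesis using C(1) that[of "2 * C"] by auto
qed

lemma subgauss_coeffs_summable:
  assumes "subgauss_coeffs p"
  shows "summable (\<lambda>k. \<bar>p k * x ^ k\<bar>)"
proof -
  obtain C where C: "C \<ge> 0" "\<And>k x. \<bar>p k * x ^ k\<bar> \<le> C * exp (1 * x\<^sup>2) * (1/2) ^ k"
    using subgauss_coeffs_term_bound[OF assms, of 1] by auto
  have "summable (\<lambda>k. C * exp (1 * x\<^sup>2) * (1/2) ^ k)"
    by (intro summable_mult summable_geometric) auto
  then show ?thesis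
    by (rule summable_comparison_test'[where N = 0]) (simp only: real_norm_def abs_idempotent C(2))
qed

lemma pser_bound:
  assumes "subgauss_coeffs p" "l > 0"
  obtains C where "C \<ge> 0" "\<And>x. \<bar>pser p x\<bar> \<le> C * exp (l * x\<^sup>2)"
proof -
  obtain C where C: "C \<ge> 0" "\<And>k x. \<bar>p k * x ^ k\<bar> \<le> C * exp (l * x\<^sup>2) * (1/2) ^ k"
    using subgauss_coeffs_term_bound[OF assms] by auto
  have "\<bar>pser p x\<bar> \<le> (2 * C) * exp (l * x\<^sup>2)" for x
  proof -
    have "\<bar>pser p x\<bar> \<le> (\<Sum>k. \<bar>p k * x ^ k\<bar>)"
      unfolding pser_def by (intro summable_rabs subgauss_coeffs_summable assms)
    also have "\<dots> \<le> (\<Sum>k. C * exp (l * x\<^sup>2) * (1/2) ^ k)"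
      by (intro suminf_le C subgauss_coeffs_summable assms summable_mult summable_geometric) auto
    also have "\<dots> = (2 * C) * exp (l * x\<^sup>2)"
      by (subst suminf_mult) (auto intro: summable_geometric simp: suminf_geometric)
    finally show ?thesis .
  qed
  then show thesis using C(1) that[of "2 * C"] by auto
qed

lemma pser_has_real_derivative:
  assumes "subgauss_coeffs p"
  shows "(pser p has_real_derivative pser (diffs p) x) (at x)"
proof -
  have "summable (\<lambda>k. p k * y ^ k)" for y
    using subgauss_coeffs_summable[OF assms, of y] by (rule summable_rabs_cancel)
  then have "((\<lambda>x. \<Sum>k. p k * x ^ k) has_real_derivative (\<Sum>k. diffs p k * x ^ k)) (at x)"
    by (intro termdiffs_strong_converges_everywhere) auto
  then show ?thesis by (simp add: pser_def[abs_def])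
qed

lemma isCont_pser: "subgauss_coeffs p \<Longrightarrow> isCont (pser p) x"
  by (rule DERIV_isCont[OF pser_has_real_derivative])

lemma continuous_on_pser [continuous_intros]:
  assumes "subgauss_coeffs p" "continuous_on S f"
  shows "continuous_on S (\<lambda>x. pser p (f x))"
  by (rule continuous_on_compose2[of UNIV "pser p", OF _ assms(2)])
     (auto intro: continuous_at_imp_continuous_on isCont_pser assms)

lemma pser_conv:
  assumes "subgauss_coeffs p" "subgauss_coeffs q"
  shows "pser (conv p q) x = pser p x * pser q x"
proof -
  have "pser p x * pser q x = (\<Sum>k. \<Sum>i\<le>k. (p i * x ^ i) * (q (k - i) * x ^ (k - i)))"
    unfolding pser_def
    by (intro Cauchy_product) (use assms in \<open>auto intro: subgauss_coeffs_summable simp del: abs_mult simp: abs_mult[symmetric]\<close>)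
  also have "\<dots> = pser (conv p q) x"
    unfolding pser_def conv_def sum_distrib_right
    by (intro suminf_cong sum.cong refl) (simp add: mult_ac flip: power_add)
  finally show ?thesis by simp
qed

lemma pser_0: "pser p 0 = p 0"
  unfolding pser_def by (subst suminf_finite[of "{0}"]) (auto simp: power_0_left)

lemma funpow_diffs_0: "(diffs ^^ k) p 0 = fact k * (p k :: real)"
proof -
  \<comment> \<open>Each derivative shifts the index, so the induction needs every \<open>n\<close>,
    not only 0.\<close>
  have "(diffs ^^ k) p n * fact n = fact (n + k) * (p (n + k) :: real)" for n
  proof (induction k arbitrary: n)
    case (Suc k)
    have "(diffs ^^ Suc k) p n * fact n = (diffs ^^ k) p (Suc n) * fact (Suc n)"
      by (simp add: diffs_def)
    then show ?case using Suc[of "Suc n"] by simp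
  qed auto
  from this[of 0] show ?thesis by simp
qed

section \<open>The Ornstein-Uhlenbeck path\<close>

text \<open>Freezing \<open>s\<close> at the grid point below it, with mesh
  \<open>1 / (n + 1)\<close>, leaves countably many measurable sections; continuity in
  \<open>s\<close> passes to the limit.\<close>

lemma borel_measurable_pair_continuous:
  fixes k :: "real \<Rightarrow> 'w \<Rightarrow> 'b::metric_space"
  assumes meas: "\<And>s. k s \<in> borel_measurable N"
    and cont: "\<And>\<omega>. \<omega> \<in> space N \<Longrightarrow> continuous_on UNIV (\<lambda>s. k s \<omega>)"
  shows "(\<lambda>(s, \<omega>). k s \<omega>) \<in> borel_measurable (borel \<Otimes>\<^sub>M N)"
proof -
  define r where "r n s = real_of_int \<lfloor>real (Suc n) * s\<rfloor> / real (Suc n)" for n s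
  have r: "(\<lambda>n. r n s) \<longlonglongrightarrow> s" for s
  proof (rule tendsto_sandwich[of "\<lambda>n. s - 1 / real (Suc n)" _ _ "\<lambda>n. s"])
    have "s - 1 / real (Suc n) \<le> r n s" for n
    proof -
      have "s - 1 / real (Suc n) = (real (Suc n) * s - 1) / real (Suc n)" by (simp add: diff_divide_distrib)
      also have "\<dots> \<le> r n s" unfolding r_def
        using real_of_int_floor_add_one_ge[of "real (Suc n) * s"] by (intro divide_right_mono) linarith+
      finally show ?thesis .
    qed
    then show "\<forall>\<^sub>F n in sequentially. s - 1 / real (Suc n) \<le> r n s" by simp
    have "r n s \<le> s" for n
      using of_int_floor_le[of "real (Suc n) * s"] by (simp add: r_def field_simps)
    then show "\<forall>\<^sub>F n in sequentially. r n s \<le> s" by simp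
    have "(\<lambda>n. s - 1 / real (Suc n)) \<longlonglongrightarrow> s - 0"
      by (intro tendsto_intros LIMSEQ_Suc lim_1_over_n)
    then show "(\<lambda>n. s - 1 / real (Suc n)) \<longlonglongrightarrow> s" by simp
  qed auto
  show ?thesis
  proof (rule borel_measurable_LIMSEQ_metric[where f = "\<lambda>n (s, \<omega>). k (r n s) \<omega>"])
    fix n
    have "(\<lambda>p. k (real_of_int i / real (Suc n)) (snd p)) \<in> borel_measurable (borel \<Otimes>\<^sub>M N)" for i
      by (rule measurable_compose[OF measurable_snd meas])
    then have "(\<lambda>p. k (real_of_int \<lfloor>real (Suc n) * fst p\<rfloor> / real (Suc n)) (snd p)) \<in> borel_measurable (borel \<Otimes>\<^sub>M N)"
      by (rule measurable_compose_countable) measurable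
    then show "(\<lambda>(s, \<omega>). k (r n s) \<omega>) \<in> borel_measurable (borel \<Otimes>\<^sub>M N)"
      by (simp add: r_def case_prod_beta')
  next
    fix p assume "p \<in> space (borel \<Otimes>\<^sub>M N :: (real \<times> 'w) measure)"
    then have \<omega>: "snd p \<in> space N" by (auto simp: space_pair_measure)
    show "(\<lambda>n. (case p of (s, \<omega>) \<Rightarrow> k (r n s) \<omega>)) \<longlonglongrightarrow> (case p of (s, \<omega>) \<Rightarrow> k s \<omega>)"
      using continuous_on_tendsto_compose[OF cont[OF \<omega>] r[of "fst p"]] by (simp add: case_prod_beta')
  qed
qed

lemma borel_measurable_integral_param:
  fixes k :: "real \<Rightarrow> 'w \<Rightarrow> 'b::euclidean_space"
  assumes "t \<le> u"
    and meas: "\<And>s. s \<in> {t..u} \<Longrightarrow> k s \<in> borel_measurable N"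
    and cont: "\<And>\<omega>. \<omega> \<in> space N \<Longrightarrow> continuous_on {t..u} (\<lambda>s. k s \<omega>)"
  shows "(\<lambda>\<omega>. integral {t..u} (\<lambda>s. k s \<omega>)) \<in> borel_measurable N"
proof -
  \<comment> \<open>Clamping \<open>s\<close> to \<open>[t, u]\<close> extends the kernel
    continuously to the whole line.\<close>
  define k' where "k' s = k (max t (min u s))" for s
  have mem: "max t (min u s) \<in> {t..u}" for s using assms(1) by auto
  have "continuous_on UNIV (\<lambda>s. k' s \<omega>)" if "\<omega> \<in> space N" for \<omega>
    unfolding k'_def
    by (rule continuous_on_compose2[OF cont[OF that]]) (use mem in \<open>auto intro!: continuous_intros\<close>)
  moreover have "k' s \<in> borel_measurable N" for s
    using mem meas by (simp add: k'_def)
  ultimately have "(\<lambda>(s, \<omega>). k' s \<omega>) \<in> borel_measurable (borel \<Otimes>\<^sub>M N)"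
    by (intro borel_measurable_pair_continuous)
  then have "(\<lambda>(s, \<omega>). k' s \<omega>) \<in> borel_measurable (lborel \<Otimes>\<^sub>M N)"
    by (simp add: measurable_cong_sets[OF sets_pair_measure_cong[OF sets_lborel refl] refl])
  then have "(\<lambda>(\<omega>, s). k' s \<omega>) \<in> borel_measurable (N \<Otimes>\<^sub>M lborel)"
    using measurable_pair_swap by fastforce
  then have [measurable]: "(\<lambda>p. k' (snd p) (fst p)) \<in> borel_measurable (N \<Otimes>\<^sub>M lborel)"
    by (simp add: case_prod_beta')
  have "(\<lambda>\<omega>. LINT s|lborel. indicator {t..u} s *\<^sub>R k' s \<omega>) \<in> borel_measurable N"
    by (rule lborel.borel_measurable_lebesgue_integral) (simp add: case_prod_beta')
  also have "?this \<longleftrightarrow> ?thesis"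
  proof (rule measurable_cong)
    fix \<omega> assume \<omega>: "\<omega> \<in> space N"
    have "(LINT s|lborel. indicator {t..u} s *\<^sub>R k' s \<omega>) = (LINT s:{t..u}|lborel. k s \<omega>)"
      unfolding set_lebesgue_integral_def
      by (intro Bochner_Integration.integral_cong) (auto simp: k'_def indicator_def)
    also have "\<dots> = integral {t..u} (\<lambda>s. k s \<omega>)"
      by (intro set_borel_integral_eq_integral borel_integrable_atLeastAtMost' cont \<omega>)
    finally show "(LINT s|lborel. indicator {t..u} s *\<^sub>R k' s \<omega>) = integral {t..u} (\<lambda>s. k s \<omega>)" .
  qed
  finally show ?thesis .
qed

text \<open>The primitive starts at 0 rather than at the starting time of the path, so that
  differences of it telescope and continuity in the starting time is that of a single
  function.\<close>

definition ou_int :: "real \<Rightarrow> real \<Rightarrow> real \<Rightarrow> (real \<Rightarrow> real) \<Rightarrow> real \<Rightarrow> real" where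
  "ou_int a b c w s = integral {0..s} (\<lambda>r. exp (- b * r) * (a + b * c * w r))"

text \<open>Variation of constants for \<open>z = y - c w\<close>, which solves \<open>z' = a + b z + b c w\<close>.\<close>

definition ou_sol :: "real \<Rightarrow> real \<Rightarrow> real \<Rightarrow> (real \<Rightarrow> real) \<Rightarrow> real \<Rightarrow> real \<Rightarrow> real \<Rightarrow> real" where
  "ou_sol a b c w t x s = c * w s + exp (b * (s - t)) * (x - c * w t)
     + exp (b * s) * (ou_int a b c w s - ou_int a b c w t)"

lemma ou_sol_start [simp]: "ou_sol a b c w t x t = x"
  by (simp add: ou_sol_def)

text \<open>The two differences of \<open>ou_int\<close> telescope and the terms in
  \<open>w t\<close> cancel. This is pure algebra and needs no order among \<open>s\<close>,
  \<open>t\<close>, \<open>r\<close>.\<close>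

lemma ou_sol_flow: "ou_sol a b c w t (ou_sol a b c w s x t) r = ou_sol a b c w s x r"
proof -
  have "exp (b * (r - t)) * exp (b * (t - s)) = exp (b * (r - s))"
    "exp (b * (r - t)) * exp (b * t) = exp (b * r)"
    by (simp_all add: exp_add[symmetric] algebra_simps)
  then show ?thesis unfolding ou_sol_def
    by (simp add: distrib_left right_diff_distrib mult.assoc[symmetric])
qed

lemma ou_int_has_vector_derivative:
  assumes "continuous_on {0..} w" "0 \<le> r" "r \<le> s"
  shows "(ou_int a b c w has_vector_derivative exp (- b * r) * (a + b * c * w r)) (at r within {0..s})"
  unfolding ou_int_def
  by (rule integral_has_vector_derivative)
     (use assms in \<open>auto intro!: continuous_intros intro: continuous_on_subset\<close>)

lemma continuous_on_ou_int:
  assumes "continuous_on {0..} w"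
  shows "continuous_on {0..} (ou_int a b c w)"
  unfolding continuous_on_eq_continuous_within
proof
  fix r :: real assume r: "r \<in> {0..}"
  have "continuous (at r within {0..r + 1}) (ou_int a b c w)"
    by (rule has_vector_derivative_continuous[OF ou_int_has_vector_derivative]) (use assms r in auto)
  also have "at r within {0..r + 1} = at r within {0..}"
    by (rule at_within_nhd[of _ "{..<r + 1}"]) auto
  finally show "continuous (at r within {0..}) (ou_int a b c w)" .
qed

lemma ou_sol_has_integral:
  assumes w: "continuous_on {0..} w" and "0 \<le> t" "t \<le> s"
  shows "((\<lambda>r. a + b * ou_sol a b c w t x r) has_integral
          (ou_sol a b c w t x s - c * w s - (x - c * w t))) {t..s}"
proof -
  define z where "z r = exp (b * (r - t)) * (x - c * w t) + exp (b * r) * (ou_int a b c w r - ou_int a b c w t)" for r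
  have z: "ou_sol a b c w t x r = c * w r + z r" for r by (simp add: ou_sol_def z_def)
  have "(z has_vector_derivative a + b * ou_sol a b c w t x r) (at r within {t..s})" if r: "r \<in> {t..s}" for r
  proof -
    have "(ou_int a b c w has_real_derivative exp (- b * r) * (a + b * c * w r)) (at r within {t..s})"
      using ou_int_has_vector_derivative[OF w, of r s a b c] r assms
      by (auto simp: has_real_derivative_iff_has_vector_derivative intro: has_vector_derivative_within_subset)
    note [derivative_intros] = this
    have "(z has_real_derivative b * z r + exp (b * r) * (exp (- b * r) * (a + b * c * w r))) (at r within {t..s})"
      unfolding z_def by (auto intro!: derivative_eq_intros simp: algebra_simps)
    also have "exp (b * r) * (exp (- b * r) * (a + b * c * w r)) = a + b * c * w r"
      by (simp add: mult.assoc[symmetric] exp_add[symmetric])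
    also have "b * z r + (a + b * c * w r) = a + b * ou_sol a b c w t x r" by (simp add: z algebra_simps)
    finally show ?thesis by (simp add: has_real_derivative_iff_has_vector_derivative)
  qed
  then have "((\<lambda>r. a + b * ou_sol a b c w t x r) has_integral z s - z t) {t..s}"
    by (intro fundamental_theorem_of_calculus assms)
  then show ?thesis by (simp add: z z_def)
qed

lemma continuous_on_ou_sol:
  assumes w: "continuous_on {0..} w"
    and "continuous_on S f" "continuous_on S g" "continuous_on S h"
    and "\<And>p. p \<in> S \<Longrightarrow> 0 \<le> f p" "\<And>p. p \<in> S \<Longrightarrow> 0 \<le> h p"
  shows "continuous_on S (\<lambda>p. ou_sol a b c w (f p) (g p) (h p))"
proof -
  have "continuous_on S (\<lambda>p. ou_int a b c w (f p))" "continuous_on S (\<lambda>p. ou_int a b c w (h p))"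
    by (rule continuous_on_compose2[OF continuous_on_ou_int[OF w]]; use assms in auto)+
  moreover have "continuous_on S (\<lambda>p. w (f p))" "continuous_on S (\<lambda>p. w (h p))"
    by (rule continuous_on_compose2[OF w]; use assms in force)+
  ultimately show ?thesis unfolding ou_sol_def by (intro continuous_intros assms)
qed

text \<open>In place of Gronwall: \<open>exp (- b * r)\<close> times the integral of
  \<open>d\<close> up to \<open>r\<close> has derivative 0 and starts at 0.\<close>

lemma linear_integral_eq_zero:
  fixes d :: "real \<Rightarrow> real"
  assumes d: "continuous_on {t..} d" and eq: "\<And>s. s \<ge> t \<Longrightarrow> d s = b * integral {t..s} d" and s: "s \<ge> t"
  shows "d s = 0"
proof -
  have "((\<lambda>r. exp (- b * r) * integral {t..r} d) has_field_derivative 0) (at r within {t..s})"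
    if r: "r \<in> {t..s}" for r
  proof -
    have "((\<lambda>u. integral {t..u} d) has_real_derivative d r) (at r within {t..s})"
      unfolding has_real_derivative_iff_has_vector_derivative
      by (rule integral_has_vector_derivative) (use r d in \<open>auto intro: continuous_on_subset\<close>)
    moreover have "((\<lambda>r. exp (- b * r)) has_real_derivative - b * exp (- b * r)) (at r within {t..s})"
      by (auto intro!: derivative_eq_intros)
    ultimately have "((\<lambda>r. exp (- b * r) * integral {t..r} d) has_real_derivative
        - b * exp (- b * r) * integral {t..r} d + d r * exp (- b * r)) (at r within {t..s})"
      by (rule DERIV_mult[rotated])
    moreover have "d r = b * integral {t..r} d" by (rule eq) (use r in auto)
    ultimately show ?thesis by simp
  qed
  then obtain C where "\<And>r. r \<in> {t..s} \<Longrightarrow> exp (- b * r) * integral {t..r} d = C"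
    using has_field_derivative_zero_constant[of "{t..s}" "\<lambda>r. exp (- b * r) * integral {t..r} d"] by auto
  from this[of t] this[of s] have "integral {t..s} d = 0" using s by auto
  then show ?thesis using eq[OF s] by simp
qed

text \<open>Resolves the definite description: \<open>ou_sol_has_integral\<close> gives existence,
  and the difference of two solutions satisfies the homogeneous equation. \<open>max s t\<close>
  reproduces the constant value \<open>x\<close> before the starting time.\<close>

lemma ou_path_eq:
  assumes w: "continuous_on {0..} w" and t: "0 \<le> t"
  shows "ou_path a b c w t x = (\<lambda>s. ou_sol a b c w t x (max s t))"
  unfolding ou_path_def
proof (rule the_equality)
  define Y where "Y s = ou_sol a b c w t x (max s t)" for s
  have Yc: "continuous_on {t..} Y"
    unfolding Y_def by (rule continuous_on_ou_sol[OF w]) (use t in \<open>auto intro!: continuous_intros\<close>)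
  have Yi: "Y s = x + integral {t..s} (\<lambda>r. a + b * Y r) + c * (w s - w t)" if "s \<ge> t" for s
  proof -
    have "integral {t..s} (\<lambda>r. a + b * Y r) = integral {t..s} (\<lambda>r. a + b * ou_sol a b c w t x r)"
      by (intro integral_cong) (auto simp: Y_def max_def)
    also have "\<dots> = ou_sol a b c w t x s - c * w s - (x - c * w t)"
      by (intro integral_unique ou_sol_has_integral w t that)
    finally show ?thesis using that by (simp add: Y_def max_def algebra_simps)
  qed
  show "continuous_on {t..} (\<lambda>s. ou_sol a b c w t x (max s t)) \<and>
    (\<forall>s\<ge>t. ou_sol a b c w t x (max s t) = x + integral {t..s} (\<lambda>r. a + b * ou_sol a b c w t x (max r t)) + c * (w s - w t)) \<and>
    (\<forall>s<t. ou_sol a b c w t x (max s t) = x)"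
    by (intro conjI allI impI Yc[unfolded Y_def] Yi[unfolded Y_def]) (simp_all add: max_def)
  fix y assume y: "continuous_on {t..} y \<and>
    (\<forall>s\<ge>t. y s = x + integral {t..s} (\<lambda>r. a + b * y r) + c * (w s - w t)) \<and> (\<forall>s<t. y s = x)"
  have int: "f integrable_on {t..s}" if "continuous_on {t..} f" for f :: "real \<Rightarrow> real" and s
    by (rule integrable_continuous_real) (rule continuous_on_subset[OF that], auto)
  have "y s = Y s" for s
  proof (cases "s \<ge> t")
    case True
    have "(\<lambda>s. y s - Y s) s = 0"
    proof (rule linear_integral_eq_zero[where t = t and d = "\<lambda>s. y s - Y s" and b = b])
      show "continuous_on {t..} (\<lambda>s. y s - Y s)" by (intro continuous_intros conjunct1[OF y] Yc)
      fix s assume s: "s \<ge> t"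
      have "y s - Y s = integral {t..s} (\<lambda>r. a + b * y r) - integral {t..s} (\<lambda>r. a + b * Y r)"
      proof -
        have "y s = x + integral {t..s} (\<lambda>r. a + b * y r) + c * (w s - w t)" using y s by blast
        then show ?thesis using Yi[OF s] by linarith
      qed
      also have "\<dots> = integral {t..s} (\<lambda>r. (a + b * y r) - (a + b * Y r))"
        by (rule Henstock_Kurzweil_Integration.integral_diff[symmetric]; rule int; intro continuous_intros conjunct1[OF y] Yc)
      also have "\<dots> = integral {t..s} (\<lambda>r. b * (y r - Y r))"
        by (intro integral_cong) (simp add: algebra_simps)
      finally show "y s - Y s = b * integral {t..s} (\<lambda>r. y r - Y r)" by simp
    qed (use True in auto)
    then show ?thesis by simp
  next
    case False
    then have "y s = x" using y by (meson linorder_not_le)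
    then show ?thesis using False by (simp add: Y_def max_def)
  qed
  then show "y = (\<lambda>s. ou_sol a b c w t x (max s t))" by (auto simp: Y_def)
qed

text \<open>The equation that characterises the path sees only the increments of \<open>w\<close>
  after \<open>t\<close>, so both drivers satisfy the same description. This is what makes the
  restarted path independent of the past.\<close>

lemma ou_sol_eq_future:
  assumes w: "continuous_on {0..} w" and ts: "0 \<le> t" "t \<le> s"
  shows "ou_sol a b c (\<lambda>r. w (max r t) - w t) t x s = ou_sol a b c w t x s"
proof -
  define w' where "w' r = w (max r t) - w t" for r
  have w': "continuous_on {0..} w'" unfolding w'_def
    by (intro continuous_intros continuous_on_compose2[OF w]) (use ts in \<open>auto intro!: continuous_intros\<close>)
  have "ou_path a b c w' t x = ou_path a b c w t x"
  proof -
    have "(\<lambda>y. continuous_on {t..} y \<and>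
      (\<forall>s\<ge>t. y s = x + integral {t..s} (\<lambda>r. a + b * y r) + c * (w' s - w' t)) \<and> (\<forall>s<t. y s = x)) =
      (\<lambda>y. continuous_on {t..} y \<and>
      (\<forall>s\<ge>t. y s = x + integral {t..s} (\<lambda>r. a + b * y r) + c * (w s - w t)) \<and> (\<forall>s<t. y s = x))"
      by (auto simp: w'_def max_def fun_eq_iff)
    then show ?thesis unfolding ou_path_def by simp
  qed
  then have "ou_path a b c w' t x s = ou_path a b c w t x s" by simp
  then have "ou_sol a b c w' t x s = ou_sol a b c w t x s"
    using ts by (simp only: ou_path_eq[OF w'] ou_path_eq[OF w] max_absorb1)
  then show ?thesis by (simp only: w'_def[abs_def])
qed

text \<open>\<open>N\<close> is arbitrary and \<open>w r\<close> is assumed measurable only up to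
  time \<open>s\<close>: the lemma serves the full algebra as well as those of the past and of the
  future.\<close>

lemma borel_measurable_ou_sol:
  assumes cont: "\<And>\<omega>. \<omega> \<in> space N \<Longrightarrow> continuous_on {0..} (\<lambda>r. w r \<omega>)"
    and meas: "\<And>r. 0 \<le> r \<Longrightarrow> r \<le> s \<Longrightarrow> w r \<in> borel_measurable N"
    and ts: "0 \<le> t" "t \<le> s"
  shows "(\<lambda>\<omega>. ou_sol a b c (\<lambda>r. w r \<omega>) t x s) \<in> borel_measurable N"
proof -
  have "(\<lambda>\<omega>. ou_int a b c (\<lambda>r. w r \<omega>) v) \<in> borel_measurable N" if "0 \<le> v" "v \<le> s" for v
    unfolding ou_int_def
  proof (rule borel_measurable_integral_param[OF that(1)])
    show "continuous_on {0..v} (\<lambda>r. exp (- b * r) * (a + b * c * w r \<omega>))" if "\<omega> \<in> space N" for \<omega>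
      by (intro continuous_intros continuous_on_subset[OF cont[OF that]]) auto
    fix r assume "r \<in> {0..v}"
    then have [measurable]: "w r \<in> borel_measurable N" using meas that by auto
    show "(\<lambda>\<omega>. exp (- b * r) * (a + b * c * w r \<omega>)) \<in> borel_measurable N" by measurable
  qed
  then have [measurable]: "(\<lambda>\<omega>. ou_int a b c (\<lambda>r. w r \<omega>) s) \<in> borel_measurable N"
      "(\<lambda>\<omega>. ou_int a b c (\<lambda>r. w r \<omega>) t) \<in> borel_measurable N"
    using ts by auto
  have [measurable]: "w s \<in> borel_measurable N" "w t \<in> borel_measurable N" using meas ts by auto
  show ?thesis unfolding ou_sol_def by measurable
qed

text \<open>A linear bound with one \<open>K\<close> for all paths, times and starting points; it
  carries the Gaussian integrability of the maximum of \<open>W\<close> over to the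
  diffusion.\<close>

lemma ou_sol_bound:
  obtains K where "K \<ge> 1"
    "\<And>w t s x Z. continuous_on {0..} w \<Longrightarrow> t \<in> {0..T} \<Longrightarrow> s \<in> {0..T} \<Longrightarrow>
       (\<And>r. r \<in> {0..T} \<Longrightarrow> \<bar>w r\<bar> \<le> Z) \<Longrightarrow> \<bar>ou_sol a b c w t x s\<bar> \<le> K * (1 + \<bar>x\<bar> + Z)"
proof -
  \<comment> \<open>Bounds every factor \<open>exp (b * u)\<close> with \<open>u\<close> between
    \<open>-T\<close> and \<open>T\<close>.\<close>
  define E where "E = exp (\<bar>b\<bar> * T)"
  define K where "K = 1 + \<bar>c\<bar> + E * (1 + \<bar>c\<bar>) + E * (2 * T * (E * (\<bar>a\<bar> + \<bar>b * c\<bar>)))"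
  have "\<bar>ou_sol a b c w t x s\<bar> \<le> K * (1 + \<bar>x\<bar> + Z)"
    if w: "continuous_on {0..} w" and ts: "t \<in> {0..T}" "s \<in> {0..T}" and Z: "\<And>r. r \<in> {0..T} \<Longrightarrow> \<bar>w r\<bar> \<le> Z" for w t s x Z
  proof -
    have T: "T \<ge> 0" using ts by auto
    have Z0: "Z \<ge> 0" using Z[OF ts(1)] by linarith
    have E: "exp (b * u) \<le> E" if "\<bar>u\<bar> \<le> T" for u
    proof -
      have "b * u \<le> \<bar>b\<bar> * \<bar>u\<bar>" by (simp add: abs_mult[symmetric])
      also have "\<dots> \<le> \<bar>b\<bar> * T" using that by (intro mult_left_mono) auto
      finally show ?thesis by (simp add: E_def)
    qed
    have E0: "E \<ge> 0" by (simp add: E_def)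
    have I: "\<bar>ou_int a b c w u\<bar> \<le> T * (E * (\<bar>a\<bar> + \<bar>b * c\<bar> * Z))" if u: "u \<in> {0..T}" for u
    proof -
      have "norm (ou_int a b c w u) \<le> (E * (\<bar>a\<bar> + \<bar>b * c\<bar> * Z)) * (u - 0)" unfolding ou_int_def
      proof (rule integral_bound)
        show "0 \<le> u" using u by auto
        show "continuous_on {0..u} (\<lambda>r. exp (- b * r) * (a + b * c * w r))"
          by (intro continuous_intros continuous_on_subset[OF w]) auto
        fix r assume r: "r \<in> {0..u}"
        have "\<bar>a + b * c * w r\<bar> \<le> \<bar>a\<bar> + \<bar>b * c\<bar> * \<bar>w r\<bar>" by (simp add: abs_mult[symmetric] abs_triangle_ineq)
        also have "\<dots> \<le> \<bar>a\<bar> + \<bar>b * c\<bar> * Z" using r u by (intro add_left_mono mult_left_mono Z) auto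
        finally show "norm (exp (- b * r) * (a + b * c * w r)) \<le> E * (\<bar>a\<bar> + \<bar>b * c\<bar> * Z)"
          using E[of "-r"] r u E0 unfolding real_norm_def abs_mult by (intro mult_mono) auto
      qed
      also have "\<dots> \<le> (E * (\<bar>a\<bar> + \<bar>b * c\<bar> * Z)) * T" using u E0 Z0 by (intro mult_left_mono) auto
      finally show ?thesis by (simp add: mult_ac)
    qed
    have 1: "\<bar>c * w s\<bar> \<le> \<bar>c\<bar> * Z" using Z[OF ts(2)] by (simp add: abs_mult mult_left_mono)
    have "\<bar>x - c * w t\<bar> \<le> \<bar>x\<bar> + \<bar>c\<bar> * \<bar>w t\<bar>" by (simp add: abs_mult[symmetric] abs_triangle_ineq4)
    also have "\<dots> \<le> \<bar>x\<bar> + \<bar>c\<bar> * Z" using ts by (intro add_left_mono mult_left_mono Z) auto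
    finally have 2: "\<bar>exp (b * (s - t)) * (x - c * w t)\<bar> \<le> E * (\<bar>x\<bar> + \<bar>c\<bar> * Z)"
      using E[of "s - t"] ts E0 unfolding abs_mult by (intro mult_mono) auto
    have "\<bar>ou_int a b c w s - ou_int a b c w t\<bar> \<le> 2 * T * (E * (\<bar>a\<bar> + \<bar>b * c\<bar> * Z))"
      using I[OF ts(1)] I[OF ts(2)] by linarith
    then have 3: "\<bar>exp (b * s) * (ou_int a b c w s - ou_int a b c w t)\<bar> \<le> E * (2 * T * (E * (\<bar>a\<bar> + \<bar>b * c\<bar> * Z)))"
      using E[of "s"] ts E0 unfolding abs_mult by (intro mult_mono) auto
    define B where "B = 1 + \<bar>x\<bar> + Z"
    have B: "B \<ge> 0" "Z \<le> B" "\<bar>x\<bar> \<le> B" "1 \<le> B" using Z0 by (auto simp: B_def)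
    have "\<bar>ou_sol a b c w t x s\<bar> \<le> \<bar>c\<bar> * Z + E * (\<bar>x\<bar> + \<bar>c\<bar> * Z) + E * (2 * T * (E * (\<bar>a\<bar> + \<bar>b * c\<bar> * Z)))"
      unfolding ou_sol_def using 1 2 3 by linarith
    also have "\<dots> \<le> \<bar>c\<bar> * B + E * (B + \<bar>c\<bar> * B) + E * (2 * T * (E * (\<bar>a\<bar> * B + \<bar>b * c\<bar> * B)))"
      using B E0 T mult_left_mono[OF B(4), of "\<bar>a\<bar>"] by (intro add_mono mult_left_mono) auto
    also have "\<dots> \<le> K * B"
      using B(1) by (simp add: K_def algebra_simps)
    finally show ?thesis by (simp add: B_def)
  qed
  moreover have "K \<ge> 1" if "T \<ge> 0" using that by (simp add: K_def E_def)
  ultimately show thesis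
  proof (cases "T \<ge> 0")
    \<comment> \<open>For negative \<open>T\<close> the interval is empty and any constant
      serves.\<close>
    case False
    then show thesis by (intro that[of 1]) auto
  qed (use that in blast)
qed

section \<open>Brownian motion\<close>

text \<open>\<open>P\<close> and \<open>Q\<close> stand for sub-algebras; their independence is that
  of the identity maps into them. So the law of the diagonal pair on \<open>P\<close> times
  \<open>Q\<close> is the product of the marginals, and Fubini integrates the second coordinate
  while the first, with it \<open>Y\<close>, stays frozen.\<close>

lemma (in prob_space) expectation_freeze:
  fixes F :: "real \<Rightarrow> 'a \<Rightarrow> complex" and \<Phi> :: "'a \<Rightarrow> complex"
  assumes ind: "indep_var P (\<lambda>\<omega>. \<omega>) Q (\<lambda>\<omega>. \<omega>)"
    and sp: "space P = space M" "space Q = space M"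
    and [measurable]: "\<Phi> \<in> borel_measurable P" "Y \<in> borel_measurable P"
      "(\<lambda>(y, \<omega>). F y \<omega>) \<in> borel_measurable (borel \<Otimes>\<^sub>M Q)"
    and bnd: "\<And>\<omega>. \<omega> \<in> space M \<Longrightarrow> norm (\<Phi> \<omega>) \<le> 1" "\<And>y \<omega>. \<omega> \<in> space M \<Longrightarrow> norm (F y \<omega>) \<le> 1"
  shows "(\<integral>\<omega>. \<Phi> \<omega> * F (Y \<omega>) \<omega> \<partial>M) = (\<integral>\<omega>. \<Phi> \<omega> * (\<integral>\<omega>'. F (Y \<omega>) \<omega>' \<partial>M) \<partial>M)"
proof -
  have rv [measurable]: "(\<lambda>\<omega>. \<omega>) \<in> measurable M P" "(\<lambda>\<omega>. \<omega>) \<in> measurable M Q"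
    and D: "distr M P (\<lambda>\<omega>. \<omega>) \<Otimes>\<^sub>M distr M Q (\<lambda>\<omega>. \<omega>) = distr M (P \<Otimes>\<^sub>M Q) (\<lambda>\<omega>. (\<omega>, \<omega>))"
    using ind by (auto simp: indep_var_distribution_eq)
  let ?P = "distr M P (\<lambda>\<omega>. \<omega>)" and ?Q = "distr M Q (\<lambda>\<omega>. \<omega>)"
  interpret P: prob_space ?P by (rule prob_space_distr) measurable
  interpret Q: prob_space ?Q by (rule prob_space_distr) measurable
  interpret PQ: pair_prob_space ?P ?Q ..
  define G where "G = (\<lambda>(\<omega>1, \<omega>2). \<Phi> \<omega>1 * F (Y \<omega>1) \<omega>2)"
  have F2: "(\<lambda>p. F (Y (fst p)) (snd p)) \<in> borel_measurable (P \<Otimes>\<^sub>M Q)"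
    using measurable_compose[of "\<lambda>p. (Y (fst p), snd p)" "P \<Otimes>\<^sub>M Q" "borel \<Otimes>\<^sub>M Q" "\<lambda>(y, \<omega>). F y \<omega>" borel]
    by simp
  then have Gm [measurable]: "G \<in> borel_measurable (P \<Otimes>\<^sub>M Q)"
    unfolding G_def case_prod_beta' by measurable
  have Gb: "norm (G p) \<le> 1" if "p \<in> space (P \<Otimes>\<^sub>M Q)" for p
    using that mult_mono[OF bnd, of "fst p" "snd p" "Y (fst p)"] sp
    by (auto simp: G_def space_pair_measure case_prod_beta' norm_mult)
  have Fm: "F y \<in> borel_measurable Q" for y
    using measurable_compose[of "\<lambda>\<omega>. (y, \<omega>)" Q "borel \<Otimes>\<^sub>M Q" "\<lambda>(y, \<omega>). F y \<omega>" borel] by simp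
  have "(\<integral>\<omega>. \<Phi> \<omega> * F (Y \<omega>) \<omega> \<partial>M) = (\<integral>p. G p \<partial>distr M (P \<Otimes>\<^sub>M Q) (\<lambda>\<omega>. (\<omega>, \<omega>)))"
    by (subst integral_distr) (auto simp: G_def)
  also have "\<dots> = (\<integral>p. G p \<partial>(?P \<Otimes>\<^sub>M ?Q))" by (simp add: D)
  also have "\<dots> = (\<integral>\<omega>1. (\<integral>\<omega>2. G (\<omega>1, \<omega>2) \<partial>?Q) \<partial>?P)"
  proof (rule PQ.integral_fst'[symmetric])
    show "integrable (?P \<Otimes>\<^sub>M ?Q) G"
      by (rule finite_measure.integrable_const_bound[where B = 1])
         (use Gb in \<open>auto simp: space_pair_measure intro!: AE_I2 PQ.P.finite_measure_axioms\<close>)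
  qed
  also have "\<dots> = (\<integral>\<omega>1. \<Phi> \<omega>1 * (\<integral>\<omega>2. F (Y \<omega>1) \<omega>2 \<partial>?Q) \<partial>?P)"
    by (simp add: G_def)
  also have "\<dots> = (\<integral>\<omega>1. \<Phi> \<omega>1 * (\<integral>\<omega>2. F (Y \<omega>1) \<omega>2 \<partial>M) \<partial>?P)"
    by (simp add: integral_distr Fm)
  also have "\<dots> = (\<integral>\<omega>. \<Phi> \<omega> * (\<integral>\<omega>'. F (Y \<omega>) \<omega>' \<partial>M) \<partial>M)"
  proof (rule integral_distr)
    have "(\<lambda>\<omega>1. \<integral>\<omega>2. F (Y \<omega>1) \<omega>2 \<partial>?Q) \<in> borel_measurable P"
      by (rule Q.borel_measurable_lebesgue_integral)
         (use F2 in \<open>simp add: case_prod_beta' cong: measurable_cong_sets sets_pair_measure_cong\<close>)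
    then have [measurable]: "(\<lambda>\<omega>1. \<integral>\<omega>2. F (Y \<omega>1) \<omega>2 \<partial>M) \<in> borel_measurable P"
      by (simp add: integral_distr Fm)
    show "(\<lambda>\<omega>. \<Phi> \<omega> * (\<integral>\<omega>'. F (Y \<omega>) \<omega>' \<partial>M)) \<in> borel_measurable P" by measurable
  qed measurable
  finally show ?thesis .
qed

lemma integrable_normal_density_exp_square:
  assumes "\<sigma> > 0" "l < 1 / (2 * \<sigma>\<^sup>2)"
  shows "integrable lborel (\<lambda>x. normal_density 0 \<sigma> x * exp (l * x\<^sup>2))"
proof -
  \<comment> \<open>The inverse variance of the tilted Gaussian, positive by the bound on
    \<open>l\<close>.\<close>
  define d where "d = 1 / \<sigma>\<^sup>2 - 2 * l"
  have d: "d > 0" using assms by (simp add: d_def field_simps)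
  define \<rho> where "\<rho> = 1 / sqrt d"
  have \<rho>: "\<rho> > 0" "1 / \<rho>\<^sup>2 = d" using d by (auto simp: \<rho>_def power_divide)
  have "normal_density 0 \<sigma> x * exp (l * x\<^sup>2) =
      sqrt (2 * pi * \<rho>\<^sup>2) / sqrt (2 * pi * \<sigma>\<^sup>2) * normal_density 0 \<rho> x" for x
  proof -
    have "- x\<^sup>2 / (2 * \<sigma>\<^sup>2) + l * x\<^sup>2 = - (x\<^sup>2 / 2) * (1 / \<sigma>\<^sup>2 - 2 * l)"
      by (simp add: algebra_simps)
    also have "\<dots> = - x\<^sup>2 / (2 * \<rho>\<^sup>2)" using \<rho>(2) by (simp add: d_def[symmetric] \<rho>(2)[symmetric])
    finally have "exp (- x\<^sup>2 / (2 * \<sigma>\<^sup>2)) * exp (l * x\<^sup>2) = exp (- x\<^sup>2 / (2 * \<rho>\<^sup>2))"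
      by (simp add: exp_add[symmetric])
    then show ?thesis using \<rho>(1) by (simp add: normal_density_def mult.assoc)
  qed
  then show ?thesis using \<rho>(1) by simp
qed

fun runmax :: "(nat \<Rightarrow> real) \<Rightarrow> nat \<Rightarrow> real" where
  "runmax Y 0 = Y 0"
| "runmax Y (Suc n) = max (runmax Y n) (Y (Suc n))"

lemma runmax_ge: "k \<le> n \<Longrightarrow> Y k \<le> runmax Y n"
  by (induction n) (auto simp: le_Suc_eq)

lemma runmax_le: "(\<And>k. k \<le> n \<Longrightarrow> Y k \<le> B) \<Longrightarrow> runmax Y n \<le> B"
  by (induction n) auto

text \<open>The right-hand side is linear in the increments of \<open>Y\<close>, so taking expectations yields the
  maximal inequality without stopping times.\<close>

lemma pathwise_Doob_L2:
  "(runmax Y n)\<^sup>2 \<le> 4 * (Y n)\<^sup>2 - 4 * (\<Sum>k<n. runmax Y k * (Y (Suc k) - Y k))"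
proof -
  \<comment> \<open>A discrete integration by parts. In the step the old maximum \<open>m\<close> is
    replaced by \<open>max m y\<close>; since \<open>m * y - m^2 / 2\<close> increases in
    \<open>m\<close> up to \<open>y\<close>, the bound can only improve.\<close>
  have "(\<Sum>k<n. runmax Y k * (Y (Suc k) - Y k)) \<le> runmax Y n * Y n - (runmax Y n)\<^sup>2 / 2"
  proof (induction n)
    case (Suc n)
    define m y where "m = runmax Y n" and "y = Y (Suc n)"
    have "m * y - m\<^sup>2 / 2 \<le> max m y * y - (max m y)\<^sup>2 / 2"
      using zero_le_power2[of "m - y"] by (auto simp: max_def power2_eq_square algebra_simps)
    then show ?case using Suc by (simp add: m_def y_def algebra_simps)
  qed (simp add: power2_eq_square)
  \<comment> \<open>Young's inequality weighted so that a quarter of the squared maximum is left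
    over, whence Doob's constant 4.\<close>
  moreover have "runmax Y n * Y n \<le> (runmax Y n)\<^sup>2 / 4 + (Y n)\<^sup>2"
    using zero_le_power2[of "runmax Y n / 2 - Y n"] by (simp add: power2_eq_square algebra_simps)
  ultimately show ?thesis by simp
qed

text \<open>The convex function \<open>exp (e * s^2)\<close> lies above its tangents. This trades an
  increment of \<open>exp (e * W^2)\<close> for a multiple of an increment of \<open>W\<close>,
  which has mean zero given the past.\<close>

lemma exp_square_tangent:
  fixes e s s' :: real
  assumes "e \<ge> 0"
  shows "2 * e * s * exp (e * s\<^sup>2) * (s' - s) \<le> exp (e * s'\<^sup>2) - exp (e * s\<^sup>2)"
proof -
  have "2 * s * (s' - s) \<le> s'\<^sup>2 - s\<^sup>2"
    using zero_le_power2[of "s' - s"] by (simp add: power2_eq_square algebra_simps)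
  then have "exp (e * s\<^sup>2) * (e * (2 * s * (s' - s))) \<le> exp (e * s\<^sup>2) * (e * (s'\<^sup>2 - s\<^sup>2))"
    using assms by (intro mult_left_mono) auto
  also have "\<dots> \<le> exp (e * s\<^sup>2) * (exp (e * (s'\<^sup>2 - s\<^sup>2)) - 1)"
    using exp_ge_add_one_self[of "e * (s'\<^sup>2 - s\<^sup>2)"] by (intro mult_left_mono) (linarith, simp)
  also have "\<dots> = exp (e * s'\<^sup>2) - exp (e * s\<^sup>2)"
    by (simp add: right_diff_distrib exp_add[symmetric])
  finally show ?thesis by (simp only: mult_ac)
qed

section \<open>Independence of past and future increments, and the maximum of a Brownian
  path\<close>

locale brownian = prob_space M for M :: "'w measure" +
  fixes W :: "real \<Rightarrow> 'w \<Rightarrow> real"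
  assumes BM: "brownian_motion M W"
begin

lemma W_measurable: "0 \<le> t \<Longrightarrow> W t \<in> borel_measurable M"
  using BM by (simp add: brownian_motion_def)

lemma W_zero: "\<omega> \<in> space M \<Longrightarrow> W 0 \<omega> = 0"
  and W_continuous: "\<omega> \<in> space M \<Longrightarrow> continuous_on {0..} (\<lambda>t. W t \<omega>)"
  using BM by (simp_all add: brownian_motion_def)

lemma W_increment_distributed: "0 \<le> s \<Longrightarrow> s < t \<Longrightarrow>
    distributed M lborel (\<lambda>\<omega>. W t \<omega> - W s \<omega>) (\<lambda>y. ennreal (normal_density 0 (sqrt (t - s)) y))"
  using BM by (simp add: brownian_motion_def)

lemma W_increments_indep:
  fixes ts :: "nat \<Rightarrow> real"
  assumes "0 \<le> ts 0" "\<And>i. i < n \<Longrightarrow> ts i < ts (Suc i)"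
  shows "indep_vars (\<lambda>_. borel) (\<lambda>i \<omega>. W (ts (Suc i)) \<omega> - W (ts i) \<omega>) {..<n}"
  using BM assms unfolding brownian_motion_def by blast

text \<open>Dyadic grids are nested, so the algebras they generate increase and their union is
  intersection stable.\<close>

definition dyadic :: "real \<Rightarrow> real \<Rightarrow> nat \<Rightarrow> nat \<Rightarrow> real" where
  "dyadic s l n i = s + real i * l / 2 ^ n"

definition increment_events :: "real \<Rightarrow> real \<Rightarrow> nat \<Rightarrow> nat \<Rightarrow> 'w set set" where
  "increment_events s l n i =
     {(\<lambda>\<omega>. W (dyadic s l n (Suc i)) \<omega> - W (dyadic s l n i) \<omega>) -` A \<inter> space M | A. A \<in> sets borel}"

definition dyadic_alg :: "real \<Rightarrow> real \<Rightarrow> nat \<Rightarrow> 'w measure" where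
  "dyadic_alg s l n = sigma (space M) (\<Union>i<2 ^ n. increment_events s l n i)"

text \<open>The events determined by the increments of \<open>W\<close> on
  \<open>[s, s + l]\<close>: the second argument is a length, not an end point.\<close>

definition path_alg :: "real \<Rightarrow> real \<Rightarrow> 'w measure" where
  "path_alg s l = sigma (space M) (\<Union>n. sets (dyadic_alg s l n))"

lemma space_dyadic_alg [simp]: "space (dyadic_alg s l n) = space M"
  and space_path_alg [simp]: "space (path_alg s l) = space M"
  by (simp_all add: dyadic_alg_def path_alg_def space_measure_of_conv)

lemma sets_dyadic_alg:
  "sets (dyadic_alg s l n) = sigma_sets (space M) (\<Union>i<2 ^ n. increment_events s l n i)"
  unfolding dyadic_alg_def by (rule sets_measure_of) (auto simp: increment_events_def)

lemma sets_path_alg: "sets (path_alg s l) = sigma_sets (space M) (\<Union>n. sets (dyadic_alg s l n))"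
  unfolding path_alg_def by (rule sets_measure_of) (use sets.sets_into_space in force)

lemma increment_measurable_dyadic_alg:
  assumes "i < 2 ^ n"
  shows "(\<lambda>\<omega>. W (dyadic s l n (Suc i)) \<omega> - W (dyadic s l n i) \<omega>) \<in> borel_measurable (dyadic_alg s l n)"
  using assms by (intro measurableI) (auto simp: sets_dyadic_alg increment_events_def intro!: sigma_sets.Basic)

text \<open>A coarse increment is the sum of two consecutive fine ones.\<close>

lemma dyadic_alg_Suc: "sets (dyadic_alg s l n) \<subseteq> sets (dyadic_alg s l (Suc n))"
proof -
  have "(\<Union>i<2 ^ n. increment_events s l n i) \<subseteq> sets (dyadic_alg s l (Suc n))"
  proof
    fix X assume "X \<in> (\<Union>i<2 ^ n. increment_events s l n i)"
    then obtain i where i: "i < 2 ^ n" and X: "X \<in> increment_events s l n i" by auto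
    have d: "dyadic s l n j = dyadic s l (Suc n) (2 * j)" for j by (simp add: dyadic_def)
    have inc: "(\<lambda>\<omega>. W (dyadic s l (Suc n) (Suc j)) \<omega> - W (dyadic s l (Suc n) j) \<omega>)
        \<in> borel_measurable (dyadic_alg s l (Suc n))" if "j = 2 * i \<or> j = Suc (2 * i)" for j
      by (rule increment_measurable_dyadic_alg) (use i that in auto)
    have "(\<lambda>\<omega>. (W (dyadic s l (Suc n) (Suc (Suc (2 * i)))) \<omega> - W (dyadic s l (Suc n) (Suc (2 * i))) \<omega>)
        + (W (dyadic s l (Suc n) (Suc (2 * i))) \<omega> - W (dyadic s l (Suc n) (2 * i)) \<omega>))
        \<in> borel_measurable (dyadic_alg s l (Suc n))"
      by (intro borel_measurable_add inc) simp_all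
    then have m: "(\<lambda>\<omega>. W (dyadic s l n (Suc i)) \<omega> - W (dyadic s l n i) \<omega>) \<in> borel_measurable (dyadic_alg s l (Suc n))"
      by (simp add: d)
    obtain A where A: "A \<in> sets borel"
      "X = (\<lambda>\<omega>. W (dyadic s l n (Suc i)) \<omega> - W (dyadic s l n i) \<omega>) -` A \<inter> space M"
      using X by (auto simp: increment_events_def)
    show "X \<in> sets (dyadic_alg s l (Suc n))" unfolding A(2) using measurable_sets[OF m A(1)] by simp
  qed
  then have "sigma_sets (space (dyadic_alg s l (Suc n))) (\<Union>i<2 ^ n. increment_events s l n i) \<subseteq> sets (dyadic_alg s l (Suc n))"
    by (rule sets.sigma_sets_subset)
  then show ?thesis by (simp add: sets_dyadic_alg[of s l n])
qed

lemma dyadic_alg_mono: "n \<le> m \<Longrightarrow> sets (dyadic_alg s l n) \<subseteq> sets (dyadic_alg s l m)"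
  by (rule lift_Suc_mono_le[of "\<lambda>n. sets (dyadic_alg s l n)"]) (rule dyadic_alg_Suc)

lemma Int_stable_dyadic_alg: "Int_stable (\<Union>n. sets (dyadic_alg s l n))"
proof (rule Int_stableI)
  fix A B assume "A \<in> (\<Union>n. sets (dyadic_alg s l n))" "B \<in> (\<Union>n. sets (dyadic_alg s l n))"
  then obtain n m where "A \<in> sets (dyadic_alg s l n)" "B \<in> sets (dyadic_alg s l m)" by auto
  then have "A \<inter> B \<in> sets (dyadic_alg s l (max n m))"
    using dyadic_alg_mono[of n "max n m" s l] dyadic_alg_mono[of m "max n m" s l] by (intro sets.Int) auto
  then show "A \<inter> B \<in> (\<Union>n. sets (dyadic_alg s l n))" by auto
qed

lemma dyadic_alg_subset_events:
  assumes "0 \<le> s" "0 \<le> l"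
  shows "sets (dyadic_alg s l n) \<subseteq> events"
  unfolding sets_dyadic_alg
proof (rule sets.sigma_sets_subset, safe)
  fix i X assume "X \<in> increment_events s l n i"
  moreover have [measurable]: "W (dyadic s l n j) \<in> borel_measurable M" for j
    by (rule W_measurable) (use assms in \<open>simp add: dyadic_def\<close>)
  ultimately show "X \<in> events" by (auto simp: increment_events_def)
qed

text \<open>The grids of \<open>[0, t]\<close> and \<open>[t, t + l]\<close> are joined into one
  increasing sequence of times, so the independence of increments applies once; its first and second
  halves generate the two algebras.\<close>

lemma indep_dyadic_algs:
  assumes "0 < t" "0 < l"
  shows "indep_set (sets (dyadic_alg 0 t n)) (sets (dyadic_alg t l n))"
proof -
  define N :: nat where "N = 2 ^ n"
  \<comment> \<open>At \<open>i = N\<close> both grids are at \<open>t\<close>, so the increments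
    with index below \<open>N\<close> belong to the first grid and all later ones to the
    second.\<close>
  define ts where "ts i = (if i \<le> N then dyadic 0 t n i else dyadic t l n (i - N))" for i
  define E where "E i = {(\<lambda>\<omega>. W (ts (Suc i)) \<omega> - W (ts i) \<omega>) -` A \<inter> space M | A. A \<in> sets borel}" for i
  have tN: "dyadic 0 t n N = t" "dyadic t l n 0 = t" by (auto simp: dyadic_def N_def)
  have "ts i < ts (Suc i)" if "i < 2 * N" for i
  proof (cases "i < N")
    case True
    then show ?thesis using assms by (simp add: ts_def dyadic_def divide_strict_right_mono)
  next
    case False
    then have "ts i = dyadic t l n (i - N)" using tN by (auto simp: ts_def not_less le_eq_less_or_eq)
    moreover have "ts (Suc i) = dyadic t l n (Suc (i - N))" using False by (auto simp: ts_def Suc_diff_le)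
    ultimately show ?thesis using assms by (simp add: dyadic_def divide_strict_right_mono)
  qed
  then have "indep_vars (\<lambda>_. borel) (\<lambda>i \<omega>. W (ts (Suc i)) \<omega> - W (ts i) \<omega>) {..<2 * N}"
    by (intro W_increments_indep) (auto simp: ts_def dyadic_def)
  then have E: "indep_sets E {..<2 * N}" unfolding indep_vars_def2 E_def by auto
  define I where "I j = (if j then {..<N} else {N..<2 * N})" for j
  have "indep_sets (\<lambda>j. sigma_sets (space M) (\<Union>i\<in>I j. E i)) UNIV"
  proof (rule indep_sets_collect_sigma)
    have "(\<Union>j. I j) = {..<2 * N}" by (auto simp: I_def)
    then show "indep_sets E (\<Union>j\<in>UNIV. I j)" using E by simp
    show "disjoint_family I" by (auto simp: disjoint_family_on_def I_def)
    show "Int_stable (E i)" for i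
    proof (rule Int_stableI)
      fix a b assume "a \<in> E i" "b \<in> E i"
      then obtain A B where "A \<in> sets borel" "B \<in> sets borel"
        "a = (\<lambda>\<omega>. W (ts (Suc i)) \<omega> - W (ts i) \<omega>) -` A \<inter> space M"
        "b = (\<lambda>\<omega>. W (ts (Suc i)) \<omega> - W (ts i) \<omega>) -` B \<inter> space M" by (auto simp: E_def)
      then show "a \<inter> b \<in> E i" by (auto simp: E_def intro!: exI[of _ "A \<inter> B"])
    qed
  qed
  also have "(\<lambda>j. sigma_sets (space M) (\<Union>i\<in>I j. E i)) = case_bool (sets (dyadic_alg 0 t n)) (sets (dyadic_alg t l n))"
  proof (rule ext)
    fix j
    show "sigma_sets (space M) (\<Union>i\<in>I j. E i) = (case j of True \<Rightarrow> sets (dyadic_alg 0 t n) | False \<Rightarrow> sets (dyadic_alg t l n))"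
    proof (cases j)
      case True
      have "E i = increment_events 0 t n i" if "i < N" for i
        using that by (auto simp: E_def increment_events_def ts_def)
      then show ?thesis using True by (simp add: sets_dyadic_alg I_def N_def)
    next
      case False
      have "E (i + N) = increment_events t l n i" for i
        using tN by (cases i) (auto simp: E_def increment_events_def ts_def)
      then have "(\<Union>i<N. increment_events t l n i) = (\<Union>i<N. E (i + N))" by simp
      also have "\<dots> = (\<Union>i\<in>{N..<2 * N}. E i)"
      proof -
        have "{N..<2 * N} = (\<lambda>i. i + N) ` {..<N}"
          using image_add_atLeastLessThan'[of N 0 N] by (simp add: lessThan_atLeast0 mult_2)
        then show ?thesis by simp
      qed
      finally show ?thesis using False by (simp add: sets_dyadic_alg I_def N_def)
    qed
  qed
  finally show ?thesis by (simp add: indep_set_def)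
qed

text \<open>Two events of different levels are compared at the finer level; independence of the
  intersection stable unions then extends to the algebras they generate.\<close>

lemma indep_path_algs:
  assumes "0 < t" "0 < l"
  shows "indep_var (path_alg 0 t) (\<lambda>\<omega>. \<omega>) (path_alg t l) (\<lambda>\<omega>. \<omega>)"
proof -
  have sub: "(\<Union>n. sets (dyadic_alg 0 t n)) \<subseteq> events" "(\<Union>n. sets (dyadic_alg t l n)) \<subseteq> events"
    using dyadic_alg_subset_events[of 0 t] dyadic_alg_subset_events[of t l] assms by auto
  have "indep_set (\<Union>n. sets (dyadic_alg 0 t n)) (\<Union>n. sets (dyadic_alg t l n))"
  proof (rule indep_setI[OF sub])
    fix A B assume "A \<in> (\<Union>n. sets (dyadic_alg 0 t n))" "B \<in> (\<Union>n. sets (dyadic_alg t l n))"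
    then obtain n m where "A \<in> sets (dyadic_alg 0 t n)" "B \<in> sets (dyadic_alg t l m)" by auto
    then have "A \<in> sets (dyadic_alg 0 t (max n m))" "B \<in> sets (dyadic_alg t l (max n m))"
      using dyadic_alg_mono[of n "max n m"] dyadic_alg_mono[of m "max n m"] by fastforce+
    then show "prob (A \<inter> B) = prob A * prob B"
      using indep_dyadic_algs[OF assms] by (rule indep_setD[rotated])
  qed
  then have ind: "indep_set (sets (path_alg 0 t)) (sets (path_alg t l))"
    unfolding sets_path_alg by (intro indep_set_sigma_sets Int_stable_dyadic_alg)
  \<comment> \<open>The random variables are identity maps, so the algebra they generate is the
    algebra itself.\<close>
  have eq: "sigma_sets (space M) {(\<lambda>\<omega>. \<omega>) -` A \<inter> space M | A. A \<in> sets (path_alg s h)} = sets (path_alg s h)" for s h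
  proof -
    have "{(\<lambda>\<omega>. \<omega>) -` A \<inter> space M | A. A \<in> sets (path_alg s h)} = sets (path_alg s h)"
      using sets.sets_into_space[of _ "path_alg s h"] by (auto simp: Int_absorb2)
    then show ?thesis using sets.sigma_sets_eq[of "path_alg s h"] by simp
  qed
  have "(\<lambda>\<omega>. \<omega>) \<in> measurable M (path_alg s h)" if "sets (path_alg s h) \<subseteq> events" for s h
    by (rule measurableI) (use that sets.sets_into_space[of _ "path_alg s h"] in \<open>auto simp: Int_absorb2\<close>)
  then show ?thesis
    unfolding indep_var_eq eq using ind indep_setD_ev1[OF ind] indep_setD_ev2[OF ind] by auto
qed

text \<open>At dyadic points the increment is a finite sum of generators; \<open>r\<close> is the
  limit of the dyadic points just below it, and paths are continuous.\<close>

lemma path_alg_measurable: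
  assumes s: "0 \<le> s" and l: "0 < l" and r: "s \<le> r" "r \<le> s + l"
  shows "(\<lambda>\<omega>. W r \<omega> - W s \<omega>) \<in> borel_measurable (path_alg s l)"
proof -
  define j where "j n = nat \<lfloor>(r - s) * 2 ^ n / l\<rfloor>" for n
  have jr: "real (j n) = real_of_int \<lfloor>(r - s) * 2 ^ n / l\<rfloor>" for n
    using r l by (simp add: j_def)
  have "(r - s) * 2 ^ n / l \<le> 2 ^ n" for n
    using mult_right_mono[of "r - s" l "2 ^ n"] r l by (simp add: divide_le_eq mult.commute)
  then have j: "j n \<le> 2 ^ n" for n
    using jr[of n] of_int_floor_le[of "(r - s) * 2 ^ n / l"] by (metis (mono_tags) of_nat_le_iff of_nat_numeral of_nat_power order_trans)
  have dy: "(\<lambda>n. dyadic s l n (j n)) \<longlonglongrightarrow> r"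
  proof (rule tendsto_sandwich[of "\<lambda>n. r - l * (1 / 2) ^ n" _ _ "\<lambda>n. r"])
    have "r - l * (1 / 2) ^ n \<le> dyadic s l n (j n)" for n
    proof -
      have "((r - s) * 2 ^ n / l - 1) * (l / 2 ^ n) \<le> real (j n) * (l / 2 ^ n)"
        unfolding jr using l by (intro mult_right_mono) (linarith, auto)
      also have "((r - s) * 2 ^ n / l - 1) * (l / 2 ^ n) = r - s - l / 2 ^ n" using l by (simp add: field_simps)
      finally show ?thesis by (simp add: dyadic_def power_divide)
    qed
    then show "\<forall>\<^sub>F n in sequentially. r - l * (1 / 2) ^ n \<le> dyadic s l n (j n)" by simp
    have "dyadic s l n (j n) \<le> r" for n
    proof -
      have "real (j n) * (l / 2 ^ n) \<le> ((r - s) * 2 ^ n / l) * (l / 2 ^ n)"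
        unfolding jr using l by (intro mult_right_mono) auto
      also have "\<dots> = r - s" using l by simp
      finally show ?thesis by (simp add: dyadic_def)
    qed
    then show "\<forall>\<^sub>F n in sequentially. dyadic s l n (j n) \<le> r" by simp
    have "(\<lambda>n. r - l * (1 / 2) ^ n) \<longlonglongrightarrow> r - l * 0" by (intro tendsto_intros LIMSEQ_power_zero) auto
    then show "(\<lambda>n. r - l * (1 / 2) ^ n) \<longlonglongrightarrow> r" by simp
  qed auto
  have W: "(\<lambda>\<omega>. W (dyadic s l n i) \<omega> - W s \<omega>) \<in> borel_measurable (dyadic_alg s l n)" if "i \<le> 2 ^ n" for n i
    using that
  proof (induction i)
    case (Suc i)
    then have "(\<lambda>\<omega>. (W (dyadic s l n (Suc i)) \<omega> - W (dyadic s l n i) \<omega>) + (W (dyadic s l n i) \<omega> - W s \<omega>))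
        \<in> borel_measurable (dyadic_alg s l n)"
      by (intro borel_measurable_add increment_measurable_dyadic_alg) auto
    then show ?case by simp
  qed (simp add: dyadic_def)
  show ?thesis
  proof (rule borel_measurable_LIMSEQ_metric)
    show "(\<lambda>\<omega>. W (dyadic s l n (j n)) \<omega> - W s \<omega>) \<in> borel_measurable (path_alg s l)" for n
      by (rule borel_measurable_subalgebra[OF _ _ W[OF j]]) (auto simp: sets_path_alg)
    fix \<omega> assume "\<omega> \<in> space (path_alg s l)"
    then have "continuous_on {0..} (\<lambda>t. W t \<omega>)" by (simp add: W_continuous)
    then have "(\<lambda>n. W (dyadic s l n (j n)) \<omega>) \<longlonglongrightarrow> W r \<omega>"
      by (rule continuous_on_tendsto_compose[OF _ dy]) (use s l r in \<open>auto simp: dyadic_def\<close>)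
    then show "(\<lambda>n. W (dyadic s l n (j n)) \<omega> - W s \<omega>) \<longlonglongrightarrow> W r \<omega> - W s \<omega>"
      by (intro tendsto_intros)
  qed
qed

lemma path_alg_measurable_0:
  assumes "0 \<le> r" "r \<le> t" "0 < t"
  shows "W r \<in> borel_measurable (path_alg 0 t)"
proof -
  have "(\<lambda>\<omega>. W r \<omega> - W 0 \<omega>) \<in> borel_measurable (path_alg 0 t)"
    by (rule path_alg_measurable) (use assms in auto)
  then show ?thesis by (rule measurable_cong[THEN iffD1, rotated]) (simp add: W_zero)
qed

text \<open>Bounding the variance by \<open>T\<close> gives one range of \<open>l\<close> for all
  times. Time 0 is separate because the normal law of increments is available only for
  \<open>s < t\<close>.\<close>

lemma integrable_exp_W_square:
  assumes "0 \<le> t" "t \<le> T" "0 < T" "l < 1 / (2 * T)"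
  shows "integrable M (\<lambda>\<omega>. exp (l * (W t \<omega>)\<^sup>2))"
proof (cases "t = 0")
  case True
  have "integrable M (\<lambda>\<omega>. 1 :: real)" by simp
  then show ?thesis by (rule Bochner_Integration.integrable_cong[THEN iffD1, rotated 2]) (use True W_zero in auto)
next
  case False
  have "1 / (2 * T) \<le> 1 / (2 * t)" using assms False by (intro divide_left_mono) auto
  then have "integrable lborel (\<lambda>x. normal_density 0 (sqrt t) x * exp (l * x\<^sup>2))"
    using assms False by (intro integrable_normal_density_exp_square) auto
  also have "distributed M lborel (\<lambda>\<omega>. W t \<omega> - W 0 \<omega>) (\<lambda>y. ennreal (normal_density 0 (sqrt t) y))"
    using W_increment_distributed[of 0 t] assms False by simp
  from distributed_integrable[OF this, of "\<lambda>x. exp (l * x\<^sup>2)"]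
  have "integrable lborel (\<lambda>x. normal_density 0 (sqrt t) x * exp (l * x\<^sup>2)) \<longleftrightarrow>
      integrable M (\<lambda>\<omega>. exp (l * (W t \<omega> - W 0 \<omega>)\<^sup>2))" by simp
  finally show ?thesis
    by (rule Bochner_Integration.integrable_cong[THEN iffD1, rotated 2]) (use W_zero in auto)
qed

text \<open>The martingale property in the form needed: \<open>U\<close> is independent of the later
  increment, so the expectation of the product factors and the second factor is 0.\<close>

lemma expectation_past_mult_increment:
  assumes "0 < s" "s < t" and U: "U \<in> borel_measurable (path_alg 0 s)" "integrable M U"
  shows "integrable M (\<lambda>\<omega>. U \<omega> * (W t \<omega> - W s \<omega>))" "expectation (\<lambda>\<omega>. U \<omega> * (W t \<omega> - W s \<omega>)) = 0"
proof -
  have "indep_var (path_alg 0 s) (\<lambda>\<omega>. \<omega>) (path_alg s (t - s)) (\<lambda>\<omega>. \<omega>)"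
    by (rule indep_path_algs) (use assms in auto)
  from indep_var_compose[OF this U(1) path_alg_measurable[of s "t - s" t]]
  have ind: "indep_var borel U borel (\<lambda>\<omega>. W t \<omega> - W s \<omega>)" using assms by (simp add: o_def)
  have D: "distributed M lborel (\<lambda>\<omega>. W t \<omega> - W s \<omega>) (\<lambda>y. ennreal (normal_density 0 (sqrt (t - s)) y))"
    using W_increment_distributed[of s t] assms by simp
  have int: "integrable M (\<lambda>\<omega>. W t \<omega> - W s \<omega>)"
    by (rule distributed_integrable_var[OF D]) (use assms in \<open>auto intro: integrable_normal_moment_nz_1\<close>)
  have "expectation (\<lambda>\<omega>. W t \<omega> - W s \<omega>) = 0"
    using distributed_integral[OF D, of "\<lambda>x. x"] integral_normal_moment_nz_1[of "sqrt (t - s)" 0] assms by simp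
  then show "integrable M (\<lambda>\<omega>. U \<omega> * (W t \<omega> - W s \<omega>))" "expectation (\<lambda>\<omega>. U \<omega> * (W t \<omega> - W s \<omega>)) = 0"
    using indep_var_integrable[OF ind U(2) int] indep_var_lebesgue_integral[OF ind U(2) int] by auto
qed

text \<open>Expectation of \<open>pathwise_Doob_L2\<close> for \<open>exp (e * W^2)\<close> on a
  grid: after the tangent bound the sum has mean zero. The bound is free of \<open>N\<close>. The
  factor 3 in the hypothesis comes from integrability of that sum, whose coefficients are controlled
  by third powers.\<close>

lemma nn_integral_runmax_le:
  assumes T: "0 < T" and e: "0 < e" "e \<le> 1" "3 * e < 1 / (2 * T)" and N: "N > 0"
  shows "(\<integral>\<^sup>+\<omega>. ennreal ((runmax (\<lambda>k. exp (e * (W (real k * T / real N) \<omega>)\<^sup>2)) N)\<^sup>2) \<partial>M)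
     \<le> ennreal (4 * expectation (\<lambda>\<omega>. exp (2 * e * (W T \<omega>)\<^sup>2)))"
proof -
  define s where "s k = real k * T / real N" for k
  have s: "0 \<le> s k" "s k < s (Suc k)" "s 0 = 0" "s N = T" for k
    using T N by (auto simp: s_def divide_strict_right_mono)
  have sT: "s k \<le> T" if "k \<le> N" for k using that T N by (simp add: s_def field_simps)
  have spos: "0 < s k" if "k > 0" for k using that T N by (simp add: s_def)
  define Y where "Y \<omega> k = exp (e * (W (s k) \<omega>)\<^sup>2)" for \<omega> k
  \<comment> \<open>Running maximum times slope of the tangent at \<open>W (s k)\<close>, both known
    at time \<open>s k\<close>.\<close>
  define U where "U k \<omega> = runmax (Y \<omega>) k * (2 * e * W (s k) \<omega> * exp (e * (W (s k) \<omega>)\<^sup>2))" for k \<omega>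
  have Y1: "Y \<omega> k \<ge> 1" for \<omega> k using e by (simp add: Y_def)
  have R0: "runmax (Y \<omega>) k \<ge> 0" for \<omega> k using runmax_ge[of 0 k "Y \<omega>"] Y1[of \<omega> 0] by linarith
  have Rm: "(\<lambda>\<omega>. runmax (Y \<omega>) k) \<in> borel_measurable P" if "\<And>i. i \<le> k \<Longrightarrow> W (s i) \<in> borel_measurable P" for P k
    using that
  proof (induction k)
    case 0
    then have [measurable]: "W (s 0) \<in> borel_measurable P" by auto
    show ?case by (simp add: Y_def)
  next
    case (Suc k)
    then have [measurable]: "W (s (Suc k)) \<in> borel_measurable P" and R: "(\<lambda>\<omega>. runmax (Y \<omega>) k) \<in> borel_measurable P"
      by auto
    have "(\<lambda>\<omega>. Y \<omega> (Suc k)) \<in> borel_measurable P" unfolding Y_def by simp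
    then show ?case unfolding runmax.simps by (intro borel_measurable_max R)
  qed
  have Um: "U k \<in> borel_measurable P" if "\<And>i. i \<le> k \<Longrightarrow> W (s i) \<in> borel_measurable P" for P k
  proof -
    have [measurable]: "W (s k) \<in> borel_measurable P" "(\<lambda>\<omega>. runmax (Y \<omega>) k) \<in> borel_measurable P"
      using Rm[of k P] that by auto
    show ?thesis unfolding U_def by measurable
  qed
  have Y3: "integrable M (\<lambda>\<omega>. Y \<omega> k ^ 3)" if "k \<le> N" for k
    using integrable_exp_W_square[of "s k" T "3 * e"] s sT[OF that] T e
    by (simp add: Y_def exp_of_nat_mult[symmetric] mult.assoc)
  have Uint: "integrable M (U k)" if k: "k \<le> N" for k
  proof (rule Bochner_Integration.integrable_bound[where f = "\<lambda>\<omega>. (\<Sum>i\<le>k. Y \<omega> i ^ 3) + Y \<omega> k ^ 3"])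
    show "integrable M (\<lambda>\<omega>. (\<Sum>i\<le>k. Y \<omega> i ^ 3) + Y \<omega> k ^ 3)"
      using k by (intro Bochner_Integration.integrable_add Bochner_Integration.integrable_sum Y3) auto
    show "U k \<in> borel_measurable M" by (rule Um) (simp add: W_measurable s)
    have "\<bar>U k \<omega>\<bar> \<le> (\<Sum>i\<le>k. Y \<omega> i ^ 3) + Y \<omega> k ^ 3" for \<omega>
    proof -
      define x where "x = W (s k) \<omega>"
      \<comment> \<open>Because \<open>e\<close> is at most 1, the slope \<open>2 * e * x\<close> is
        bounded by \<open>1 + e * x^2\<close> and so by \<open>Y\<close> itself; this yields three
        factors of size at most the maximum.\<close>
      have "2 * \<bar>x\<bar> \<le> 1 + x\<^sup>2" using zero_le_power2[of "\<bar>x\<bar> - 1"] by (simp add: power2_eq_square algebra_simps)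
      then have "e * (2 * \<bar>x\<bar>) \<le> e * (1 + x\<^sup>2)" using e by (intro mult_left_mono) auto
      also have "\<dots> \<le> 1 + e * x\<^sup>2" using e by (simp add: algebra_simps)
      also have "\<dots> \<le> exp (e * x\<^sup>2)" by (rule exp_ge_add_one_self)
      finally have x: "2 * e * \<bar>x\<bar> \<le> Y \<omega> k" by (simp add: Y_def x_def mult_ac)
      have "\<bar>U k \<omega>\<bar> = runmax (Y \<omega>) k * ((2 * e * \<bar>x\<bar>) * Y \<omega> k)"
        using R0[of \<omega> k] e by (simp add: U_def abs_mult x_def Y_def)
      also have "\<dots> \<le> runmax (Y \<omega>) k * (Y \<omega> k * Y \<omega> k)"
        using R0[of \<omega> k] Y1[of \<omega> k] x by (intro mult_left_mono mult_right_mono) auto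
      also have "\<dots> \<le> runmax (Y \<omega>) k ^ 3 + Y \<omega> k ^ 3"
      proof (cases "runmax (Y \<omega>) k \<le> Y \<omega> k")
        case True
        then have "runmax (Y \<omega>) k * (Y \<omega> k * Y \<omega> k) \<le> Y \<omega> k * (Y \<omega> k * Y \<omega> k)"
          using Y1[of \<omega> k] by (intro mult_right_mono) auto
        then show ?thesis using R0[of \<omega> k] by (simp add: power3_eq_cube add_increasing)
      next
        case False
        then have "Y \<omega> k * Y \<omega> k \<le> runmax (Y \<omega>) k * runmax (Y \<omega>) k"
          using Y1[of \<omega> k] R0[of \<omega> k] by (intro mult_mono) auto
        then have "runmax (Y \<omega>) k * (Y \<omega> k * Y \<omega> k) \<le> runmax (Y \<omega>) k * (runmax (Y \<omega>) k * runmax (Y \<omega>) k)"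
          using R0[of \<omega> k] by (intro mult_left_mono) auto
        then show ?thesis using Y1[of \<omega> k] by (simp add: power3_eq_cube add_increasing2)
      qed
      also have "runmax (Y \<omega>) k ^ 3 \<le> (\<Sum>i\<le>k. Y \<omega> i ^ 3)"
      proof (induction k)
        case (Suc k)
        have "runmax (Y \<omega>) (Suc k) ^ 3 \<le> runmax (Y \<omega>) k ^ 3 + Y \<omega> (Suc k) ^ 3"
          using R0[of \<omega> k] Y1[of \<omega> "Suc k"] by (auto simp: max_def)
        then show ?case using Suc by simp
      qed simp
      finally show ?thesis by simp
    qed
    then show "AE \<omega> in M. norm (U k \<omega>) \<le> norm ((\<Sum>i\<le>k. Y \<omega> i ^ 3) + Y \<omega> k ^ 3)"
      by (intro AE_I2) (metis abs_ge_self order_trans real_norm_def)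
  qed
  have Ux: "integrable M (\<lambda>\<omega>. U k \<omega> * (W (s (Suc k)) \<omega> - W (s k) \<omega>)) \<and>
      expectation (\<lambda>\<omega>. U k \<omega> * (W (s (Suc k)) \<omega> - W (s k) \<omega>)) = 0" if k: "k < N" for k
  proof (cases "k = 0")
    case True
    \<comment> \<open>The independence lemma needs a positive time; at time 0 the coefficient
      vanishes with \<open>W 0\<close>.\<close>
    have z: "U k \<omega> * (W (s (Suc k)) \<omega> - W (s k) \<omega>) = 0" if "\<omega> \<in> space M" for \<omega>
      using that True by (simp add: U_def s W_zero)
    then show ?thesis
      by (auto simp: Bochner_Integration.integrable_cong[OF refl z] Bochner_Integration.integral_cong[OF refl z])
  next
    case False
    have "U k \<in> borel_measurable (path_alg 0 (s k))"
    proof (rule Um, rule path_alg_measurable_0)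
      show "s i \<le> s k" if "i \<le> k" for i using that T by (simp add: s_def divide_right_mono)
    qed (use s spos False in auto)
    then show ?thesis
      using expectation_past_mult_increment[of "s k" "s (Suc k)" "U k"] Uint[of k] s spos False k by auto
  qed
  define R where "R \<omega> = 4 * (Y \<omega> N)\<^sup>2 - 4 * (\<Sum>k<N. U k \<omega> * (W (s (Suc k)) \<omega> - W (s k) \<omega>))" for \<omega>
  have le: "(runmax (Y \<omega>) N)\<^sup>2 \<le> R \<omega>" for \<omega>
  proof -
    have "U k \<omega> * (W (s (Suc k)) \<omega> - W (s k) \<omega>) \<le> runmax (Y \<omega>) k * (Y \<omega> (Suc k) - Y \<omega> k)" for k
      using mult_left_mono[OF exp_square_tangent[of e "W (s k) \<omega>" "W (s (Suc k)) \<omega>"] R0[of \<omega> k]] e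
      by (simp add: U_def Y_def mult.assoc)
    then have "(\<Sum>k<N. U k \<omega> * (W (s (Suc k)) \<omega> - W (s k) \<omega>)) \<le> (\<Sum>k<N. runmax (Y \<omega>) k * (Y \<omega> (Suc k) - Y \<omega> k))"
      by (intro sum_mono)
    then show ?thesis using pathwise_Doob_L2[of "Y \<omega>" N] by (simp add: R_def)
  qed
  have Y2: "(Y \<omega> N)\<^sup>2 = exp (2 * e * (W T \<omega>)\<^sup>2)" for \<omega>
    by (simp add: Y_def s power2_eq_square exp_add[symmetric])
  have Y2i: "integrable M (\<lambda>\<omega>. (Y \<omega> N)\<^sup>2)"
    unfolding Y2 by (rule integrable_exp_W_square[of T T]) (use T e in auto)
  have Ri: "integrable M R" unfolding R_def
    by (intro Bochner_Integration.integrable_diff integrable_mult_right Bochner_Integration.integrable_sum Y2i conjunct1[OF Ux]) simp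
  have "(\<integral>\<^sup>+\<omega>. ennreal ((runmax (Y \<omega>) N)\<^sup>2) \<partial>M) \<le> (\<integral>\<^sup>+\<omega>. ennreal (R \<omega>) \<partial>M)"
    by (intro nn_integral_mono ennreal_leI le)
  also have "\<dots> = ennreal (expectation R)"
    by (intro nn_integral_eq_integral Ri AE_I2 order_trans[OF zero_le_power2 le])
  also have "expectation R = expectation (\<lambda>\<omega>. 4 * (Y \<omega> N)\<^sup>2)
      - expectation (\<lambda>\<omega>. 4 * (\<Sum>k<N. U k \<omega> * (W (s (Suc k)) \<omega> - W (s k) \<omega>)))"
    unfolding R_def
    by (intro Bochner_Integration.integral_diff integrable_mult_right Bochner_Integration.integrable_sum Y2i conjunct1[OF Ux]) simp
  also have "expectation (\<lambda>\<omega>. 4 * (\<Sum>k<N. U k \<omega> * (W (s (Suc k)) \<omega> - W (s k) \<omega>)))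
      = 4 * (\<Sum>k<N. expectation (\<lambda>\<omega>. U k \<omega> * (W (s (Suc k)) \<omega> - W (s k) \<omega>)))"
    using Ux by (simp add: Bochner_Integration.integral_sum)
  also have "expectation (\<lambda>\<omega>. 4 * (Y \<omega> N)\<^sup>2) - \<dots> = 4 * expectation (\<lambda>\<omega>. (Y \<omega> N)\<^sup>2)"
    using Ux by simp
  finally show ?thesis unfolding Y2 unfolding Y_def s_def .
qed

text \<open>\<open>G\<close> is the lower limit of the squared running maxima over finer and finer
  grids: Fatou bounds its integral, and continuity of the paths makes it dominate
  \<open>exp (2 * e * W^2)\<close> at all times. \<open>Z\<close> is read off by inverting that
  exponential.\<close>

lemma sup_W_dominated:
  assumes T: "0 < T"
  obtains Z e where "e > 0" "Z \<in> borel_measurable M" "integrable M (\<lambda>\<omega>. exp (e * (Z \<omega>)\<^sup>2))"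
    "\<And>\<omega> r. \<omega> \<in> space M \<Longrightarrow> r \<in> {0..T} \<Longrightarrow> \<bar>W r \<omega>\<bar> \<le> Z \<omega>"
proof -
  \<comment> \<open>\<open>1 / (8 * T)\<close> makes \<open>3 * e\<close> at most
    \<open>3 / (8 * T)\<close>, below the required \<open>1 / (2 * T)\<close>; the 1 secures
    \<open>e <= 1\<close>.\<close>
  define e where "e = min 1 (1 / (8 * T))"
  have e: "0 < e" "e \<le> 1" using T by (auto simp: e_def)
  have "3 * e \<le> 3 * (1 / (8 * T))" unfolding e_def by (intro mult_left_mono) auto
  also have "\<dots> < 1 / (2 * T)" using T by (simp add: field_simps)
  finally have e3: "3 * e < 1 / (2 * T)" .
  define Y where "Y n \<omega> k = exp (e * (W (real k * T / real (Suc n)) \<omega>)\<^sup>2)" for n \<omega> k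
  define m where "m n \<omega> = (runmax (Y n \<omega>) (Suc n))\<^sup>2" for n \<omega>
  define G where "G \<omega> = liminf (\<lambda>n. ennreal (m n \<omega>))" for \<omega>
  have m_meas: "m n \<in> borel_measurable M" for n
  proof -
    have "(\<lambda>\<omega>. runmax (Y n \<omega>) k) \<in> borel_measurable M" for k
    proof (induction k)
      case 0
      have [measurable]: "W 0 \<in> borel_measurable M" by (rule W_measurable) auto
      show ?case by (simp add: Y_def)
    next
      case (Suc k)
      define r where "r = real (Suc k) * T / real (Suc n)"
      have "0 \<le> r" using T by (simp add: r_def)
      then have [measurable]: "W r \<in> borel_measurable M" by (rule W_measurable)
      have "(\<lambda>\<omega>. Y n \<omega> (Suc k)) = (\<lambda>\<omega>. exp (e * (W r \<omega>)\<^sup>2))" unfolding Y_def r_def ..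
      then have "(\<lambda>\<omega>. Y n \<omega> (Suc k)) \<in> borel_measurable M" by simp
      then show ?case unfolding runmax.simps by (intro borel_measurable_max Suc)
    qed
    then show ?thesis unfolding m_def by measurable
  qed
  have G_meas [measurable]: "G \<in> borel_measurable M"
    unfolding G_def using m_meas by measurable
  define C where "C = 4 * expectation (\<lambda>\<omega>. exp (2 * e * (W T \<omega>)\<^sup>2))"
  have "(\<integral>\<^sup>+\<omega>. G \<omega> \<partial>M) \<le> liminf (\<lambda>n. \<integral>\<^sup>+\<omega>. ennreal (m n \<omega>) \<partial>M)"
    unfolding G_def by (rule nn_integral_liminf) (use m_meas in measurable)
  also have "\<dots> \<le> liminf (\<lambda>n. ennreal C)"
    unfolding m_def Y_def C_def
    by (intro Liminf_mono always_eventually allI nn_integral_runmax_le T e e3) simp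
  also have "\<dots> = ennreal C" by (simp add: Liminf_const)
  finally have GC: "(\<integral>\<^sup>+\<omega>. G \<omega> \<partial>M) \<le> ennreal C" .
  \<comment> \<open>Finite for every path, not only almost surely, since a continuous path is
    bounded on \<open>[0, T]\<close>. Hence \<open>Z\<close> will dominate without exceptional
    set.\<close>
  have Gfin: "G \<omega> < \<infinity>" if \<omega>: "\<omega> \<in> space M" for \<omega>
  proof -
    have "compact ((\<lambda>t. W t \<omega>) ` {0..T})"
      by (rule compact_continuous_image[OF continuous_on_subset[OF W_continuous[OF \<omega>]]]) auto
    then have "bounded ((\<lambda>t. W t \<omega>) ` {0..T})" by (rule compact_imp_bounded)
    then obtain B where B: "\<And>t. t \<in> {0..T} \<Longrightarrow> \<bar>W t \<omega>\<bar> \<le> B"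
      unfolding bounded_iff real_norm_def by blast
    have "m n \<omega> \<le> (exp (e * B\<^sup>2))\<^sup>2" for n
    proof -
      have "Y n \<omega> k \<le> exp (e * B\<^sup>2)" if "k \<le> Suc n" for k
      proof -
        have "real k * T / real (Suc n) \<in> {0..T}"
          using that T mult_right_mono[of "real k" "real (Suc n)" T] by (auto simp: divide_le_eq mult.commute simp del: of_nat_Suc)
        from power_mono[OF B[OF this], of 2] show ?thesis using e by (simp add: Y_def)
      qed
      then have "runmax (Y n \<omega>) (Suc n) \<le> exp (e * B\<^sup>2)" by (rule runmax_le)
      moreover have "0 \<le> runmax (Y n \<omega>) (Suc n)"
        using runmax_ge[of 0 "Suc n" "Y n \<omega>"] by (simp add: Y_def order_trans[OF exp_ge_zero])
      ultimately show ?thesis unfolding m_def by (intro power_mono)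
    qed
    then have "G \<omega> \<le> liminf (\<lambda>n. ennreal ((exp (e * B\<^sup>2))\<^sup>2))"
      unfolding G_def by (intro Liminf_mono always_eventually allI ennreal_leI)
    then show ?thesis by (simp add: Liminf_const le_less_trans)
  qed
  have Gge: "ennreal (exp (2 * e * (W r \<omega>)\<^sup>2)) \<le> G \<omega>" if \<omega>: "\<omega> \<in> space M" and r: "r \<in> {0..T}" for \<omega> r
  proof -
    \<comment> \<open>Index of the last grid point of level \<open>n\<close> not after
      \<open>r\<close>; in general \<open>r\<close> lies on no grid.\<close>
    define j where "j n = nat \<lfloor>r * real (Suc n) / T\<rfloor>" for n
    define q where "q n = real (j n) * T / real (Suc n)" for n
    have jr: "real (j n) = real_of_int \<lfloor>r * real (Suc n) / T\<rfloor>" for n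
      using r T by (simp add: j_def del: of_nat_Suc)
    have "r * real (Suc n) / T \<le> real (Suc n)" for n
      using mult_right_mono[of r T "real (Suc n)"] r T by (simp add: divide_le_eq mult.commute del: of_nat_Suc)
    then have j: "j n \<le> Suc n" for n
      using jr[of n] of_int_floor_le[of "r * real (Suc n) / T"] by (metis of_nat_le_iff order_trans)
    have q: "q \<longlonglongrightarrow> r"
    proof (rule tendsto_sandwich[of "\<lambda>n. r - T * (1 / real (Suc n))" _ _ "\<lambda>n. r"])
      have "r - T * (1 / real (Suc n)) \<le> q n" for n
      proof -
        have "(r * real (Suc n) / T - 1) * (T / real (Suc n)) \<le> real (j n) * (T / real (Suc n))"
          unfolding jr using T by (intro mult_right_mono) (linarith, auto)
        also have "(r * real (Suc n) / T - 1) * (T / real (Suc n)) = r - T * (1 / real (Suc n))"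
          using T by (simp add: left_diff_distrib diff_divide_distrib del: of_nat_Suc)
        finally show ?thesis by (simp add: q_def)
      qed
      then show "\<forall>\<^sub>F n in sequentially. r - T * (1 / real (Suc n)) \<le> q n" by simp
      have "q n \<le> r" for n
      proof -
        have "real (j n) * (T / real (Suc n)) \<le> (r * real (Suc n) / T) * (T / real (Suc n))"
          unfolding jr using T by (intro mult_right_mono) auto
        also have "\<dots> = r" using T by (simp del: of_nat_Suc)
        finally show ?thesis by (simp add: q_def)
      qed
      then show "\<forall>\<^sub>F n in sequentially. q n \<le> r" by simp
      have "(\<lambda>n. r - T * (1 / real (Suc n))) \<longlonglongrightarrow> r - T * 0"
        by (intro tendsto_intros LIMSEQ_Suc lim_1_over_n)
      then show "(\<lambda>n. r - T * (1 / real (Suc n))) \<longlonglongrightarrow> r" by simp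
    qed auto
    have "(\<lambda>n. W (q n) \<omega>) \<longlonglongrightarrow> W r \<omega>"
      by (rule continuous_on_tendsto_compose[OF W_continuous[OF \<omega>] q]) (use r T in \<open>auto simp: q_def\<close>)
    then have "(\<lambda>n. exp (2 * e * (W (q n) \<omega>)\<^sup>2)) \<longlonglongrightarrow> exp (2 * e * (W r \<omega>)\<^sup>2)"
      by (intro tendsto_intros)
    then have "ennreal (exp (2 * e * (W r \<omega>)\<^sup>2)) = liminf (\<lambda>n. ennreal (exp (2 * e * (W (q n) \<omega>)\<^sup>2)))"
      by (intro lim_imp_Liminf[symmetric] tendsto_ennrealI) auto
    also have "\<dots> \<le> G \<omega>"
    proof -
      have "exp (2 * e * (W (q n) \<omega>)\<^sup>2) \<le> m n \<omega>" for n
      proof -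
        have "exp (2 * e * (W (q n) \<omega>)\<^sup>2) = (Y n \<omega> (j n))\<^sup>2"
          by (simp add: Y_def q_def power2_eq_square exp_add[symmetric])
        also have "\<dots> \<le> m n \<omega>" unfolding m_def
          by (intro power_mono runmax_ge j) (simp add: Y_def)
        finally show ?thesis .
      qed
      then show ?thesis unfolding G_def by (intro Liminf_mono always_eventually allI ennreal_leI)
    qed
    finally show ?thesis .
  qed
  \<comment> \<open>The maximum with 1 keeps the logarithm under the square root in \<open>Z\<close>
    nonnegative for every argument.\<close>
  define g where "g \<omega> = max 1 (enn2real (G \<omega>))" for \<omega>
  define Z where "Z \<omega> = sqrt (ln (g \<omega>) / (2 * e))" for \<omega>
  have g1: "g \<omega> \<ge> 1" for \<omega> by (simp add: g_def)
  have g_meas: "g \<in> borel_measurable M" unfolding g_def by measurable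
  have gG: "ennreal (g \<omega>) = G \<omega>" if "\<omega> \<in> space M" for \<omega>
  proof -
    have "1 \<le> exp (2 * e * (W 0 \<omega>)\<^sup>2)" using e by simp
    then have "1 \<le> G \<omega>" using Gge[OF that, of 0] T by (metis atLeastAtMost_iff ennreal_1 ennreal_leI less_imp_le order_refl order_trans)
    moreover have "ennreal (enn2real (G \<omega>)) = G \<omega>" using Gfin[OF that] by simp
    ultimately have "1 \<le> enn2real (G \<omega>)" by (metis ennreal_1 ennreal_le_iff enn2real_nonneg)
    then show ?thesis using Gfin[OF that] by (simp add: g_def)
  qed
  have expZ: "exp (2 * e * (Z \<omega>)\<^sup>2) = g \<omega>" for \<omega>
    using g1[of \<omega>] e by (simp add: Z_def ln_ge_zero exp_ln)
  show thesis
  proof (rule that[of "2 * e" Z])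
    show "2 * e > 0" using e by simp
    show "Z \<in> borel_measurable M" unfolding Z_def g_def by measurable
    have "(\<integral>\<^sup>+\<omega>. ennreal (g \<omega>) \<partial>M) = (\<integral>\<^sup>+\<omega>. G \<omega> \<partial>M)" by (intro nn_integral_cong gG)
    also have "\<dots> < \<infinity>" using GC by (simp add: le_less_trans)
    finally have "integrable M g"
      by (intro integrableI_nonneg g_meas AE_I2 order_trans[OF zero_le_one g1])
    then show "integrable M (\<lambda>\<omega>. exp (2 * e * (Z \<omega>)\<^sup>2))" by (simp add: expZ)
    fix \<omega> r assume \<omega>: "\<omega> \<in> space M" and r: "r \<in> {0..T}"
    have "ennreal (exp (2 * e * (W r \<omega>)\<^sup>2)) \<le> ennreal (exp (2 * e * (Z \<omega>)\<^sup>2))"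
      unfolding expZ gG[OF \<omega>] by (rule Gge[OF \<omega> r])
    then have "(W r \<omega>)\<^sup>2 \<le> (Z \<omega>)\<^sup>2" using e by simp
    then have "\<bar>W r \<omega>\<bar> \<le> \<bar>Z \<omega>\<bar>" by (simp add: abs_le_square_iff)
    then show "\<bar>W r \<omega>\<bar> \<le> Z \<omega>" using g1[of \<omega>] e by (simp add: Z_def)
  qed
qed

end

section \<open>Smoothness in the space variable\<close>

lemma vector_mvt_bound:
  fixes f :: "real \<Rightarrow> 'a::real_normed_vector"
  assumes "\<And>y. y \<in> closed_segment x z \<Longrightarrow> (f has_vector_derivative f' y) (at y)"
    and "\<And>y. y \<in> closed_segment x z \<Longrightarrow> norm (f' y) \<le> B"
  shows "norm (f z - f x) \<le> B * \<bar>z - x\<bar>"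
proof -
  have "norm (f z - f x) \<le> B * norm (z - x)"
  proof (rule differentiable_bound[of "closed_segment x z" f "\<lambda>y h. h *\<^sub>R f' y"])
    show "(f has_derivative (\<lambda>h. h *\<^sub>R f' y)) (at y within closed_segment x z)" if "y \<in> closed_segment x z" for y
      using assms(1)[OF that] unfolding has_vector_derivative_def by (rule has_derivative_at_withinI)
    show "onorm (\<lambda>h. h *\<^sub>R f' y) \<le> B" if "y \<in> closed_segment x z" for y
      using assms(2)[OF that] by (intro onorm_le) (simp add: mult.commute[of B] mult_left_mono)
  qed auto
  then show ?thesis by simp
qed

text \<open>The form in which dominated convergence delivers derivatives.\<close>

lemma has_vector_derivative_iff_sequentially:
  fixes f :: "real \<Rightarrow> 'a::real_normed_vector"
  shows "(f has_vector_derivative D) (at x within S) \<longleftrightarrow>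
    (\<forall>X. (\<forall>n. X n \<in> S - {x}) \<longrightarrow> X \<longlonglongrightarrow> x \<longrightarrow> (\<lambda>n. (f (X n) - f x) /\<^sub>R (X n - x)) \<longlonglongrightarrow> D)"
proof -
  have "(f has_vector_derivative D) (at x within S) \<longleftrightarrow>
      ((\<lambda>y. norm ((f y - f x) - (y - x) *\<^sub>R D) / norm (y - x)) \<longlongrightarrow> 0) (at x within S)"
    unfolding has_vector_derivative_def has_derivative_iff_norm
    by (simp add: bounded_linear_scaleR_left)
  also have "\<dots> \<longleftrightarrow> ((\<lambda>y. norm ((f y - f x) /\<^sub>R (y - x) - D)) \<longlongrightarrow> 0) (at x within S)"
  proof (rule Lim_cong_within[OF refl refl refl])
    fix y assume "y \<noteq> x"
    then have "(f y - f x) /\<^sub>R (y - x) - D = ((f y - f x) - (y - x) *\<^sub>R D) /\<^sub>R (y - x)"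
      by (simp add: scaleR_diff_right)
    then show "norm ((f y - f x) - (y - x) *\<^sub>R D) / norm (y - x) = norm ((f y - f x) /\<^sub>R (y - x) - D)"
      by (simp add: divide_inverse_commute)
  qed
  also have "\<dots> \<longleftrightarrow> ((\<lambda>y. (f y - f x) /\<^sub>R (y - x)) \<longlongrightarrow> D) (at x within S)"
    by (simp add: tendsto_norm_zero_iff LIM_zero_iff)
  finally show ?thesis by (simp add: tendsto_at_iff_sequentially o_def)
qed

section \<open>Iterated derivatives and function algebras closed under differentiation\<close>

lemma nderiv_0 [simp]: "nderiv 0 g = g"
  by (simp add: nderiv_def)

lemma nderiv_Suc: "nderiv (Suc k) g x = vector_derivative (nderiv k g) (at x)"
  by (simp add: nderiv_def)

lemma nderiv_eqI:
  fixes D :: "nat \<Rightarrow> real \<Rightarrow> 'b::real_normed_vector"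
  assumes "\<And>k x. (D k has_vector_derivative D (Suc k) x) (at x)"
  shows "nderiv k (D 0) = D k"
proof (induction k)
  case (Suc k)
  show ?case
    by (rule ext) (simp add: nderiv_Suc Suc vector_derivative_at[OF assms])
qed simp

text \<open>Derivatives of \<open>exp (H 0)\<close> of high order are unwieldy polynomials in
  \<open>exp (H 0)\<close> and the \<open>H j\<close>. Membership in a generated algebra replaces
  their explicit form. The index \<open>i\<close> collects everything that stays fixed under
  differentiation.\<close>

inductive_set fun_alg :: "('i \<Rightarrow> real \<Rightarrow> complex) set \<Rightarrow> ('i \<Rightarrow> real \<Rightarrow> complex) set" for \<Gamma> where
  gen: "g \<in> \<Gamma> \<Longrightarrow> g \<in> fun_alg \<Gamma>"
| add: "g \<in> fun_alg \<Gamma> \<Longrightarrow> h \<in> fun_alg \<Gamma> \<Longrightarrow> (\<lambda>i x. g i x + h i x) \<in> fun_alg \<Gamma>"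
| mult: "g \<in> fun_alg \<Gamma> \<Longrightarrow> h \<in> fun_alg \<Gamma> \<Longrightarrow> (\<lambda>i x. g i x * h i x) \<in> fun_alg \<Gamma>"

lemma fun_alg_derivative:
  assumes gen: "\<And>g. g \<in> \<Gamma> \<Longrightarrow> \<exists>g'\<in>fun_alg \<Gamma>. \<forall>i\<in>I. \<forall>x. (g i has_vector_derivative g' i x) (at x)"
    and "g \<in> fun_alg \<Gamma>"
  shows "\<exists>g'\<in>fun_alg \<Gamma>. \<forall>i\<in>I. \<forall>x. (g i has_vector_derivative g' i x) (at x)"
  using assms(2)
proof induction
  case (gen g)
  then show ?case by (rule assms(1))
next
  case (add g h)
  then obtain g' h' where g': "g' \<in> fun_alg \<Gamma>" "\<forall>i\<in>I. \<forall>x. (g i has_vector_derivative g' i x) (at x)"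
    and h': "h' \<in> fun_alg \<Gamma>" "\<forall>i\<in>I. \<forall>x. (h i has_vector_derivative h' i x) (at x)" by auto
  show ?case
    by (rule bexI[where x = "\<lambda>i x. g' i x + h' i x"])
       (use g' h' in \<open>auto intro!: fun_alg.add has_vector_derivative_add\<close>)
next
  case (mult g h)
  then obtain g' h' where g': "g' \<in> fun_alg \<Gamma>" "\<forall>i\<in>I. \<forall>x. (g i has_vector_derivative g' i x) (at x)"
    and h': "h' \<in> fun_alg \<Gamma>" "\<forall>i\<in>I. \<forall>x. (h i has_vector_derivative h' i x) (at x)" by auto
  show ?case
    by (rule bexI[where x = "\<lambda>i x. g i x * h' i x + g' i x * h i x"])
       (use g' h' mult.hyps in \<open>auto intro!: fun_alg.add fun_alg.mult has_vector_derivative_mult\<close>)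
qed

text \<open>A chosen derivative inside the algebra is iterated, so that any property stable under
  sums and products reaches all orders at once.\<close>

lemma fun_alg_derivatives:
  assumes gen: "\<And>g. g \<in> \<Gamma> \<Longrightarrow> \<exists>g'\<in>fun_alg \<Gamma>. \<forall>i\<in>I. \<forall>x. (g i has_vector_derivative g' i x) (at x)"
    and "g \<in> fun_alg \<Gamma>"
  obtains D where "D 0 = g" "\<And>k. D k \<in> fun_alg \<Gamma>"
    "\<And>k i x. i \<in> I \<Longrightarrow> (D k i has_vector_derivative D (Suc k) i x) (at x)"
    "\<And>k i. i \<in> I \<Longrightarrow> nderiv k (g i) = D k i"
proof -
  have "\<forall>g\<in>fun_alg \<Gamma>. \<exists>g'. g' \<in> fun_alg \<Gamma> \<and> (\<forall>i\<in>I. \<forall>x. (g i has_vector_derivative g' i x) (at x))"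
    using fun_alg_derivative[OF gen] by blast
  from bchoice[OF this] obtain d where
    d: "\<And>g. g \<in> fun_alg \<Gamma> \<Longrightarrow> d g \<in> fun_alg \<Gamma> \<and> (\<forall>i\<in>I. \<forall>x. (g i has_vector_derivative d g i x) (at x))"
    by blast
  define D where "D k = (d ^^ k) g" for k
  have D: "D k \<in> fun_alg \<Gamma>" for k
    using assms(2) d by (induction k) (auto simp: D_def)
  have D': "(D k i has_vector_derivative D (Suc k) i x) (at x)" if "i \<in> I" for k i x
    using d[OF D[of k]] that by (simp add: D_def)
  show thesis
    by (rule that[of D]) (use D D' nderiv_eqI[of "\<lambda>k. D k i" for i] in \<open>auto simp: D_def\<close>)
qed

text \<open>Replacing \<open>s\<close> by \<open>max s t\<close> makes the limits of integration
  constant: the kernel becomes constant on \<open>[0, t]\<close>, and the surplus \<open>t\<close>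
  times its value at \<open>s = t\<close> is subtracted.\<close>

lemma continuous_on_integral_lower_limit:
  fixes k :: "real \<Rightarrow> real \<Rightarrow> real \<Rightarrow> complex"
  assumes T: "0 \<le> T" and k: "continuous_on ({0..T} \<times> UNIV \<times> {0..T}) (\<lambda>(t, x, s). k t x s)"
  shows "continuous_on ({0..T} \<times> UNIV) (\<lambda>(t, x). integral {t..T} (k t x))"
proof -
  have kc: "continuous_on S (\<lambda>p. k (t p) (x p) (s p))"
    if "continuous_on S t" "continuous_on S x" "continuous_on S s"
      "\<And>p. p \<in> S \<Longrightarrow> t p \<in> {0..T}" "\<And>p. p \<in> S \<Longrightarrow> s p \<in> {0..T}"
    for S :: "'z::topological_space set" and t x s
    using continuous_on_compose2[OF k continuous_on_Pair[OF that(1) continuous_on_Pair[OF that(2,3)]]] that(4,5)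
    by fastforce
  have "continuous_on ({0..T} \<times> UNIV) (\<lambda>p. integral (cbox 0 T) (\<lambda>s. k (fst p) (snd p) (max s (fst p))))"
    by (rule integral_continuous_on_param) (auto simp: case_prod_beta' intro!: kc continuous_intros)
  moreover have "continuous_on ({0..T} \<times> UNIV) (\<lambda>p. k (fst p) (snd p) (fst p))"
    by (rule kc) (auto intro!: continuous_intros)
  ultimately have "continuous_on ({0..T} \<times> UNIV) (\<lambda>p. integral {0..T} (\<lambda>s. k (fst p) (snd p) (max s (fst p)))
      - fst p *\<^sub>R k (fst p) (snd p) (fst p))"
    by (intro continuous_intros) auto
  also have "?this \<longleftrightarrow> ?thesis"
  proof (rule continuous_on_cong[OF refl])
    fix p :: "real \<times> real" assume p: "p \<in> {0..T} \<times> UNIV"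
    obtain t x where px: "p = (t, x)" by (cases p)
    have t: "0 \<le> t" "t \<le> T" using p px by auto
    have "(\<lambda>s. k t x (max s t)) integrable_on {0..T}"
      by (rule integrable_continuous_real) (rule kc, use t in \<open>auto intro!: continuous_intros\<close>)
    from Henstock_Kurzweil_Integration.integral_combine[OF t this]
    have "integral {0..T} (\<lambda>s. k t x (max s t)) = integral {0..t} (\<lambda>s. k t x (max s t)) + integral {t..T} (\<lambda>s. k t x (max s t))"
      by simp
    also have "integral {0..t} (\<lambda>s. k t x (max s t)) = integral {0..t} (\<lambda>s. k t x t)"
      by (intro integral_cong) (auto simp: max_def)
    also have "\<dots> = t *\<^sub>R k t x t" using t by simp
    also have "integral {t..T} (\<lambda>s. k t x (max s t)) = integral {t..T} (k t x)"
      by (intro integral_cong) (auto simp: max_def)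
    finally show "integral {0..T} (\<lambda>s. k (fst p) (snd p) (max s (fst p))) - fst p *\<^sub>R k (fst p) (snd p) (fst p)
        = (case p of (t, x) \<Rightarrow> integral {t..T} (k t x))"
      by (simp add: px)
  qed
  finally show ?thesis .
qed

text \<open>Any number of terms in the potential, and only the sign of their total real part
  matters; the square behind \<open>p1\<close> enters when the locale is interpreted. The size of
  \<open>W\<close> is felt only through \<open>Z\<close> and \<open>e0\<close>.\<close>

locale fk = brownian M W for M :: "'w measure" and W +
  fixes a b c T :: real and m :: nat and u :: "nat \<Rightarrow> real \<Rightarrow> complex" and P :: "nat \<Rightarrow> nat \<Rightarrow> real"
    and v :: complex and q :: "nat \<Rightarrow> real" and Z :: "'w \<Rightarrow> real" and e0 :: real
  assumes T: "0 < T"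
    and u_cont: "\<And>i. i < m \<Longrightarrow> continuous_on {0..T} (u i)"
    and P_coeffs: "\<And>i. i < m \<Longrightarrow> subgauss_coeffs (P i)"
    and q_coeffs: "subgauss_coeffs q"
    and Re_potential: "\<And>s x. s \<in> {0..T} \<Longrightarrow> Re (\<Sum>i<m. u i s * of_real (pser (P i) x)) \<le> 0"
    and Re_v: "Re v = 0"
    and e0: "0 < e0" and Z_measurable: "Z \<in> borel_measurable M"
    and Z_integrable: "integrable M (\<lambda>\<omega>. exp (e0 * (Z \<omega>)\<^sup>2))"
    and W_le_Z: "\<And>\<omega> r. \<omega> \<in> space M \<Longrightarrow> r \<in> {0..T} \<Longrightarrow> \<bar>W r \<omega>\<bar> \<le> Z \<omega>"
begin

definition X :: "'w \<Rightarrow> real \<Rightarrow> real \<Rightarrow> real \<Rightarrow> real" where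
  "X \<omega> t x s = ou_sol a b c (\<lambda>r. W r \<omega>) t x s"

definition V :: "nat \<Rightarrow> real \<Rightarrow> real \<Rightarrow> complex" where
  "V j s x = (\<Sum>i<m. u i s * of_real (pser ((diffs ^^ j) (P i)) x))"

definition Q :: "nat \<Rightarrow> real \<Rightarrow> complex" where
  "Q j x = v * of_real (pser ((diffs ^^ j) q) x)"

text \<open>\<open>H j\<close> is the \<open>j\<close>-th derivative in \<open>x\<close> of the exponent, as \<open>\<partial>\<^sub>x X = exp (b (s - t))\<close>.\<close>

definition H :: "nat \<Rightarrow> real \<Rightarrow> real \<Rightarrow> 'w \<Rightarrow> complex" where
  "H j t x \<omega> = integral {t..T} (\<lambda>s. of_real (exp (real j * b * (s - t))) * V j s (X \<omega> t x s))
     + of_real (exp (real j * b * (T - t))) * Q j (X \<omega> t x T)"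

definition f :: "real \<Rightarrow> real \<Rightarrow> complex" where
  "f t x = (\<integral>\<omega>. exp (H 0 t x \<omega>) \<partial>M)"

lemma Z_nonneg: "\<omega> \<in> space M \<Longrightarrow> 0 \<le> Z \<omega>"
  using W_le_Z[of \<omega> 0] T by fastforce

lemma continuous_on_X:
  assumes "\<omega> \<in> space M" "continuous_on S t" "continuous_on S x" "continuous_on S s"
    "\<And>p. p \<in> S \<Longrightarrow> 0 \<le> t p" "\<And>p. p \<in> S \<Longrightarrow> 0 \<le> s p"
  shows "continuous_on S (\<lambda>p. X \<omega> (t p) (x p) (s p))"
  unfolding X_def by (rule continuous_on_ou_sol[OF W_continuous]) (use assms in auto)

lemma X_measurable: "0 \<le> t \<Longrightarrow> t \<le> s \<Longrightarrow> (\<lambda>\<omega>. X \<omega> t x s) \<in> borel_measurable M"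
  unfolding X_def by (rule borel_measurable_ou_sol) (auto simp: W_measurable W_continuous)

lemma X_start [simp]: "X \<omega> t x t = x"
  by (simp add: X_def)

lemma X_has_real_derivative: "((\<lambda>x. X \<omega> t x s) has_real_derivative exp (b * (s - t))) (at x)"
  unfolding X_def ou_sol_def by (auto intro!: derivative_eq_intros)

lemma X_square_bound:
  obtains K where "K \<ge> 1" "\<And>\<omega> t s x. \<omega> \<in> space M \<Longrightarrow> t \<in> {0..T} \<Longrightarrow> s \<in> {0..T} \<Longrightarrow>
     \<bar>X \<omega> t x s\<bar> \<le> K * (1 + \<bar>x\<bar> + Z \<omega>) \<and> (X \<omega> t x s)\<^sup>2 \<le> 3 * K\<^sup>2 * (1 + x\<^sup>2 + (Z \<omega>)\<^sup>2)"
proof -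
  obtain K where K: "K \<ge> 1" "\<And>w t s x Z. continuous_on {0..} w \<Longrightarrow> t \<in> {0..T} \<Longrightarrow> s \<in> {0..T} \<Longrightarrow>
       (\<And>r. r \<in> {0..T} \<Longrightarrow> \<bar>w r\<bar> \<le> Z) \<Longrightarrow> \<bar>ou_sol a b c w t x s\<bar> \<le> K * (1 + \<bar>x\<bar> + Z)"
    using ou_sol_bound[of T a b c] by blast
  have "\<bar>X \<omega> t x s\<bar> \<le> K * (1 + \<bar>x\<bar> + Z \<omega>) \<and> (X \<omega> t x s)\<^sup>2 \<le> 3 * K\<^sup>2 * (1 + x\<^sup>2 + (Z \<omega>)\<^sup>2)"
    if "\<omega> \<in> space M" "t \<in> {0..T}" "s \<in> {0..T}" for \<omega> t s x
  proof -
    have X: "\<bar>X \<omega> t x s\<bar> \<le> K * (1 + \<bar>x\<bar> + Z \<omega>)"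
      unfolding X_def by (rule K(2)) (use that W_continuous W_le_Z in auto)
    then have "\<bar>X \<omega> t x s\<bar>\<^sup>2 \<le> (K * (1 + \<bar>x\<bar> + Z \<omega>))\<^sup>2" by (intro power_mono) auto
    also have "\<dots> = K\<^sup>2 * (1 + \<bar>x\<bar> + Z \<omega>)\<^sup>2" by (simp add: power_mult_distrib)
    also have "\<dots> \<le> K\<^sup>2 * (3 * (1 + x\<^sup>2 + (Z \<omega>)\<^sup>2))"
      using zero_le_power2[of "1 - \<bar>x\<bar>"] zero_le_power2[of "1 - Z \<omega>"] zero_le_power2[of "\<bar>x\<bar> - Z \<omega>"]
      unfolding power2_eq_square by (intro mult_left_mono) (simp_all add: algebra_simps)
    finally have "(X \<omega> t x s)\<^sup>2 \<le> K\<^sup>2 * (3 * (1 + x\<^sup>2 + (Z \<omega>)\<^sup>2))" by (simp only: power2_abs)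
    then show ?thesis using X by (simp only: mult_ac simp_thms)
  qed
  then show thesis using K(1) that by blast
qed

lemma V_has_vector_derivative: "(V j s has_vector_derivative V (Suc j) s x) (at x)"
proof -
  have "((\<lambda>x. pser ((diffs ^^ j) (P i)) x) has_real_derivative pser ((diffs ^^ Suc j) (P i)) x) (at x)" if "i < m" for i
    using pser_has_real_derivative[OF subgauss_coeffs_funpow_diffs[OF P_coeffs[OF that]], of j x] by simp
  then show ?thesis unfolding V_def
    by (intro has_vector_derivative_sum has_vector_derivative_mult_right has_vector_derivative_of_real) auto
qed

lemma Q_has_vector_derivative: "(Q j has_vector_derivative Q (Suc j) x) (at x)"
proof -
  have "((\<lambda>x. pser ((diffs ^^ j) q) x) has_real_derivative pser ((diffs ^^ Suc j) q) x) (at x)"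
    using pser_has_real_derivative[OF subgauss_coeffs_funpow_diffs[OF q_coeffs], of j x] by simp
  then show ?thesis unfolding Q_def
    by (intro has_vector_derivative_mult_right has_vector_derivative_of_real)
qed

lemma continuous_on_V:
  assumes "continuous_on S s" "continuous_on S x" "\<And>p. p \<in> S \<Longrightarrow> s p \<in> {0..T}"
  shows "continuous_on S (\<lambda>p. V j (s p) (x p))"
proof -
  have "continuous_on S (\<lambda>p. u i (s p))" if "i < m" for i
    by (rule continuous_on_compose2[OF u_cont[OF that] assms(1)]) (use assms(3) in auto)
  then show ?thesis unfolding V_def
    by (intro continuous_intros subgauss_coeffs_funpow_diffs P_coeffs assms) auto
qed

lemma continuous_on_Q: "continuous_on S x \<Longrightarrow> continuous_on S (\<lambda>p. Q j (x p))"
  unfolding Q_def by (intro continuous_intros subgauss_coeffs_funpow_diffs q_coeffs)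

lemma V_bound:
  assumes "l > 0"
  obtains C where "C \<ge> 0" "\<And>s x. s \<in> {0..T} \<Longrightarrow> norm (V j s x) \<le> C * exp (l * x\<^sup>2)"
proof -
  have "\<exists>C\<ge>0. \<forall>s\<in>{0..T}. \<forall>x. norm (u i s * of_real (pser ((diffs ^^ j) (P i)) x)) \<le> C * exp (l * x\<^sup>2)" if i: "i < m" for i
  proof -
    obtain C where C: "C \<ge> 0" "\<And>x. \<bar>pser ((diffs ^^ j) (P i)) x\<bar> \<le> C * exp (l * x\<^sup>2)"
      using pser_bound[OF subgauss_coeffs_funpow_diffs[OF P_coeffs[OF i]] assms] by blast
    have "bounded (u i ` {0..T})"
      by (intro compact_imp_bounded compact_continuous_image u_cont i) simp
    then obtain B where B: "\<And>s. s \<in> {0..T} \<Longrightarrow> norm (u i s) \<le> B" unfolding bounded_iff by blast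
    have "0 \<le> norm (u i 0)" by simp
    also have "\<dots> \<le> B" using T by (intro B) auto
    finally have B0: "B \<ge> 0" .
    have "norm (u i s * of_real (pser ((diffs ^^ j) (P i)) x)) \<le> (B * C) * exp (l * x\<^sup>2)" if "s \<in> {0..T}" for s x
      using mult_mono[OF B[OF that] C(2)[of x] B0] by (simp add: norm_mult mult.assoc)
    then show ?thesis using B0 C(1) by (intro exI[of _ "B * C"]) auto
  qed
  then obtain C where C: "\<And>i. i < m \<Longrightarrow> C i \<ge> 0"
    "\<And>i s x. i < m \<Longrightarrow> s \<in> {0..T} \<Longrightarrow> norm (u i s * of_real (pser ((diffs ^^ j) (P i)) x)) \<le> C i * exp (l * x\<^sup>2)"
    by metis
  have "norm (V j s x) \<le> (\<Sum>i<m. C i) * exp (l * x\<^sup>2)" if "s \<in> {0..T}" for s x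
    unfolding V_def sum_distrib_right
    by (rule order_trans[OF norm_sum]) (intro sum_mono C that, auto)
  moreover have "(\<Sum>i<m. C i) \<ge> 0" by (intro sum_nonneg C) auto
  ultimately show thesis using that by blast
qed

lemma Q_bound:
  assumes "l > 0"
  obtains C where "C \<ge> 0" "\<And>x. norm (Q j x) \<le> C * exp (l * x\<^sup>2)"
proof -
  obtain C where C: "C \<ge> 0" "\<And>x. \<bar>pser ((diffs ^^ j) q) x\<bar> \<le> C * exp (l * x\<^sup>2)"
    using pser_bound[OF subgauss_coeffs_funpow_diffs[OF q_coeffs] assms] by blast
  have "norm (Q j x) \<le> (norm v * C) * exp (l * x\<^sup>2)" for x
    using mult_left_mono[OF C(2)[of x], of "norm v"] by (simp add: Q_def norm_mult mult.assoc)
  then show thesis using that[of "norm v * C"] C(1) by auto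
qed

text \<open>Being bounded by \<open>C exp (l (x\<^sup>2 + Z\<^sup>2))\<close> for every \<open>l > 0\<close> is stable under products, and one
  admissible \<open>l\<close> makes the bound integrable, so a single dominating function serves all limits.\<close>

definition tame :: "(real \<times> 'w \<Rightarrow> real \<Rightarrow> complex) \<Rightarrow> bool" where
  "tame g \<longleftrightarrow>
     (\<forall>t\<in>{0..T}. \<forall>x. (\<lambda>\<omega>. g (t, \<omega>) x) \<in> borel_measurable M) \<and>
     (\<forall>\<omega>\<in>space M. continuous_on ({0..T} \<times> UNIV) (\<lambda>(t, x). g (t, \<omega>) x)) \<and>
     (\<forall>l>0. \<exists>C. \<forall>t\<in>{0..T}. \<forall>x. \<forall>\<omega>\<in>space M. norm (g (t, \<omega>) x) \<le> C * exp (l * (x\<^sup>2 + (Z \<omega>)\<^sup>2)))"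

lemma tame_measurable: "tame g \<Longrightarrow> t \<in> {0..T} \<Longrightarrow> (\<lambda>\<omega>. g (t, \<omega>) x) \<in> borel_measurable M"
  by (simp add: tame_def)

lemma tame_continuous: "tame g \<Longrightarrow> \<omega> \<in> space M \<Longrightarrow> continuous_on ({0..T} \<times> UNIV) (\<lambda>(t, x). g (t, \<omega>) x)"
  by (simp add: tame_def)

lemma tame_bound:
  assumes "tame g" "l > 0"
  obtains C where "C \<ge> 0"
    "\<And>t x \<omega>. t \<in> {0..T} \<Longrightarrow> \<omega> \<in> space M \<Longrightarrow> norm (g (t, \<omega>) x) \<le> C * exp (l * (x\<^sup>2 + (Z \<omega>)\<^sup>2))"
proof -
  obtain C where C: "\<forall>t\<in>{0..T}. \<forall>x. \<forall>\<omega>\<in>space M. norm (g (t, \<omega>) x) \<le> C * exp (l * (x\<^sup>2 + (Z \<omega>)\<^sup>2))"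
    using assms unfolding tame_def by blast
  \<comment> \<open>The sample space is nonempty, so the bound at one point forces the constant to
    be nonnegative.\<close>
  obtain \<omega> where \<omega>: "\<omega> \<in> space M" using not_empty by auto
  have "0 \<le> norm (g (0, \<omega>) 0)" by simp
  also have "0 \<in> {0..T}" using T by simp
  then have "norm (g (0, \<omega>) 0) \<le> C * exp (l * (0\<^sup>2 + (Z \<omega>)\<^sup>2))" using C \<omega> by blast
  finally have "C \<ge> 0" by (simp add: zero_le_mult_iff)
  then show thesis using that C by blast
qed

lemma tame_add:
  assumes "tame g" "tame h"
  shows "tame (\<lambda>i x. g i x + h i x)"
  unfolding tame_def
proof (intro conjI ballI allI impI)
  show "(\<lambda>\<omega>. g (t, \<omega>) x + h (t, \<omega>) x) \<in> borel_measurable M" if "t \<in> {0..T}" for t x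
    using tame_measurable[OF assms(1) that] tame_measurable[OF assms(2) that] by (intro borel_measurable_add)
  show "continuous_on ({0..T} \<times> UNIV) (\<lambda>(t, x). g (t, \<omega>) x + h (t, \<omega>) x)" if "\<omega> \<in> space M" for \<omega>
    using tame_continuous[OF assms(1) that] tame_continuous[OF assms(2) that]
    unfolding case_prod_beta' by (intro continuous_intros)
  fix l :: real assume l: "l > 0"
  obtain C where C: "C \<ge> 0" "\<And>t x \<omega>. t \<in> {0..T} \<Longrightarrow> \<omega> \<in> space M \<Longrightarrow> norm (g (t, \<omega>) x) \<le> C * exp (l * (x\<^sup>2 + (Z \<omega>)\<^sup>2))"
    using tame_bound[OF assms(1) l] by blast
  obtain D where D: "D \<ge> 0" "\<And>t x \<omega>. t \<in> {0..T} \<Longrightarrow> \<omega> \<in> space M \<Longrightarrow> norm (h (t, \<omega>) x) \<le> D * exp (l * (x\<^sup>2 + (Z \<omega>)\<^sup>2))"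
    using tame_bound[OF assms(2) l] by blast
  show "\<exists>C. \<forall>t\<in>{0..T}. \<forall>x. \<forall>\<omega>\<in>space M. norm (g (t, \<omega>) x + h (t, \<omega>) x) \<le> C * exp (l * (x\<^sup>2 + (Z \<omega>)\<^sup>2))"
    by (rule exI[of _ "C + D"]) (auto simp: distrib_right intro!: norm_triangle_mono C(2) D(2))
qed

lemma tame_mult:
  assumes "tame g" "tame h"
  shows "tame (\<lambda>i x. g i x * h i x)"
  unfolding tame_def
proof (intro conjI ballI allI impI)
  show "(\<lambda>\<omega>. g (t, \<omega>) x * h (t, \<omega>) x) \<in> borel_measurable M" if "t \<in> {0..T}" for t x
    using tame_measurable[OF assms(1) that] tame_measurable[OF assms(2) that] by (intro borel_measurable_times)
  show "continuous_on ({0..T} \<times> UNIV) (\<lambda>(t, x). g (t, \<omega>) x * h (t, \<omega>) x)" if "\<omega> \<in> space M" for \<omega>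
    using tame_continuous[OF assms(1) that] tame_continuous[OF assms(2) that]
    unfolding case_prod_beta' by (intro continuous_intros)
  fix l :: real assume l: "l > 0"
  \<comment> \<open>Each factor is granted half of the exponent.\<close>
  then have l2: "l / 2 > 0" by simp
  obtain C where C: "C \<ge> 0" "\<And>t x \<omega>. t \<in> {0..T} \<Longrightarrow> \<omega> \<in> space M \<Longrightarrow> norm (g (t, \<omega>) x) \<le> C * exp (l / 2 * (x\<^sup>2 + (Z \<omega>)\<^sup>2))"
    using tame_bound[OF assms(1) l2] by blast
  obtain D where D: "D \<ge> 0" "\<And>t x \<omega>. t \<in> {0..T} \<Longrightarrow> \<omega> \<in> space M \<Longrightarrow> norm (h (t, \<omega>) x) \<le> D * exp (l / 2 * (x\<^sup>2 + (Z \<omega>)\<^sup>2))"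
    using tame_bound[OF assms(2) l2] by blast
  have "norm (g (t, \<omega>) x * h (t, \<omega>) x) \<le> (C * D) * exp (l * (x\<^sup>2 + (Z \<omega>)\<^sup>2))"
    if "t \<in> {0..T}" "\<omega> \<in> space M" for t x \<omega>
  proof -
    have "norm (g (t, \<omega>) x * h (t, \<omega>) x) \<le> (C * exp (l / 2 * (x\<^sup>2 + (Z \<omega>)\<^sup>2))) * (D * exp (l / 2 * (x\<^sup>2 + (Z \<omega>)\<^sup>2)))"
      unfolding norm_mult using that C(1) by (intro mult_mono C(2) D(2)) auto
    also have "\<dots> = (C * D) * (exp (l / 2 * (x\<^sup>2 + (Z \<omega>)\<^sup>2)) * exp (l / 2 * (x\<^sup>2 + (Z \<omega>)\<^sup>2)))" by simp
    also have "exp (l / 2 * (x\<^sup>2 + (Z \<omega>)\<^sup>2)) * exp (l / 2 * (x\<^sup>2 + (Z \<omega>)\<^sup>2)) = exp (l * (x\<^sup>2 + (Z \<omega>)\<^sup>2))"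
      by (simp add: exp_add[symmetric])
    finally show ?thesis .
  qed
  then show "\<exists>C. \<forall>t\<in>{0..T}. \<forall>x. \<forall>\<omega>\<in>space M. norm (g (t, \<omega>) x * h (t, \<omega>) x) \<le> C * exp (l * (x\<^sup>2 + (Z \<omega>)\<^sup>2))"
    by blast
qed

lemma exp_Z_integrable:
  assumes "l \<le> e0"
  shows "integrable M (\<lambda>\<omega>. exp (l * (Z \<omega>)\<^sup>2))"
proof (rule Bochner_Integration.integrable_bound[OF Z_integrable])
  show "(\<lambda>\<omega>. exp (l * (Z \<omega>)\<^sup>2)) \<in> borel_measurable M" using Z_measurable by measurable
qed (use assms in \<open>auto intro!: AE_I2 mult_right_mono\<close>)

lemma tame_dominated:
  assumes "tame g"
  obtains D where "integrable M D"
    "\<And>t x \<omega>. t \<in> {0..T} \<Longrightarrow> \<bar>x\<bar> \<le> R \<Longrightarrow> \<omega> \<in> space M \<Longrightarrow> norm (g (t, \<omega>) x) \<le> D \<omega>"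
proof -
  obtain C where C: "C \<ge> 0" "\<And>t x \<omega>. t \<in> {0..T} \<Longrightarrow> \<omega> \<in> space M \<Longrightarrow> norm (g (t, \<omega>) x) \<le> C * exp (e0 * (x\<^sup>2 + (Z \<omega>)\<^sup>2))"
    using tame_bound[OF assms e0] by blast
  show thesis
  proof (rule that[of "\<lambda>\<omega>. (C * exp (e0 * R\<^sup>2)) * exp (e0 * (Z \<omega>)\<^sup>2)"])
    show "integrable M (\<lambda>\<omega>. (C * exp (e0 * R\<^sup>2)) * exp (e0 * (Z \<omega>)\<^sup>2))"
      using Z_integrable by (rule integrable_mult_right)
    fix t x \<omega> assume "t \<in> {0..T}" "\<bar>x\<bar> \<le> R" "\<omega> \<in> space M"
    then have "norm (g (t, \<omega>) x) \<le> C * exp (e0 * (x\<^sup>2 + (Z \<omega>)\<^sup>2))" by (intro C)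
    also have "x\<^sup>2 \<le> R\<^sup>2" using power_mono[OF \<open>\<bar>x\<bar> \<le> R\<close>, of 2] by simp
    then have "C * exp (e0 * (x\<^sup>2 + (Z \<omega>)\<^sup>2)) \<le> C * exp (e0 * (R\<^sup>2 + (Z \<omega>)\<^sup>2))"
      using C(1) e0 by (intro mult_left_mono) auto
    finally show "norm (g (t, \<omega>) x) \<le> (C * exp (e0 * R\<^sup>2)) * exp (e0 * (Z \<omega>)\<^sup>2)"
      by (simp add: distrib_left exp_add mult.assoc)
  qed
qed

lemma tame_integrable:
  assumes "tame g" "t \<in> {0..T}"
  shows "integrable M (\<lambda>\<omega>. g (t, \<omega>) x)"
proof -
  obtain D where D: "integrable M D"
    "\<And>t y \<omega>. t \<in> {0..T} \<Longrightarrow> \<bar>y\<bar> \<le> \<bar>x\<bar> \<Longrightarrow> \<omega> \<in> space M \<Longrightarrow> norm (g (t, \<omega>) y) \<le> D \<omega>"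
    using tame_dominated[OF assms(1)] by blast
  show ?thesis
  proof (rule Bochner_Integration.integrable_bound[OF D(1)])
    show "(\<lambda>\<omega>. g (t, \<omega>) x) \<in> borel_measurable M" by (rule tame_measurable[OF assms])
    show "AE \<omega> in M. norm (g (t, \<omega>) x) \<le> norm (D \<omega>)"
    proof (rule AE_I2)
      fix \<omega> assume "\<omega> \<in> space M"
      then have "norm (g (t, \<omega>) x) \<le> D \<omega>" using D(2)[OF assms(2)] by blast
      then show "norm (g (t, \<omega>) x) \<le> norm (D \<omega>)" by simp
    qed
  qed
qed

lemma tame_expectation_tendsto:
  assumes g: "tame g" and t: "\<And>n. t n \<in> {0..T}" "t \<longlonglongrightarrow> t0" and x: "x \<longlonglongrightarrow> x0"
  shows "(\<lambda>n. \<integral>\<omega>. g (t n, \<omega>) (x n) \<partial>M) \<longlonglongrightarrow> (\<integral>\<omega>. g (t0, \<omega>) x0 \<partial>M)"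
proof -
  have t0: "t0 \<in> {0..T}" by (rule closed_sequentially[OF closed_atLeastAtMost]) (use t in auto)
  obtain R where R: "\<And>n. \<bar>x n\<bar> \<le> R" using convergent_imp_Bseq[OF convergentI[OF x]] unfolding Bseq_def by auto
  obtain D where D: "integrable M D"
    "\<And>t y \<omega>. t \<in> {0..T} \<Longrightarrow> \<bar>y\<bar> \<le> R \<Longrightarrow> \<omega> \<in> space M \<Longrightarrow> norm (g (t, \<omega>) y) \<le> D \<omega>"
    using tame_dominated[OF g] by blast
  show ?thesis
  proof (rule integral_dominated_convergence[where w = D])
    show "AE \<omega> in M. (\<lambda>n. g (t n, \<omega>) (x n)) \<longlonglongrightarrow> g (t0, \<omega>) x0"
    proof (rule AE_I2)
      fix \<omega> assume "\<omega> \<in> space M"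
      from continuous_on_tendsto_compose[OF tame_continuous[OF g this] tendsto_Pair[OF t(2) x]] t t0
      show "(\<lambda>n. g (t n, \<omega>) (x n)) \<longlonglongrightarrow> g (t0, \<omega>) x0" by simp
    qed
  qed (use D t R t0 tame_measurable[OF g] in \<open>auto intro!: AE_I2\<close>)
qed

lemma tame_expectation_continuous:
  assumes "tame g"
  shows "continuous_on ({0..T} \<times> UNIV) (\<lambda>(t, x). \<integral>\<omega>. g (t, \<omega>) x \<partial>M)"
  unfolding continuous_on_sequentially
proof (intro allI ballI impI, elim conjE)
  fix p :: "nat \<Rightarrow> real \<times> real" and p0
  assume "p0 \<in> {0..T} \<times> UNIV" "\<forall>n. p n \<in> {0..T} \<times> UNIV" "p \<longlonglongrightarrow> p0"
  then show "((\<lambda>(t, x). \<integral>\<omega>. g (t, \<omega>) x \<partial>M) \<circ> p) \<longlonglongrightarrow> (case p0 of (t, x) \<Rightarrow> \<integral>\<omega>. g (t, \<omega>) x \<partial>M)"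
    unfolding o_def case_prod_beta'
    by (intro tame_expectation_tendsto assms tendsto_fst tendsto_snd) (auto simp: mem_Times_iff)
qed

lemma tame_expectation_bound:
  assumes "tame g" "l > 0"
  obtains C where "C \<ge> 0" "\<And>t x. t \<in> {0..T} \<Longrightarrow> norm (\<integral>\<omega>. g (t, \<omega>) x \<partial>M) \<le> C * exp (l * x\<^sup>2)"
proof -
  \<comment> \<open>At most \<open>l\<close> for the growth that is claimed, at most
    \<open>e0\<close> for the integrability of \<open>exp (l' * Z^2)\<close>.\<close>
  define l' where "l' = min l e0"
  have l': "l' > 0" "l' \<le> l" "l' \<le> e0" using assms e0 by (auto simp: l'_def)
  obtain C where C: "C \<ge> 0" "\<And>t x \<omega>. t \<in> {0..T} \<Longrightarrow> \<omega> \<in> space M \<Longrightarrow> norm (g (t, \<omega>) x) \<le> C * exp (l' * (x\<^sup>2 + (Z \<omega>)\<^sup>2))"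
    using tame_bound[OF assms(1) l'(1)] by blast
  define E where "E = (\<integral>\<omega>. exp (l' * (Z \<omega>)\<^sup>2) \<partial>M)"
  have E: "E \<ge> 0" unfolding E_def by (intro integral_nonneg_AE) simp
  have "norm (\<integral>\<omega>. g (t, \<omega>) x \<partial>M) \<le> (C * E) * exp (l * x\<^sup>2)" if t: "t \<in> {0..T}" for t x
  proof -
    have "norm (\<integral>\<omega>. g (t, \<omega>) x \<partial>M) \<le> (\<integral>\<omega>. (C * exp (l' * x\<^sup>2)) * exp (l' * (Z \<omega>)\<^sup>2) \<partial>M)"
    proof (rule order_trans[OF integral_norm_bound integral_mono])
      show "integrable M (\<lambda>\<omega>. norm (g (t, \<omega>) x))" by (intro integrable_norm tame_integrable[OF assms(1) t])
      show "integrable M (\<lambda>\<omega>. (C * exp (l' * x\<^sup>2)) * exp (l' * (Z \<omega>)\<^sup>2))"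
        by (intro integrable_mult_right exp_Z_integrable l')
      show "norm (g (t, \<omega>) x) \<le> (C * exp (l' * x\<^sup>2)) * exp (l' * (Z \<omega>)\<^sup>2)" if "\<omega> \<in> space M" for \<omega>
        using C(2)[OF t that, of x] by (simp add: distrib_left exp_add mult.assoc)
    qed
    also have "\<dots> = (C * exp (l' * x\<^sup>2)) * E" unfolding E_def by simp
    also have "\<dots> \<le> (C * exp (l * x\<^sup>2)) * E"
      using C(1) E l' by (intro mult_right_mono mult_left_mono) (auto intro: mult_right_mono)
    finally show ?thesis by (simp add: mult_ac)
  qed
  then show thesis using that[of "C * E"] C(1) E by auto
qed

text \<open>Difference quotients are dominated through the mean value theorem by a bound on
  \<open>g'\<close> that is uniform over a bounded range of \<open>x\<close>.\<close>

lemma tame_expectation_derivative: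
  assumes g: "tame g" and g': "tame g'" and t: "t \<in> {0..T}"
    and d: "\<And>\<omega> x. \<omega> \<in> space M \<Longrightarrow> (g (t, \<omega>) has_vector_derivative g' (t, \<omega>) x) (at x)"
  shows "((\<lambda>x. \<integral>\<omega>. g (t, \<omega>) x \<partial>M) has_vector_derivative (\<integral>\<omega>. g' (t, \<omega>) x \<partial>M)) (at x)"
  unfolding has_vector_derivative_iff_sequentially
proof (intro allI impI)
  fix y :: "nat \<Rightarrow> real" assume yx: "\<forall>n. y n \<in> UNIV - {x}" and y: "y \<longlonglongrightarrow> x"
  obtain R where R: "\<And>n. \<bar>y n\<bar> \<le> R" using convergent_imp_Bseq[OF convergentI[OF y]] unfolding Bseq_def by auto
  obtain D where D: "integrable M D"
    "\<And>t z \<omega>. t \<in> {0..T} \<Longrightarrow> \<bar>z\<bar> \<le> max R \<bar>x\<bar> \<Longrightarrow> \<omega> \<in> space M \<Longrightarrow> norm (g' (t, \<omega>) z) \<le> D \<omega>"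
    using tame_dominated[OF g'] by blast
  have "(\<lambda>n. \<integral>\<omega>. (g (t, \<omega>) (y n) - g (t, \<omega>) x) /\<^sub>R (y n - x) \<partial>M) \<longlonglongrightarrow> (\<integral>\<omega>. g' (t, \<omega>) x \<partial>M)"
  proof (rule integral_dominated_convergence[where w = D])
    show "AE \<omega> in M. (\<lambda>n. (g (t, \<omega>) (y n) - g (t, \<omega>) x) /\<^sub>R (y n - x)) \<longlonglongrightarrow> g' (t, \<omega>) x"
      using d yx y unfolding has_vector_derivative_iff_sequentially by (intro AE_I2) blast
    show "AE \<omega> in M. norm ((g (t, \<omega>) (y n) - g (t, \<omega>) x) /\<^sub>R (y n - x)) \<le> D \<omega>" for n
    proof (rule AE_I2)
      fix \<omega> assume \<omega>: "\<omega> \<in> space M"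
      have "norm (g (t, \<omega>) (y n) - g (t, \<omega>) x) \<le> D \<omega> * \<bar>y n - x\<bar>"
      proof (rule vector_mvt_bound[OF d[OF \<omega>]])
        fix z assume "z \<in> closed_segment x (y n)"
        then have "\<bar>z\<bar> \<le> max \<bar>y n\<bar> \<bar>x\<bar>" by (auto simp: closed_segment_eq_real_ivl split: if_splits)
        also have "\<dots> \<le> max R \<bar>x\<bar>" using R[of n] by auto
        finally show "norm (g' (t, \<omega>) z) \<le> D \<omega>" using D(2) t \<omega> by blast
      qed
      then show "norm ((g (t, \<omega>) (y n) - g (t, \<omega>) x) /\<^sub>R (y n - x)) \<le> D \<omega>"
        using yx by (simp add: divide_simps mult.commute)
    qed
    show "(\<lambda>\<omega>. (g (t, \<omega>) (y n) - g (t, \<omega>) x) /\<^sub>R (y n - x)) \<in> borel_measurable M" for n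
      using tame_measurable[OF g t] by measurable
  qed (use D tame_measurable[OF g' t] in auto)
  then show "(\<lambda>n. ((\<integral>\<omega>. g (t, \<omega>) (y n) \<partial>M) - (\<integral>\<omega>. g (t, \<omega>) x \<partial>M)) /\<^sub>R (y n - x)) \<longlonglongrightarrow> (\<integral>\<omega>. g' (t, \<omega>) x \<partial>M)"
    using tame_integrable[OF g t] by simp
qed

section \<open>Regularity and growth of the exponent\<close>

lemma continuous_on_kernel:
  assumes "\<omega> \<in> space M" "continuous_on S t" "continuous_on S x" "continuous_on S s"
    "\<And>p. p \<in> S \<Longrightarrow> t p \<in> {0..T}" "\<And>p. p \<in> S \<Longrightarrow> s p \<in> {0..T}"
  shows "continuous_on S (\<lambda>p. of_real (exp (real j * b * (s p - t p))) * V j (s p) (X \<omega> (t p) (x p) (s p)))"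
  using assms(5,6) by (intro continuous_intros continuous_on_V continuous_on_X assms) force+

lemma H_has_vector_derivative:
  assumes \<omega>: "\<omega> \<in> space M" and t: "t \<in> {0..T}"
  shows "((\<lambda>x. H j t x \<omega>) has_vector_derivative H (Suc j) t x \<omega>) (at x)"
proof -
  \<comment> \<open>Serves twice: for \<open>V\<close> at a fixed time and for \<open>Q\<close>. As
    \<open>X\<close> is affine in \<open>x\<close>, differentiation produces a single term.\<close>
  have chain: "((\<lambda>x. of_real (exp (real j * b * (s - t))) * G j (X \<omega> t x s)) has_vector_derivative
      of_real (exp (real (Suc j) * b * (s - t))) * G (Suc j) (X \<omega> t x s)) (at x)"
    if G: "\<And>y. (G j has_vector_derivative G (Suc j) y) (at y)" for G :: "nat \<Rightarrow> real \<Rightarrow> complex" and s x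
  proof -
    have "((\<lambda>x. X \<omega> t x s) has_vector_derivative exp (b * (s - t))) (at x)"
      using X_has_real_derivative by (simp add: has_real_derivative_iff_has_vector_derivative)
    from vector_diff_chain_at[OF this G]
    have "((\<lambda>x. G j (X \<omega> t x s)) has_vector_derivative exp (b * (s - t)) *\<^sub>R G (Suc j) (X \<omega> t x s)) (at x)"
      by (simp add: o_def)
    from has_vector_derivative_mult_right[OF this, of "of_real (exp (real j * b * (s - t)))"]
    have "((\<lambda>x. of_real (exp (real j * b * (s - t))) * G j (X \<omega> t x s)) has_vector_derivative
        of_real (exp (real j * b * (s - t)) * exp (b * (s - t))) * G (Suc j) (X \<omega> t x s)) (at x)"
      by (simp add: scaleR_conv_of_real mult.assoc)
    also have "exp (real j * b * (s - t)) * exp (b * (s - t)) = exp (real (Suc j) * b * (s - t))"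
      by (simp add: exp_add[symmetric] algebra_simps)
    finally show ?thesis .
  qed
  have "((\<lambda>x. integral (cbox t T) (\<lambda>s. of_real (exp (real j * b * (s - t))) * V j s (X \<omega> t x s))) has_vector_derivative
     integral (cbox t T) (\<lambda>s. of_real (exp (real (Suc j) * b * (s - t))) * V (Suc j) s (X \<omega> t x s))) (at x within UNIV)"
  proof (rule leibniz_rule_vector_derivative)
    show "((\<lambda>x. of_real (exp (real j * b * (s - t))) * V j s (X \<omega> t x s)) has_vector_derivative
        of_real (exp (real (Suc j) * b * (s - t))) * V (Suc j) s (X \<omega> t x s)) (at x within UNIV)" for s x
      using chain[of "\<lambda>j. V j s", OF V_has_vector_derivative] by simp
    show "(\<lambda>s. of_real (exp (real j * b * (s - t))) * V j s (X \<omega> t x s)) integrable_on cbox t T" for x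
      by (rule integrable_continuous) (rule continuous_on_kernel[OF \<omega>], use t in \<open>auto intro!: continuous_intros\<close>)
    show "continuous_on (UNIV \<times> cbox t T) (\<lambda>(x, s). of_real (exp (real (Suc j) * b * (s - t))) * V (Suc j) s (X \<omega> t x s))"
      unfolding case_prod_beta' by (rule continuous_on_kernel[OF \<omega>]) (use t in \<open>auto intro!: continuous_intros\<close>)
  qed auto
  then show ?thesis
    unfolding H_def by (intro has_vector_derivative_add chain Q_has_vector_derivative) simp
qed

text \<open>The algebra \<open>N\<close> is left open because the Markov property needs the integral
  up to \<open>r\<close> measurable for the past alone.\<close>

lemma integral_V_measurable:
  assumes N: "space N = space M" and t: "t \<in> {0..T}" "r \<in> {t..T}"
    and X: "\<And>s. s \<in> {t..r} \<Longrightarrow> (\<lambda>\<omega>. X \<omega> t x s) \<in> borel_measurable N"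
  shows "(\<lambda>\<omega>. integral {t..r} (\<lambda>s. of_real (exp (real j * b * (s - t))) * V j s (X \<omega> t x s))) \<in> borel_measurable N"
proof (rule borel_measurable_integral_param)
  show "continuous_on {t..r} (\<lambda>s. of_real (exp (real j * b * (s - t))) * V j s (X \<omega> t x s))" if "\<omega> \<in> space N" for \<omega>
    by (rule continuous_on_kernel) (use t that N in \<open>auto intro!: continuous_intros\<close>)
  fix s assume s: "s \<in> {t..r}"
  have "continuous_on UNIV (\<lambda>y. V j s y)"
    by (intro continuous_on_V continuous_intros) (use s t in auto)
  then have "(\<lambda>\<omega>. V j s (X \<omega> t x s)) \<in> borel_measurable N"
    by (intro measurable_compose[OF X[OF s]] borel_measurable_continuous_onI)
  then show "(\<lambda>\<omega>. of_real (exp (real j * b * (s - t))) * V j s (X \<omega> t x s)) \<in> borel_measurable N"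
    by (intro borel_measurable_times borel_measurable_const)
qed (use t in auto)

lemma H_measurable_if:
  assumes N: "space N = space M" and t: "t \<in> {0..T}"
    and X: "\<And>s. s \<in> {t..T} \<Longrightarrow> (\<lambda>\<omega>. X \<omega> t x s) \<in> borel_measurable N"
  shows "(\<lambda>\<omega>. H j t x \<omega>) \<in> borel_measurable N"
proof -
  have "(\<lambda>\<omega>. Q j (X \<omega> t x T)) \<in> borel_measurable N"
    by (intro measurable_compose[OF X] borel_measurable_continuous_onI continuous_on_Q continuous_intros)
       (use t in auto)
  then show ?thesis unfolding H_def using t
    by (intro borel_measurable_add borel_measurable_times borel_measurable_const integral_V_measurable N X) auto
qed

lemma H_measurable: "t \<in> {0..T} \<Longrightarrow> (\<lambda>\<omega>. H j t x \<omega>) \<in> borel_measurable M"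
  by (rule H_measurable_if) (auto intro: X_measurable)

lemma H_continuous:
  assumes "\<omega> \<in> space M"
  shows "continuous_on ({0..T} \<times> UNIV) (\<lambda>(t, x). H j t x \<omega>)"
proof -
  have "continuous_on ({0..T} \<times> UNIV \<times> {0..T})
      (\<lambda>(t, x, s). of_real (exp (real j * b * (s - t))) * V j s (X \<omega> t x s))"
    unfolding case_prod_beta' by (rule continuous_on_kernel[OF assms]) (auto intro!: continuous_intros)
  from continuous_on_integral_lower_limit[OF _ this] T
  have "continuous_on ({0..T} \<times> UNIV) (\<lambda>p. integral {fst p..T} (\<lambda>s. of_real (exp (real j * b * (s - fst p))) * V j s (X \<omega> (fst p) (snd p) s)))"
    by (simp add: case_prod_beta')
  moreover have "continuous_on ({0..T} \<times> UNIV) (\<lambda>p. of_real (exp (real j * b * (T - fst p))) * Q j (X \<omega> (fst p) (snd p) T))"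
    by (intro continuous_intros continuous_on_Q continuous_on_X assms) (use T in auto)
  ultimately show ?thesis unfolding H_def case_prod_beta' by (rule continuous_on_add)
qed

text \<open>Passing from \<open>X\<close> to \<open>x\<close> and \<open>Z\<close> multiplies the
  exponent by \<open>3 * K^2\<close>, which shrinking \<open>l'\<close> undoes.
  \<open>V_bound\<close> and \<open>Q_bound\<close> hold for every positive exponent; here the type
  zero of the power series is spent.\<close>

lemma exp_X_square_bound:
  assumes "l > 0"
  obtains l' B where "l' > 0" "B \<ge> 0"
    "\<And>\<omega> t s x. \<omega> \<in> space M \<Longrightarrow> t \<in> {0..T} \<Longrightarrow> s \<in> {0..T} \<Longrightarrow>
       exp (l' * (X \<omega> t x s)\<^sup>2) \<le> B * exp (l * (x\<^sup>2 + (Z \<omega>)\<^sup>2))"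
proof -
  obtain K where K: "K \<ge> 1" "\<And>\<omega> t s x. \<omega> \<in> space M \<Longrightarrow> t \<in> {0..T} \<Longrightarrow> s \<in> {0..T} \<Longrightarrow>
     \<bar>X \<omega> t x s\<bar> \<le> K * (1 + \<bar>x\<bar> + Z \<omega>) \<and> (X \<omega> t x s)\<^sup>2 \<le> 3 * K\<^sup>2 * (1 + x\<^sup>2 + (Z \<omega>)\<^sup>2)"
    using X_square_bound by blast
  define l' where "l' = l / (3 * K\<^sup>2)"
  have l': "l' > 0" "l' * (3 * K\<^sup>2) = l" using assms K(1) by (auto simp: l'_def)
  show thesis
  proof (rule that[of l' "exp l"])
    fix \<omega> t s x assume h: "\<omega> \<in> space M" "t \<in> {0..T}" "s \<in> {0..T}"
    have "l' * (X \<omega> t x s)\<^sup>2 \<le> l' * (3 * K\<^sup>2 * (1 + x\<^sup>2 + (Z \<omega>)\<^sup>2))"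
      using K(2)[OF h] l' by (intro mult_left_mono) auto
    also have "\<dots> = (l' * (3 * K\<^sup>2)) * (1 + x\<^sup>2 + (Z \<omega>)\<^sup>2)" by (simp only: mult.assoc)
    also have "\<dots> = l + l * (x\<^sup>2 + (Z \<omega>)\<^sup>2)" unfolding l'(2) by (simp add: algebra_simps)
    finally show "exp (l' * (X \<omega> t x s)\<^sup>2) \<le> exp l * exp (l * (x\<^sup>2 + (Z \<omega>)\<^sup>2))"
      by (simp add: exp_add[symmetric])
  qed (use l' in auto)
qed

lemma V_path_bound:
  assumes "l > 0"
  obtains C where "C \<ge> 0" "\<And>\<omega> t s x. \<omega> \<in> space M \<Longrightarrow> t \<in> {0..T} \<Longrightarrow> s \<in> {0..T} \<Longrightarrow>
       norm (V j s (X \<omega> t x s)) \<le> C * exp (l * (x\<^sup>2 + (Z \<omega>)\<^sup>2))"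
proof -
  obtain l' B where l': "l' > 0" "B \<ge> 0" "\<And>\<omega> t s x. \<omega> \<in> space M \<Longrightarrow> t \<in> {0..T} \<Longrightarrow> s \<in> {0..T} \<Longrightarrow>
       exp (l' * (X \<omega> t x s)\<^sup>2) \<le> B * exp (l * (x\<^sup>2 + (Z \<omega>)\<^sup>2))"
    using exp_X_square_bound[OF assms] by blast
  obtain C where C: "C \<ge> 0" "\<And>s x. s \<in> {0..T} \<Longrightarrow> norm (V j s x) \<le> C * exp (l' * x\<^sup>2)"
    using V_bound[OF l'(1)] by blast
  show thesis
  proof (rule that[of "C * B"])
    fix \<omega> t s x assume h: "\<omega> \<in> space M" "t \<in> {0..T}" "s \<in> {0..T}"
    show "norm (V j s (X \<omega> t x s)) \<le> C * B * exp (l * (x\<^sup>2 + (Z \<omega>)\<^sup>2))"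
      using order_trans[OF C(2)[OF h(3)] mult_left_mono[OF l'(3)[OF h] C(1)]] by (simp add: mult.assoc)
  qed (use C l' in auto)
qed

lemma tame_H: "tame (\<lambda>(t, \<omega>) x. H j t x \<omega>)"
  unfolding tame_def prod.case
proof (intro conjI ballI allI impI)
  show "H j t x \<in> borel_measurable M" if "t \<in> {0..T}" for t x
    by (rule H_measurable[OF that])
  show "continuous_on ({0..T} \<times> UNIV) (\<lambda>(t, x). H j t x \<omega>)" if "\<omega> \<in> space M" for \<omega>
    by (rule H_continuous[OF that])
  fix l :: real assume l: "l > 0"
  obtain C where C: "C \<ge> 0" "\<And>\<omega> t s x. \<omega> \<in> space M \<Longrightarrow> t \<in> {0..T} \<Longrightarrow> s \<in> {0..T} \<Longrightarrow>
       norm (V j s (X \<omega> t x s)) \<le> C * exp (l * (x\<^sup>2 + (Z \<omega>)\<^sup>2))"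
    using V_path_bound[OF l] by blast
  obtain l' B where l': "l' > 0" "B \<ge> 0" "\<And>\<omega> t s x. \<omega> \<in> space M \<Longrightarrow> t \<in> {0..T} \<Longrightarrow> s \<in> {0..T} \<Longrightarrow>
       exp (l' * (X \<omega> t x s)\<^sup>2) \<le> B * exp (l * (x\<^sup>2 + (Z \<omega>)\<^sup>2))"
    using exp_X_square_bound[OF l] by blast
  obtain D where D: "D \<ge> 0" "\<And>x. norm (Q j x) \<le> D * exp (l' * x\<^sup>2)"
    using Q_bound[OF l'(1)] by blast
  define E where "E = exp (real j * \<bar>b\<bar> * T)"
  have E: "exp (real j * b * r) \<le> E" if "0 \<le> r" "r \<le> T" for r
  proof -
    have "real j * b * r \<le> real j * \<bar>b\<bar> * T"
      using that by (intro mult_mono mult_left_mono) auto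
    then show ?thesis by (simp add: E_def)
  qed
  have E0: "E \<ge> 0" by (simp add: E_def)
  have "norm (H j t x \<omega>) \<le> (T * (E * C) + E * (D * B)) * exp (l * (x\<^sup>2 + (Z \<omega>)\<^sup>2))"
    if t: "t \<in> {0..T}" and \<omega>: "\<omega> \<in> space M" for t x \<omega>
  proof -
    define G where "G = exp (l * (x\<^sup>2 + (Z \<omega>)\<^sup>2))"
    have G: "G \<ge> 0" by (simp add: G_def)
    have "norm (integral {t..T} (\<lambda>s. of_real (exp (real j * b * (s - t))) * V j s (X \<omega> t x s))) \<le> (E * (C * G)) * (T - t)"
    proof (rule integral_bound)
      show "continuous_on {t..T} (\<lambda>s. of_real (exp (real j * b * (s - t))) * V j s (X \<omega> t x s))"
        by (rule continuous_on_kernel[OF \<omega>]) (use t in \<open>auto intro!: continuous_intros\<close>)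
      fix s assume s: "s \<in> {t..T}"
      show "norm (of_real (exp (real j * b * (s - t))) * V j s (X \<omega> t x s)) \<le> E * (C * G)"
        unfolding norm_mult G_def using s t \<omega> E0
        by (intro mult_mono C(2)) (auto intro!: E)
    qed (use t in auto)
    also have "\<dots> \<le> (E * (C * G)) * T" using t E0 C(1) G by (intro mult_left_mono) auto
    finally have 1: "norm (integral {t..T} (\<lambda>s. of_real (exp (real j * b * (s - t))) * V j s (X \<omega> t x s))) \<le> (E * (C * G)) * T" .
    have "norm (Q j (X \<omega> t x T)) \<le> D * exp (l' * (X \<omega> t x T)\<^sup>2)" by (rule D)
    also have "\<dots> \<le> D * (B * G)" unfolding G_def using t \<omega> T by (intro mult_left_mono l' D) auto
    finally have 2: "norm (of_real (exp (real j * b * (T - t))) * Q j (X \<omega> t x T)) \<le> E * (D * (B * G))"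
      unfolding norm_mult using t E0 by (intro mult_mono) (auto intro!: E)
    have "norm (H j t x \<omega>) \<le> (E * (C * G)) * T + E * (D * (B * G))"
      unfolding H_def by (rule norm_triangle_mono[OF 1 2])
    then show ?thesis by (simp add: G_def algebra_simps)
  qed
  then show "\<exists>C. \<forall>t\<in>{0..T}. \<forall>x. \<forall>\<omega>\<in>space M. norm (H j t x \<omega>) \<le> C * exp (l * (x\<^sup>2 + (Z \<omega>)\<^sup>2))"
    by blast
qed

lemma V_0_Re: "s \<in> {0..T} \<Longrightarrow> Re (V 0 s x) \<le> 0"
  using Re_potential by (simp add: V_def)

lemma Re_integral_V_le:
  assumes "\<omega> \<in> space M" "t \<in> {0..T}" "r \<in> {t..T}"
  shows "Re (integral {t..r} (\<lambda>s. V 0 s (X \<omega> t x s))) \<le> 0"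
proof -
  have c: "continuous_on {t..r} (\<lambda>s. V 0 s (X \<omega> t x s))"
    by (intro continuous_on_V continuous_on_X assms continuous_intros) (use assms in auto)
  have i: "(\<lambda>s. V 0 s (X \<omega> t x s)) integrable_on {t..r}" by (rule integrable_continuous_real[OF c])
  have "Re (integral {t..r} (\<lambda>s. V 0 s (X \<omega> t x s))) = integral {t..r} (\<lambda>s. Re (V 0 s (X \<omega> t x s)))"
    using integral_linear[OF i bounded_linear_Re] by (simp add: o_def)
  also have "\<dots> \<le> integral {t..r} (\<lambda>s. 0)"
    by (intro integral_le integrable_continuous_real continuous_intros c) (use assms in \<open>auto intro!: V_0_Re\<close>)
  finally show ?thesis by simp
qed

lemma norm_exp_H_le:
  assumes "\<omega> \<in> space M" "t \<in> {0..T}"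
  shows "norm (exp (H 0 t x \<omega>)) \<le> 1"
proof -
  have "Re (H 0 t x \<omega>) \<le> 0"
    using Re_integral_V_le[OF assms, of T x] assms Re_v by (simp add: H_def Q_def)
  then show ?thesis by (simp add: norm_exp_eq_Re)
qed

lemma tame_exp_H: "tame (\<lambda>(t, \<omega>) x. exp (H 0 t x \<omega>))"
  unfolding tame_def prod.case
proof (intro conjI ballI allI impI)
  show "(\<lambda>\<omega>. exp (H 0 t x \<omega>)) \<in> borel_measurable M" if "t \<in> {0..T}" for t x
    using H_measurable[OF that, of 0 x] by measurable
  show "continuous_on ({0..T} \<times> UNIV) (\<lambda>(t, x). exp (H 0 t x \<omega>))" if "\<omega> \<in> space M" for \<omega>
    using H_continuous[OF that, of 0] unfolding case_prod_beta' by (rule continuous_on_exp)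
  fix l :: real assume l: "l > 0"
  have "norm (exp (H 0 t x \<omega>)) \<le> 1 * exp (l * (x\<^sup>2 + (Z \<omega>)\<^sup>2))" if "t \<in> {0..T}" "\<omega> \<in> space M" for t x \<omega>
    using norm_exp_H_le[OF that(2,1), of x] l by (rule_tac order_trans[of _ 1]) auto
  then show "\<exists>C. \<forall>t\<in>{0..T}. \<forall>x. \<forall>\<omega>\<in>space M. norm (exp (H 0 t x \<omega>)) \<le> C * exp (l * (x\<^sup>2 + (Z \<omega>)\<^sup>2))"
    by blast
qed

section \<open>The derivatives of \<open>f\<close> as expectations\<close>

definition gens :: "(real \<times> 'w \<Rightarrow> real \<Rightarrow> complex) set" where
  "gens = insert (\<lambda>(t, \<omega>) x. exp (H 0 t x \<omega>)) (range (\<lambda>j (t, \<omega>) x. H j t x \<omega>))"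

lemma tame_fun_alg: "g \<in> fun_alg gens \<Longrightarrow> tame g"
  by (induction rule: fun_alg.induct) (auto simp: gens_def intro: tame_add tame_mult tame_H tame_exp_H)

text \<open>\<open>H j\<close> goes to \<open>H (Suc j)\<close>, and \<open>exp (H 0)\<close> to
  \<open>H 1\<close> times itself.\<close>

lemma gens_derivative:
  assumes "g \<in> gens"
  shows "\<exists>g'\<in>fun_alg gens. \<forall>i\<in>{0..T} \<times> space M. \<forall>x. (g i has_vector_derivative g' i x) (at x)"
proof -
  have H: "(\<lambda>(t, \<omega>) x. H j t x \<omega>) \<in> fun_alg gens" for j
    by (rule fun_alg.gen) (auto simp: gens_def)
  consider "g = (\<lambda>(t, \<omega>) x. exp (H 0 t x \<omega>))" | j where "g = (\<lambda>(t, \<omega>) x. H j t x \<omega>)"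
    using assms by (auto simp: gens_def)
  then show ?thesis
  proof cases
    case 1
    show ?thesis
    proof (rule bexI)
      show "(\<lambda>i x. (case i of (t, \<omega>) \<Rightarrow> \<lambda>x. H 1 t x \<omega>) x * g i x) \<in> fun_alg gens"
        by (rule fun_alg.mult[OF H]) (use assms in \<open>auto intro: fun_alg.gen\<close>)
      show "\<forall>i\<in>{0..T} \<times> space M. \<forall>x. (g i has_vector_derivative (case i of (t, \<omega>) \<Rightarrow> \<lambda>x. H 1 t x \<omega>) x * g i x) (at x)"
      proof (intro ballI allI)
        fix i x assume "i \<in> {0..T} \<times> space M"
        then obtain t \<omega> where i: "i = (t, \<omega>)" "t \<in> {0..T}" "\<omega> \<in> space M" by blast
        then have "((exp \<circ> (\<lambda>x. H 0 t x \<omega>)) has_vector_derivative H 1 t x \<omega> * exp (H 0 t x \<omega>)) (at x)"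
          using H_has_vector_derivative[of \<omega> t 0 x] by (intro field_vector_diff_chain_at) (auto intro: DERIV_exp)
        then show "(g i has_vector_derivative (case i of (t, \<omega>) \<Rightarrow> \<lambda>x. H 1 t x \<omega>) x * g i x) (at x)"
          by (simp add: 1 i(1) o_def)
      qed
    qed
  next
    case 2
    show ?thesis
      by (rule bexI[OF _ H[of "Suc j"]]) (auto simp: 2 intro: H_has_vector_derivative)
  qed
qed

lemma f_derivatives:
  obtains D where "\<And>k. D k \<in> fun_alg gens" "\<And>k t x. t \<in> {0..T} \<Longrightarrow> nderiv k (f t) x = (\<integral>\<omega>. D k (t, \<omega>) x \<partial>M)"
    "\<And>k t x. t \<in> {0..T} \<Longrightarrow> (nderiv k (f t) has_vector_derivative nderiv (Suc k) (f t) x) (at x)"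
proof -
  have g: "(\<lambda>(t, \<omega>) x. exp (H 0 t x \<omega>)) \<in> fun_alg gens"
    by (rule fun_alg.gen) (simp add: gens_def)
  obtain D where D: "D 0 = (\<lambda>(t, \<omega>) x. exp (H 0 t x \<omega>))" "\<And>k. D k \<in> fun_alg gens"
    "\<And>k i x. i \<in> {0..T} \<times> space M \<Longrightarrow> (D k i has_vector_derivative D (Suc k) i x) (at x)"
    "\<And>k i. i \<in> {0..T} \<times> space M \<Longrightarrow> nderiv k ((\<lambda>(t, \<omega>) x. exp (H 0 t x \<omega>)) i) = D k i"
    by (rule fun_alg_derivatives[OF gens_derivative g]) (assumption, blast)
  define F where "F t k x = (\<integral>\<omega>. D k (t, \<omega>) x \<partial>M)" for t k x
  have F: "(F t k has_vector_derivative F t (Suc k) x) (at x)" if "t \<in> {0..T}" for t k x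
    unfolding F_def
    by (rule tame_expectation_derivative[OF tame_fun_alg[OF D(2)] tame_fun_alg[OF D(2)] that]) (use D(3) that in auto)
  have "f t = F t 0" for t by (auto simp: f_def F_def D(1))
  then have N: "nderiv k (f t) = F t k" if "t \<in> {0..T}" for t k
    using nderiv_eqI[of "F t", OF F[OF that]] by simp
  show thesis
    by (rule that[of D]) (use D(2) N F in \<open>auto simp: F_def\<close>)
qed

lemma f_has_vector_derivative:
  "t \<in> {0..T} \<Longrightarrow> (nderiv k (f t) has_vector_derivative nderiv (Suc k) (f t) x) (at x)"
  using f_derivatives by metis

lemma f_continuous: "continuous_on ({0..T} \<times> UNIV) (\<lambda>(t, x). nderiv k (f t) x)"
proof -
  obtain D where D: "\<And>k. D k \<in> fun_alg gens" "\<And>k t x. t \<in> {0..T} \<Longrightarrow> nderiv k (f t) x = (\<integral>\<omega>. D k (t, \<omega>) x \<partial>M)"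
    using f_derivatives by metis
  have "continuous_on ({0..T} \<times> UNIV) (\<lambda>(t, x). \<integral>\<omega>. D k (t, \<omega>) x \<partial>M)"
    by (rule tame_expectation_continuous[OF tame_fun_alg[OF D(1)]])
  then show ?thesis by (rule continuous_on_cong[THEN iffD1, rotated 2]) (use D(2) in auto)
qed

text \<open>For \<open>k = 3\<close> this controls the Taylor remainder along a random segment,
  where continuity of the derivative alone would give no integrable bound.\<close>

lemma f_bound:
  assumes "l > 0"
  obtains C where "C \<ge> 0" "\<And>t x. t \<in> {0..T} \<Longrightarrow> norm (nderiv k (f t) x) \<le> C * exp (l * x\<^sup>2)"
proof -
  obtain D where D: "\<And>k. D k \<in> fun_alg gens" "\<And>k t x. t \<in> {0..T} \<Longrightarrow> nderiv k (f t) x = (\<integral>\<omega>. D k (t, \<omega>) x \<partial>M)"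
    using f_derivatives by metis
  show thesis
    using tame_expectation_bound[OF tame_fun_alg[OF D(1)] assms] D(2) that by metis
qed

lemma norm_f_le: "t \<in> {0..T} \<Longrightarrow> norm (f t x) \<le> 1"
proof -
  assume t: "t \<in> {0..T}"
  have "norm (f t x) \<le> (\<integral>\<omega>. norm (exp (H 0 t x \<omega>)) \<partial>M)" unfolding f_def by (rule integral_norm_bound)
  also have "\<dots> \<le> (\<integral>\<omega>. 1 \<partial>M)"
    using tame_integrable[OF tame_exp_H t, of x] norm_exp_H_le[OF _ t, of _ x]
    by (intro integral_mono integrable_norm) auto
  finally show "norm (f t x) \<le> 1" by (simp add: prob_space)
qed

end

section \<open>The backward equation\<close>

text \<open>Three mean value estimates in a row, for the second, first and zeroth derivative. This
  gives \<open>B\<close> where sharp integration would give \<open>B / 6\<close>.\<close>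

lemma vector_taylor2_bound:
  fixes D :: "nat \<Rightarrow> real \<Rightarrow> 'a::real_normed_vector"
  assumes D: "\<And>k y. (D k has_vector_derivative D (Suc k) y) (at y)"
    and M: "\<And>y. y \<in> closed_segment x z \<Longrightarrow> norm (D 3 y) \<le> B"
  shows "norm (D 0 z - D 0 x - (z - x) *\<^sub>R D 1 x - ((z - x)\<^sup>2 / 2) *\<^sub>R D 2 x) \<le> B * \<bar>z - x\<bar> ^ 3"
proof -
  have seg: "closed_segment x y \<subseteq> closed_segment x z" if "y \<in> closed_segment x z" for y
    using that by (simp add: closed_segment_subset)
  have le: "\<bar>y - x\<bar> \<le> \<bar>z - x\<bar>" if "y \<in> closed_segment x z" for y
    using that by (auto simp: closed_segment_eq_real_ivl split: if_splits)
  have B0: "B \<ge> 0" using order_trans[OF norm_ge_zero M[of x]] by simp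
  have d2: "(D 2 has_vector_derivative D 3 y) (at y)" and d1: "(D 1 has_vector_derivative D 2 y) (at y)"
    and d0: "(D 0 has_vector_derivative D 1 y) (at y)" for y
    using D[of 2 y] D[of 1 y] D[of 0 y] by (simp_all add: numeral_eq_Suc)
  have 2: "norm (D 2 y - D 2 x) \<le> B * \<bar>z - x\<bar>" if y: "y \<in> closed_segment x z" for y
  proof -
    have "norm (D 2 y - D 2 x) \<le> B * \<bar>y - x\<bar>"
      by (rule vector_mvt_bound[OF d2]) (use seg[OF y] M in auto)
    also have "\<dots> \<le> B * \<bar>z - x\<bar>" using le[OF y] B0 by (intro mult_left_mono)
    finally show ?thesis .
  qed
  have 1: "norm (D 1 y - D 1 x - (y - x) *\<^sub>R D 2 x) \<le> B * \<bar>z - x\<bar> * \<bar>z - x\<bar>" if y: "y \<in> closed_segment x z" for y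
  proof -
    have "norm ((\<lambda>y. D 1 y - (y - x) *\<^sub>R D 2 x) y - (\<lambda>y. D 1 y - (y - x) *\<^sub>R D 2 x) x) \<le> B * \<bar>z - x\<bar> * \<bar>y - x\<bar>"
    proof (rule vector_mvt_bound[where f' = "\<lambda>y. D 2 y - D 2 x"])
      show "((\<lambda>y. D 1 y - (y - x) *\<^sub>R D 2 x) has_vector_derivative D 2 y - D 2 x) (at y)" for y
        using d1[of y] by (auto intro!: derivative_eq_intros)
      show "norm (D 2 w - D 2 x) \<le> B * \<bar>z - x\<bar>" if "w \<in> closed_segment x y" for w
        using 2 seg[OF y] that by auto
    qed
    also have "\<dots> \<le> B * \<bar>z - x\<bar> * \<bar>z - x\<bar>" using le[OF y] B0 by (intro mult_left_mono) auto
    finally show ?thesis by (simp add: algebra_simps)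
  qed
  have "norm ((\<lambda>y. D 0 y - (y - x) *\<^sub>R D 1 x - ((y - x)\<^sup>2 / 2) *\<^sub>R D 2 x) z
      - (\<lambda>y. D 0 y - (y - x) *\<^sub>R D 1 x - ((y - x)\<^sup>2 / 2) *\<^sub>R D 2 x) x) \<le> B * \<bar>z - x\<bar> * \<bar>z - x\<bar> * \<bar>z - x\<bar>"
  proof (rule vector_mvt_bound[where f' = "\<lambda>y. D 1 y - D 1 x - (y - x) *\<^sub>R D 2 x"])
    show "((\<lambda>y. D 0 y - (y - x) *\<^sub>R D 1 x - ((y - x)\<^sup>2 / 2) *\<^sub>R D 2 x) has_vector_derivative
        D 1 y - D 1 x - (y - x) *\<^sub>R D 2 x) (at y)" for y
    proof -
      have "((\<lambda>y. (y - x)\<^sup>2 / 2) has_real_derivative (y - x)) (at y)"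
        by (auto intro!: derivative_eq_intros)
      then have "((\<lambda>y. ((y - x)\<^sup>2 / 2) *\<^sub>R D 2 x) has_vector_derivative (y - x) *\<^sub>R D 2 x) (at y)"
        by (auto intro!: derivative_eq_intros)
      moreover have "((\<lambda>y. (y - x) *\<^sub>R D 1 x) has_vector_derivative D 1 x) (at y)"
        by (auto intro!: derivative_eq_intros)
      ultimately show ?thesis by (intro has_vector_derivative_diff d0)
    qed
  qed (rule 1)
  then show ?thesis by (simp add: power3_eq_cube mult.assoc algebra_simps)
qed

text \<open>The first argument of the kernel is the moving left end point, as in a path started at
  \<open>t1 n\<close>; continuity at \<open>(t, t)\<close> handles it together with the variable of
  integration.\<close>

lemma integral_average_tendsto:
  fixes k :: "real \<Rightarrow> real \<Rightarrow> 'a::euclidean_space"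
  assumes k: "continuous_on ({0..T} \<times> {0..T}) (\<lambda>(\<tau>, s). k \<tau> s)"
    and t: "t \<in> {0..T}" "\<And>n. t1 n \<in> {0..T}" "\<And>n. t2 n \<in> {0..T}" "\<And>n. t1 n < t2 n" "t1 \<longlonglongrightarrow> t" "t2 \<longlonglongrightarrow> t"
  shows "(\<lambda>n. integral {t1 n..t2 n} (k (t1 n)) /\<^sub>R (t2 n - t1 n)) \<longlonglongrightarrow> k t t"
proof (rule LIMSEQ_I)
  fix e :: real assume e: "e > 0"
  obtain d where d: "d > 0" "\<And>p. p \<in> {0..T} \<times> {0..T} \<Longrightarrow> dist p (t, t) < d \<Longrightarrow>
      dist (case p of (\<tau>, s) \<Rightarrow> k \<tau> s) (k t t) < e / 2"
    using k[unfolded continuous_on_iff, rule_format, of "(t, t)" "e / 2"] t(1) e by auto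
  have "\<forall>\<^sub>F n in sequentially. dist (t1 n) t < d / 2" "\<forall>\<^sub>F n in sequentially. dist (t2 n) t < d / 2"
    using tendstoD[OF t(5), of "d / 2"] tendstoD[OF t(6), of "d / 2"] d(1) by simp_all
  then have "\<forall>\<^sub>F n in sequentially. norm (integral {t1 n..t2 n} (k (t1 n)) /\<^sub>R (t2 n - t1 n) - k t t) < e"
  proof eventually_elim
    case (elim n)
    define h where "h = t2 n - t1 n"
    have h: "h > 0" using t(4)[of n] by (simp add: h_def)
    have kc: "continuous_on {t1 n..t2 n} (k (t1 n))"
    proof -
      have pc: "continuous_on {t1 n..t2 n} (\<lambda>s. (t1 n, s))" by (intro continuous_intros)
      have "(\<lambda>s. (t1 n, s)) ` {t1 n..t2 n} \<subseteq> {0..T} \<times> {0..T}" using t(2,3)[of n] by auto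
      from continuous_on_compose2[OF k pc this] show ?thesis by simp
    qed
    have "norm (integral {t1 n..t2 n} (\<lambda>s. k (t1 n) s - k t t)) \<le> (e / 2) * (t2 n - t1 n)"
    proof (rule integral_bound)
      show "continuous_on {t1 n..t2 n} (\<lambda>s. k (t1 n) s - k t t)" by (intro continuous_intros kc)
      fix s assume s: "s \<in> {t1 n..t2 n}"
      have "dist s t < d / 2" using elim s unfolding dist_real_def atLeastAtMost_iff by linarith
      then have "dist (t1 n, s) (t, t) < d"
        using elim(1) dist_Pair_Pair[of "t1 n" s t t] sqrt_sum_squares_le_sum_abs[of "dist (t1 n) t" "dist s t"] by auto
      then show "norm (k (t1 n) s - k t t) \<le> e / 2"
        using d(2)[of "(t1 n, s)"] s t(2,3)[of n] by (auto simp: dist_norm)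
    qed (use t(4)[of n] in auto)
    moreover have "integral {t1 n..t2 n} (\<lambda>s. k (t1 n) s - k t t) = integral {t1 n..t2 n} (k (t1 n)) - h *\<^sub>R k t t"
      using h integrable_continuous_real[OF kc]
      by (subst Henstock_Kurzweil_Integration.integral_diff) (auto simp: h_def)
    ultimately have le: "norm (integral {t1 n..t2 n} (k (t1 n)) - h *\<^sub>R k t t) \<le> (e / 2) * h" by (simp add: h_def)
    have "integral {t1 n..t2 n} (k (t1 n)) /\<^sub>R h - k t t = (integral {t1 n..t2 n} (k (t1 n)) - h *\<^sub>R k t t) /\<^sub>R h"
      using h by (simp add: scaleR_diff_right)
    then have "norm (integral {t1 n..t2 n} (k (t1 n)) /\<^sub>R h - k t t) = norm (integral {t1 n..t2 n} (k (t1 n)) - h *\<^sub>R k t t) / h"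
      using h by (simp add: divide_inverse_commute)
    also have "\<dots> \<le> e / 2" using le h by (simp add: divide_le_eq)
    finally show ?case using e by (simp add: h_def)
  qed
  then show "\<exists>N. \<forall>n\<ge>N. norm (integral {t1 n..t2 n} (k (t1 n)) /\<^sub>R (t2 n - t1 n) - k t t) < e"
    by (simp add: eventually_sequentially)
qed

text \<open>The segment from 0 to \<open>z\<close> stays in the left half-plane, where the
  derivative of \<open>exp\<close> has norm at most 1.\<close>

lemma norm_exp_minus_1_le:
  fixes z :: complex
  assumes "Re z \<le> 0"
  shows "norm (exp z - 1) \<le> norm z"
proof -
  have "norm ((\<lambda>r. exp (of_real r * z)) 1 - (\<lambda>r. exp (of_real r * z)) 0) \<le> norm z * \<bar>1 - 0\<bar>"
  proof (rule vector_mvt_bound[where f' = "\<lambda>r. z * exp (of_real r * z)"])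
    fix r :: real assume r: "r \<in> closed_segment 0 1"
    have "((\<lambda>r. of_real r * z) has_vector_derivative z) (at r)"
      unfolding scaleR_conv_of_real[symmetric] by (auto intro!: derivative_eq_intros)
    from field_vector_diff_chain_at[OF this DERIV_exp]
    show "((\<lambda>r. exp (of_real r * z)) has_vector_derivative z * exp (of_real r * z)) (at r)" by (simp add: o_def)
    have "norm (exp (of_real r * z)) \<le> 1"
      using r assms by (simp add: norm_exp_eq_Re closed_segment_eq_real_ivl mult_nonneg_nonpos)
    then show "norm (z * exp (of_real r * z)) \<le> norm z"
      using mult_left_mono[of "norm (exp (of_real r * z))" 1 "norm z"] by (simp add: norm_mult)
  qed
  then show ?thesis by simp
qed

lemma exp_minus_1_quotient_tendsto:
  fixes z :: "nat \<Rightarrow> complex" and h :: "nat \<Rightarrow> real"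
  assumes "z \<longlonglongrightarrow> 0" "(\<lambda>n. z n /\<^sub>R h n) \<longlonglongrightarrow> w"
  shows "(\<lambda>n. (exp (z n) - 1) /\<^sub>R h n) \<longlonglongrightarrow> w"
proof -
  \<comment> \<open>The removable singularity is filled in, so that \<open>z n = 0\<close> needs no
    separate treatment.\<close>
  define \<psi> where "\<psi> z = (if z = 0 then 1 else (exp z - 1) / z)" for z :: complex
  have "((\<lambda>z. (exp (0 + z) - exp 0) / z) \<longlongrightarrow> exp 0) (at (0::complex))"
    using DERIV_exp[of "0::complex"] unfolding DERIV_def .
  then have "((\<lambda>z. (exp z - 1) / z) \<longlongrightarrow> 1) (at (0::complex))" by simp
  then have "(\<psi> \<longlongrightarrow> 1) (at 0)"
    by (rule Lim_cong_within[THEN iffD1, rotated 4]) (auto simp: \<psi>_def)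
  then have "isCont \<psi> 0" by (simp add: isCont_def \<psi>_def)
  from isCont_tendsto_compose[OF this assms(1)] have "(\<lambda>n. \<psi> (z n)) \<longlonglongrightarrow> 1" by (simp add: \<psi>_def)
  from tendsto_mult[OF assms(2) this] have "(\<lambda>n. z n /\<^sub>R h n * \<psi> (z n)) \<longlonglongrightarrow> w" by simp
  moreover have "(\<lambda>n. z n /\<^sub>R h n * \<psi> (z n)) = (\<lambda>n. (exp (z n) - 1) /\<^sub>R h n)" by (auto simp: \<psi>_def)
  ultimately show ?thesis by (simp only:)
qed

section \<open>Markov property and short-time expansion of \<open>f\<close>\<close>

context fk
begin

text \<open>The flow identity splits the exponent at \<open>t2\<close>. The first factor and the
  position at \<open>t2\<close> depend on the past, the restarted functional only on later
  increments, so \<open>expectation_freeze\<close> replaces the latter by \<open>f t2\<close> at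
  that position.\<close>

lemma f_markov:
  assumes t: "0 \<le> t1" "t1 < t2" "t2 \<le> T"
  shows "f t1 x = (\<integral>\<omega>. exp (integral {t1..t2} (\<lambda>s. V 0 s (X \<omega> t1 x s))) * f t2 (X \<omega> t1 x t2) \<partial>M)"
proof -
  define \<Phi> where "\<Phi> \<omega> = exp (integral {t1..t2} (\<lambda>s. V 0 s (X \<omega> t1 x s)))" for \<omega>
  define F where "F y \<omega> = exp (H 0 t2 y \<omega>)" for y \<omega>
  have split: "exp (H 0 t1 x \<omega>) = \<Phi> \<omega> * F (X \<omega> t1 x t2) \<omega>" if \<omega>: "\<omega> \<in> space M" for \<omega>
  proof -
    have flow: "X \<omega> t2 (X \<omega> t1 x t2) s = X \<omega> t1 x s" for s by (simp add: X_def ou_sol_flow)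
    have "(\<lambda>s. V 0 s (X \<omega> t1 x s)) integrable_on {t1..T}"
      by (intro integrable_continuous_real continuous_on_V continuous_on_X \<omega> continuous_intros) (use t in auto)
    from Henstock_Kurzweil_Integration.integral_combine[OF _ _ this, of t2] t
    have "integral {t1..T} (\<lambda>s. V 0 s (X \<omega> t1 x s)) =
        integral {t1..t2} (\<lambda>s. V 0 s (X \<omega> t1 x s)) + integral {t2..T} (\<lambda>s. V 0 s (X \<omega> t1 x s))" by simp
    then show ?thesis by (simp add: H_def \<Phi>_def F_def flow exp_add[symmetric] add.assoc)
  qed
  \<comment> \<open>The extra 1 keeps the length of the future interval positive when
    \<open>t2 = T\<close>.\<close>
  let ?P = "path_alg 0 t2" and ?Q = "path_alg t2 (T + 1 - t2)"
  have XP: "(\<lambda>\<omega>. X \<omega> t1 x s) \<in> borel_measurable ?P" if "s \<in> {t1..t2}" for s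
    unfolding X_def by (rule borel_measurable_ou_sol) (use t that in \<open>auto intro!: W_continuous path_alg_measurable_0\<close>)
  have \<Phi>: "\<Phi> \<in> borel_measurable ?P"
    unfolding \<Phi>_def using integral_V_measurable[of ?P t1 t2 x 0] XP t by simp
  have XQ: "(\<lambda>\<omega>. X \<omega> t2 y s) \<in> borel_measurable ?Q" if s: "s \<in> {t2..T}" for s y
  proof -
    \<comment> \<open>Written with increments after \<open>t2\<close>, the restarted path is visibly
      measurable for the future.\<close>
    have "(\<lambda>\<omega>. ou_sol a b c (\<lambda>r. W (max r t2) \<omega> - W t2 \<omega>) t2 y s) \<in> borel_measurable ?Q"
    proof (rule borel_measurable_ou_sol)
      show "continuous_on {0..} (\<lambda>r. W (max r t2) \<omega> - W t2 \<omega>)" if "\<omega> \<in> space ?Q" for \<omega>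
        by (intro continuous_intros continuous_on_compose2[OF W_continuous])
           (use that t in \<open>auto intro!: continuous_intros\<close>)
      show "(\<lambda>\<omega>. W (max r t2) \<omega> - W t2 \<omega>) \<in> borel_measurable ?Q" if "0 \<le> r" "r \<le> s" for r
        by (rule path_alg_measurable) (use that s t in auto)
    qed (use s t in auto)
    also have "?this \<longleftrightarrow> ?thesis"
      unfolding X_def by (rule measurable_cong, rule ou_sol_eq_future) (use s t in \<open>auto intro: W_continuous\<close>)
    finally show ?thesis .
  qed
  have "F y \<in> borel_measurable ?Q" for y
    unfolding F_def using H_measurable_if[of ?Q t2 y 0] XQ t by simp
  moreover have "continuous_on UNIV (\<lambda>y. F y \<omega>)" if "\<omega> \<in> space ?Q" for \<omega>
  proof -
    have pc: "continuous_on UNIV (\<lambda>y::real. (t2, y))" by (intro continuous_intros)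
    have "continuous_on UNIV (\<lambda>y. H 0 t2 y \<omega>)"
    proof -
      have "(\<lambda>y::real. (t2, y)) ` UNIV \<subseteq> {0..T} \<times> UNIV" using t by auto
      from continuous_on_compose2[OF H_continuous[of \<omega> 0] pc this] that show ?thesis by simp
    qed
    then show ?thesis unfolding F_def by (rule continuous_on_exp)
  qed
  ultimately have Fm: "(\<lambda>(y, \<omega>). F y \<omega>) \<in> borel_measurable (borel \<Otimes>\<^sub>M ?Q)"
    by (rule borel_measurable_pair_continuous)
  have "f t1 x = (\<integral>\<omega>. \<Phi> \<omega> * F (X \<omega> t1 x t2) \<omega> \<partial>M)"
    unfolding f_def by (intro Bochner_Integration.integral_cong refl split)
  also have "\<dots> = (\<integral>\<omega>. \<Phi> \<omega> * (\<integral>\<omega>'. F (X \<omega> t1 x t2) \<omega>' \<partial>M) \<partial>M)"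
  proof (rule expectation_freeze[OF indep_path_algs[of t2 "T + 1 - t2"] _ _ \<Phi> XP Fm])
    show "norm (\<Phi> \<omega>) \<le> 1" if "\<omega> \<in> space M" for \<omega>
      using Re_integral_V_le[OF that, of t1 t2 x] t by (simp add: \<Phi>_def norm_exp_eq_Re)
    show "norm (F y \<omega>) \<le> 1" if "\<omega> \<in> space M" for y \<omega>
      unfolding F_def using norm_exp_H_le[OF that, of t2 y] t by simp
  qed (use t in auto)
  finally show ?thesis by (simp add: \<Phi>_def F_def f_def)
qed

text \<open>The sixth moment is for the cubic Taylor remainder: \<open>B^3\<close> has to be
  separated from a factor depending on \<open>Z\<close>, which is not independent of it, by an
  inequality that squares it.\<close>

lemma increment_moments:
  assumes "0 \<le> s" "s < t"
  shows "integrable M (\<lambda>\<omega>. (W t \<omega> - W s \<omega>) ^ k)"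
    "(\<integral>\<omega>. W t \<omega> - W s \<omega> \<partial>M) = 0" "(\<integral>\<omega>. (W t \<omega> - W s \<omega>)\<^sup>2 \<partial>M) = t - s"
    "(\<integral>\<omega>. (W t \<omega> - W s \<omega>) ^ 6 \<partial>M) = 15 * (t - s) ^ 3"
proof -
  define \<sigma> where "\<sigma> = sqrt (t - s)"
  have \<sigma>: "\<sigma> > 0" "\<sigma>\<^sup>2 = t - s" using assms by (auto simp: \<sigma>_def)
  have D: "distributed M lborel (\<lambda>\<omega>. W t \<omega> - W s \<omega>) (\<lambda>y. ennreal (normal_density 0 \<sigma> y))"
    using W_increment_distributed[OF assms] by (simp add: \<sigma>_def)
  show "integrable M (\<lambda>\<omega>. (W t \<omega> - W s \<omega>) ^ k)"
    using distributed_integrable[OF D, of "\<lambda>x. x ^ k"] integrable_normal_moment[OF \<sigma>(1), of 0 k] by simp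
  show "(\<integral>\<omega>. W t \<omega> - W s \<omega> \<partial>M) = 0"
    using distributed_integral[OF D, of "\<lambda>x. x"] integral_normal_moment_nz_1[OF \<sigma>(1), of 0] by simp
  show "(\<integral>\<omega>. (W t \<omega> - W s \<omega>)\<^sup>2 \<partial>M) = t - s"
    using distributed_integral[OF D, of "\<lambda>x. x\<^sup>2"] integral_normal_moment_even[OF \<sigma>(1), of 0 1] \<sigma>
    by (simp add: fact_numeral)
  have "(\<integral>\<omega>. (W t \<omega> - W s \<omega>) ^ 6 \<partial>M) = fact 6 / ((2 / \<sigma>\<^sup>2) ^ 3 * fact 3)"
    using distributed_integral[OF D, of "\<lambda>x. x ^ 6"] integral_normal_moment_even[OF \<sigma>(1), of 0 3] by simp
  also have "\<dots> = 15 * (\<sigma>\<^sup>2) ^ 3" using \<sigma>(1) by (simp add: fact_numeral power_divide)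
  finally show "(\<integral>\<omega>. (W t \<omega> - W s \<omega>) ^ 6 \<partial>M) = 15 * (t - s) ^ 3" using \<sigma> by simp
qed

text \<open>With both end points moving, the limit later yields derivatives from either side and at
  the ends of \<open>[0, T]\<close>. Everything is expanded at time \<open>t2 n\<close>, where
  \<open>f\<close> is smooth in space; joint continuity of the space derivatives moves them to
  \<open>t\<close>.\<close>

lemma f_generator_limit:
  assumes t: "t \<in> {0..T}" "\<And>n. t1 n \<in> {0..T}" "\<And>n. t2 n \<in> {0..T}" "\<And>n. t1 n < t2 n" "t1 \<longlonglongrightarrow> t" "t2 \<longlonglongrightarrow> t"
  shows "(\<lambda>n. (f (t1 n) x - f (t2 n) x) /\<^sub>R (t2 n - t1 n)) \<longlonglongrightarrow>
    V 0 t x * f t x + (a + b * x) *\<^sub>R nderiv 1 (f t) x + (c\<^sup>2 / 2) *\<^sub>R nderiv 2 (f t) x"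
proof -
  define h where "h n = t2 n - t1 n" for n
  define B where "B n \<omega> = W (t2 n) \<omega> - W (t1 n) \<omega>" for n \<omega>
  define Y where "Y n \<omega> = X \<omega> (t1 n) x (t2 n)" for n \<omega>
  define R where "R n \<omega> = integral {t1 n..t2 n} (\<lambda>r. a + b * X \<omega> (t1 n) x r)" for n \<omega>
  define I where "I n \<omega> = integral {t1 n..t2 n} (\<lambda>s. V 0 s (X \<omega> (t1 n) x s))" for n \<omega>
  \<comment> \<open>Powers of \<open>E\<close> up to the fourth occur below, and
    \<open>E ^ 4\<close> is exactly \<open>exp (e0 * Z^2)\<close>.\<close>
  define e1 where "e1 = e0 / 4"
  define E where "E \<omega> = exp (e1 * (Z \<omega>)\<^sup>2)" for \<omega>
  have h: "h n > 0" "h n \<le> T" for n using t(2-4)[of n] by (auto simp: h_def)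
  have h0: "h \<longlonglongrightarrow> 0" using tendsto_diff[OF t(6,5)] by (simp add: h_def[abs_def])
  have e1: "e1 > 0" using e0 by (simp add: e1_def)
  have t1': "0 \<le> t1 n" "t2 n \<le> T" "t1 n \<le> T" "0 \<le> t2 n" for n using t(2,3)[of n] by auto
  have E1: "E \<omega> \<ge> 1" for \<omega> using e1 by (simp add: E_def)
  have Epow: "integrable M (\<lambda>\<omega>. E \<omega> ^ k)" if "k \<le> 4" for k
  proof -
    have "real k * e1 \<le> 4 * e1" using that e1 by (intro mult_right_mono) auto
    then have "integrable M (\<lambda>\<omega>. exp (real k * e1 * (Z \<omega>)\<^sup>2))" by (intro exp_Z_integrable) (simp add: e1_def)
    then show ?thesis by (simp add: E_def exp_of_nat_mult[symmetric] mult.assoc)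
  qed
  have Eint: "integrable M E" using Epow[of 1] by simp
  have Zle: "1 + \<bar>z\<bar> \<le> (2 + 1 / e1) * exp (e1 * z\<^sup>2)" for z :: real
  proof -
    have "\<bar>z\<bar> \<le> 1 + z\<^sup>2" using zero_le_power2[of "\<bar>z\<bar> - 1/2"] by (simp add: power2_eq_square algebra_simps)
    moreover have "e1 * z\<^sup>2 \<le> exp (e1 * z\<^sup>2)" using exp_ge_add_one_self[of "e1 * z\<^sup>2"] by linarith
    then have "z\<^sup>2 \<le> 1 / e1 * exp (e1 * z\<^sup>2)" using e1 by (simp add: field_simps)
    moreover have "2 \<le> 2 * exp (e1 * z\<^sup>2)" using e1 by simp
    ultimately have "1 + \<bar>z\<bar> \<le> 2 * exp (e1 * z\<^sup>2) + 1 / e1 * exp (e1 * z\<^sup>2)" by linarith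
    then show ?thesis by (simp only: distrib_right)
  qed
  obtain K where K: "K \<ge> 1" "\<And>\<omega> t s x. \<omega> \<in> space M \<Longrightarrow> t \<in> {0..T} \<Longrightarrow> s \<in> {0..T} \<Longrightarrow>
     \<bar>X \<omega> t x s\<bar> \<le> K * (1 + \<bar>x\<bar> + Z \<omega>) \<and> (X \<omega> t x s)\<^sup>2 \<le> 3 * K\<^sup>2 * (1 + x\<^sup>2 + (Z \<omega>)\<^sup>2)"
    using X_square_bound by blast
  \<comment> \<open>One constant for two bounds: the terms with \<open>a\<close> and
    \<open>b\<close> serve the drift, the 2 serves the increment \<open>B\<close>, and the last
    factor turns \<open>1 + Z\<close> into a multiple of \<open>E\<close>.\<close>
  define G where "G = (\<bar>a\<bar> + \<bar>b\<bar> * K * (1 + \<bar>x\<bar>) + 2) * (2 + 1 / e1)"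
  have G0: "G \<ge> 0" using K(1) e1 by (simp add: G_def)
  have ZE: "1 + Z \<omega> \<le> (2 + 1 / e1) * E \<omega>" if "\<omega> \<in> space M" for \<omega>
    using Zle[of "Z \<omega>"] Z_nonneg[OF that] by (simp add: E_def)
  have Bb: "\<bar>B n \<omega>\<bar> \<le> G * E \<omega>" if \<omega>: "\<omega> \<in> space M" for n \<omega>
  proof -
    have "\<bar>B n \<omega>\<bar> \<le> 2 * (1 + Z \<omega>)"
      using W_le_Z[OF \<omega> t(2)[of n]] W_le_Z[OF \<omega> t(3)[of n]] by (simp add: B_def)
    also have "\<dots> \<le> (\<bar>a\<bar> + \<bar>b\<bar> * K * (1 + \<bar>x\<bar>) + 2) * (1 + Z \<omega>)"
      using Z_nonneg[OF \<omega>] K(1) by (intro mult_right_mono) auto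
    also have "\<dots> \<le> (\<bar>a\<bar> + \<bar>b\<bar> * K * (1 + \<bar>x\<bar>) + 2) * ((2 + 1 / e1) * E \<omega>)"
      using K(1) by (intro mult_left_mono ZE[OF \<omega>]) auto
    finally show ?thesis by (simp add: G_def mult.assoc)
  qed
  have Xc: "continuous_on {t1 n..t2 n} (\<lambda>s. X \<omega> (t1 n) x s)" if "\<omega> \<in> space M" for n \<omega>
    by (intro continuous_on_X that continuous_intros) (use t1'[of n] in auto)
  have Rb: "\<bar>R n \<omega>\<bar> \<le> G * E \<omega> * h n" if \<omega>: "\<omega> \<in> space M" for n \<omega>
  proof -
    have "norm (R n \<omega>) \<le> (G * E \<omega>) * (t2 n - t1 n)" unfolding R_def
    proof (rule integral_bound)
      show "continuous_on {t1 n..t2 n} (\<lambda>r. a + b * X \<omega> (t1 n) x r)" by (intro continuous_intros Xc \<omega>)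
      fix r assume r: "r \<in> {t1 n..t2 n}"
      have "norm (a + b * X \<omega> (t1 n) x r) \<le> \<bar>a\<bar> + \<bar>b\<bar> * \<bar>X \<omega> (t1 n) x r\<bar>"
        by (simp add: abs_mult[symmetric] abs_triangle_ineq)
      also have "\<dots> \<le> \<bar>a\<bar> + \<bar>b\<bar> * (K * (1 + \<bar>x\<bar> + Z \<omega>))"
        using K(2)[OF \<omega> t(2)[of n], of r x] r t1'[of n] by (intro add_left_mono mult_left_mono) auto
      also have "\<dots> \<le> \<bar>a\<bar> * (1 + Z \<omega>) + \<bar>b\<bar> * (K * ((1 + \<bar>x\<bar>) * (1 + Z \<omega>))) + 2 * (1 + Z \<omega>)"
      proof -
        have "\<bar>a\<bar> * 1 \<le> \<bar>a\<bar> * (1 + Z \<omega>)" using Z_nonneg[OF \<omega>] by (intro mult_left_mono) auto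
        moreover have "1 + \<bar>x\<bar> + Z \<omega> \<le> (1 + \<bar>x\<bar>) * (1 + Z \<omega>)" using Z_nonneg[OF \<omega>] by (simp add: algebra_simps)
        then have "\<bar>b\<bar> * (K * (1 + \<bar>x\<bar> + Z \<omega>)) \<le> \<bar>b\<bar> * (K * ((1 + \<bar>x\<bar>) * (1 + Z \<omega>)))"
          using K(1) by (intro mult_left_mono) auto
        ultimately show ?thesis using Z_nonneg[OF \<omega>] by simp
      qed
      also have "\<dots> = (\<bar>a\<bar> + \<bar>b\<bar> * K * (1 + \<bar>x\<bar>) + 2) * (1 + Z \<omega>)" by (simp add: algebra_simps)
      also have "\<dots> \<le> (\<bar>a\<bar> + \<bar>b\<bar> * K * (1 + \<bar>x\<bar>) + 2) * ((2 + 1 / e1) * E \<omega>)"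
        using K(1) by (intro mult_left_mono ZE[OF \<omega>]) auto
      finally show "norm (a + b * X \<omega> (t1 n) x r) \<le> G * E \<omega>" by (simp add: G_def mult.assoc)
    qed (use t(4)[of n] in auto)
    then show ?thesis by (simp add: h_def)
  qed
  \<comment> \<open>A centred part of size \<open>sqrt (h n)\<close> and a drift of size
    \<open>h n\<close>.\<close>
  have dec: "Y n \<omega> - x = c * B n \<omega> + R n \<omega>" if \<omega>: "\<omega> \<in> space M" for n \<omega>
    using integral_unique[OF ou_sol_has_integral[OF W_continuous[OF \<omega>], of "t1 n" "t2 n" a b c x]] t(4)[of n] t1'[of n]
    by (simp add: Y_def R_def B_def X_def algebra_simps)
  have Ym: "Y n \<in> borel_measurable M" for n
    unfolding Y_def by (rule X_measurable) (use t1'[of n] t(4)[of n] in auto)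
  have Bm: "B n \<in> borel_measurable M" for n
    unfolding B_def using W_measurable[of "t1 n"] W_measurable[of "t2 n"] t1'[of n] by simp
  have Rm: "R n \<in> borel_measurable M" for n
  proof -
    have "(\<lambda>\<omega>. Y n \<omega> - x - c * B n \<omega>) \<in> borel_measurable M" using Ym[of n] Bm[of n] by measurable
    then show ?thesis by (rule measurable_cong[THEN iffD1, rotated]) (use dec in \<open>simp add: algebra_simps\<close>)
  qed
  have Rlim: "(\<lambda>n. R n \<omega> /\<^sub>R h n) \<longlonglongrightarrow> a + b * x" if \<omega>: "\<omega> \<in> space M" for \<omega>
  proof -
    have "continuous_on ({0..T} \<times> {0..T}) (\<lambda>(\<tau>, s). a + b * X \<omega> \<tau> x s)"
      unfolding case_prod_beta' by (intro continuous_intros continuous_on_X \<omega>) auto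
    from integral_average_tendsto[OF this t] show ?thesis by (simp add: R_def h_def)
  qed
  have Ilim: "(\<lambda>n. I n \<omega> /\<^sub>R h n) \<longlonglongrightarrow> V 0 t x" if \<omega>: "\<omega> \<in> space M" for \<omega>
  proof -
    have "continuous_on ({0..T} \<times> {0..T}) (\<lambda>(\<tau>, s). V 0 s (X \<omega> \<tau> x s))"
      unfolding case_prod_beta' by (intro continuous_on_V continuous_intros continuous_on_X \<omega>) auto
    from integral_average_tendsto[OF this t] show ?thesis by (simp add: I_def h_def)
  qed
  have scale0: "z \<longlonglongrightarrow> 0" if "(\<lambda>n. z n /\<^sub>R h n) \<longlonglongrightarrow> w" for z :: "nat \<Rightarrow> 'z::real_normed_vector" and w
  proof -
    have "(\<lambda>n. h n *\<^sub>R (z n /\<^sub>R h n)) \<longlonglongrightarrow> 0 *\<^sub>R w" by (intro tendsto_scaleR h0 that)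
    moreover have "h n *\<^sub>R (z n /\<^sub>R h n) = z n" for n using h(1)[of n] by simp
    ultimately show ?thesis by simp
  qed
  have Blim: "(\<lambda>n. B n \<omega>) \<longlonglongrightarrow> 0" if \<omega>: "\<omega> \<in> space M" for \<omega>
  proof -
    have "(\<lambda>n. W (t1 n) \<omega>) \<longlonglongrightarrow> W t \<omega>" "(\<lambda>n. W (t2 n) \<omega>) \<longlonglongrightarrow> W t \<omega>"
      by (rule continuous_on_tendsto_compose[OF W_continuous[OF \<omega>] t(5)]; use t t1' in auto)
         (rule continuous_on_tendsto_compose[OF W_continuous[OF \<omega>] t(6)]; use t t1' in auto)
    from tendsto_diff[OF this(2,1)] show ?thesis by (simp add: B_def)
  qed
  have Ylim: "(\<lambda>n. Y n \<omega>) \<longlonglongrightarrow> x" if \<omega>: "\<omega> \<in> space M" for \<omega>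
  proof -
    have "(\<lambda>n. x + (c * B n \<omega> + R n \<omega>)) \<longlonglongrightarrow> x + (c * 0 + 0)"
      by (intro tendsto_intros Blim[OF \<omega>] scale0[OF Rlim[OF \<omega>]])
    then show ?thesis by (simp add: dec[OF \<omega>, symmetric])
  qed
  have fcont: "(\<lambda>n. nderiv k (f (t2 n)) (y n)) \<longlonglongrightarrow> nderiv k (f t) y0" if "y \<longlonglongrightarrow> y0" for y y0 k
    using continuous_on_tendsto_compose[OF f_continuous[of k] tendsto_Pair[OF t(6) that]] t by simp
  have fm: "(\<lambda>\<omega>. f (t2 n) (Y n \<omega>)) \<in> borel_measurable M" for n
  proof -
    have "continuous_on UNIV (f (t2 n))"
      using has_vector_derivative_continuous[OF f_has_vector_derivative[OF t(3)[of n], of 0]]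
      by (simp add: continuous_on_eq_continuous_within)
    then show ?thesis by (intro measurable_compose[OF Ym] borel_measurable_continuous_onI)
  qed
  have Im: "I n \<in> borel_measurable M" for n
    unfolding I_def using integral_V_measurable[OF refl t(2)[of n], of "t2 n" x 0] X_measurable[OF t1'(1)[of n]] t(4)[of n] t1'[of n]
    by simp
  have fi: "integrable M (\<lambda>\<omega>. f (t2 n) (Y n \<omega>))" for n
    by (rule integrable_const_bound[where B = 1]) (use norm_f_le[OF t(3)[of n]] fm in auto)
  have ReI: "Re (I n \<omega>) \<le> 0" if "\<omega> \<in> space M" for n \<omega>
    unfolding I_def by (rule Re_integral_V_le[OF that t(2)]) (use t(4)[of n] t1'[of n] in auto)
  have Afi: "integrable M (\<lambda>\<omega>. (exp (I n \<omega>) - 1) * f (t2 n) (Y n \<omega>))" for n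
  proof (rule integrable_const_bound[where B = 2])
    show "(\<lambda>\<omega>. (exp (I n \<omega>) - 1) * f (t2 n) (Y n \<omega>)) \<in> borel_measurable M" using Im[of n] fm[of n] by measurable
    show "AE \<omega> in M. norm ((exp (I n \<omega>) - 1) * f (t2 n) (Y n \<omega>)) \<le> 2"
    proof (rule AE_I2)
      fix \<omega> assume "\<omega> \<in> space M"
      then have "norm (exp (I n \<omega>)) \<le> 1" using ReI by (simp add: norm_exp_eq_Re)
      then have "norm (exp (I n \<omega>) - 1) \<le> 2" using norm_triangle_ineq4[of "exp (I n \<omega>)" 1] unfolding norm_one by linarith
      then have "norm (exp (I n \<omega>) - 1) * norm (f (t2 n) (Y n \<omega>)) \<le> 2 * 1"
        using norm_f_le[OF t(3)[of n]] by (intro mult_mono) auto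
      then show "norm ((exp (I n \<omega>) - 1) * f (t2 n) (Y n \<omega>)) \<le> 2" by (simp add: norm_mult)
    qed
  qed
  \<comment> \<open>The potential's contribution and the displacement's contribution, treated
    separately.\<close>
  have split: "f (t1 n) x - f (t2 n) x =
      (\<integral>\<omega>. (exp (I n \<omega>) - 1) * f (t2 n) (Y n \<omega>) \<partial>M) + (\<integral>\<omega>. f (t2 n) (Y n \<omega>) - f (t2 n) x \<partial>M)" for n
  proof -
    have "f (t1 n) x = (\<integral>\<omega>. exp (I n \<omega>) * f (t2 n) (Y n \<omega>) \<partial>M)"
      using f_markov[of "t1 n" "t2 n" x] t1'[of n] t(4)[of n] by (simp add: I_def Y_def)
    also have "\<dots> = (\<integral>\<omega>. (exp (I n \<omega>) - 1) * f (t2 n) (Y n \<omega>) + f (t2 n) (Y n \<omega>) \<partial>M)"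
      by (simp add: algebra_simps)
    also have "\<dots> = (\<integral>\<omega>. (exp (I n \<omega>) - 1) * f (t2 n) (Y n \<omega>) \<partial>M) + (\<integral>\<omega>. f (t2 n) (Y n \<omega>) \<partial>M)"
      by (intro Bochner_Integration.integral_add Afi fi)
    finally show ?thesis using fi[of n] by (simp add: prob_space)
  qed
  have limA: "(\<lambda>n. (\<integral>\<omega>. (exp (I n \<omega>) - 1) * f (t2 n) (Y n \<omega>) \<partial>M) /\<^sub>R h n) \<longlonglongrightarrow> V 0 t x * f t x"
  proof -
    obtain C where C: "C \<ge> 0" "\<And>\<omega> t s x. \<omega> \<in> space M \<Longrightarrow> t \<in> {0..T} \<Longrightarrow> s \<in> {0..T} \<Longrightarrow>
       norm (V 0 s (X \<omega> t x s)) \<le> C * exp (e1 * (x\<^sup>2 + (Z \<omega>)\<^sup>2))"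
      using V_path_bound[OF e1] by blast
    have "(\<lambda>n. \<integral>\<omega>. ((exp (I n \<omega>) - 1) * f (t2 n) (Y n \<omega>)) /\<^sub>R h n \<partial>M) \<longlonglongrightarrow> (\<integral>\<omega>. V 0 t x * f t x \<partial>M)"
    proof (rule integral_dominated_convergence[where w = "\<lambda>\<omega>. (C * exp (e1 * x\<^sup>2)) * E \<omega>"])
      show "integrable M (\<lambda>\<omega>. (C * exp (e1 * x\<^sup>2)) * E \<omega>)" by (intro integrable_mult_right Eint)
      show "(\<lambda>\<omega>. ((exp (I n \<omega>) - 1) * f (t2 n) (Y n \<omega>)) /\<^sub>R h n) \<in> borel_measurable M" for n
        using Im[of n] fm[of n] by measurable
      show "AE \<omega> in M. (\<lambda>n. ((exp (I n \<omega>) - 1) * f (t2 n) (Y n \<omega>)) /\<^sub>R h n) \<longlonglongrightarrow> V 0 t x * f t x"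
      proof (rule AE_I2)
        fix \<omega> assume \<omega>: "\<omega> \<in> space M"
        have "(\<lambda>n. (exp (I n \<omega>) - 1) /\<^sub>R h n) \<longlonglongrightarrow> V 0 t x"
          by (rule exp_minus_1_quotient_tendsto[OF scale0[OF Ilim[OF \<omega>]] Ilim[OF \<omega>]])
        from tendsto_mult[OF this fcont[OF Ylim[OF \<omega>], of 0]]
        show "(\<lambda>n. ((exp (I n \<omega>) - 1) * f (t2 n) (Y n \<omega>)) /\<^sub>R h n) \<longlonglongrightarrow> V 0 t x * f t x" by simp
      qed
      show "AE \<omega> in M. norm (((exp (I n \<omega>) - 1) * f (t2 n) (Y n \<omega>)) /\<^sub>R h n) \<le> (C * exp (e1 * x\<^sup>2)) * E \<omega>" for n
      proof (rule AE_I2)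
        fix \<omega> assume \<omega>: "\<omega> \<in> space M"
        have "norm (I n \<omega>) \<le> ((C * exp (e1 * x\<^sup>2)) * E \<omega>) * (t2 n - t1 n)" unfolding I_def
        proof (rule integral_bound)
          show "continuous_on {t1 n..t2 n} (\<lambda>s. V 0 s (X \<omega> (t1 n) x s))"
            by (intro continuous_on_V continuous_intros Xc \<omega>) (use t1'[of n] in auto)
          fix s assume "s \<in> {t1 n..t2 n}"
          then have "norm (V 0 s (X \<omega> (t1 n) x s)) \<le> C * exp (e1 * (x\<^sup>2 + (Z \<omega>)\<^sup>2))"
            using t1'[of n] by (intro C \<omega>) auto
          then show "norm (V 0 s (X \<omega> (t1 n) x s)) \<le> (C * exp (e1 * x\<^sup>2)) * E \<omega>"
            by (simp add: E_def exp_add distrib_left mult.assoc)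
        qed (use t(4)[of n] in auto)
        then have "norm (exp (I n \<omega>) - 1) \<le> ((C * exp (e1 * x\<^sup>2)) * E \<omega>) * h n"
          using norm_exp_minus_1_le[OF ReI[OF \<omega>, of n]] by (simp add: h_def)
        then have "norm (exp (I n \<omega>) - 1) * norm (f (t2 n) (Y n \<omega>)) \<le> (((C * exp (e1 * x\<^sup>2)) * E \<omega>) * h n) * 1"
          using norm_f_le[OF t(3)[of n]] C(1) h(1)[of n] E1[of \<omega>] by (intro mult_mono) auto
        then have "norm (exp (I n \<omega>) - 1) * norm (f (t2 n) (Y n \<omega>)) / h n \<le> (C * exp (e1 * x\<^sup>2)) * E \<omega>"
          using h(1)[of n] by (simp only: pos_divide_le_eq mult_1_right)
        then show "norm (((exp (I n \<omega>) - 1) * f (t2 n) (Y n \<omega>)) /\<^sub>R h n) \<le> (C * exp (e1 * x\<^sup>2)) * E \<omega>"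
          using h(1)[of n] unfolding norm_scaleR norm_mult by (simp add: divide_inverse_commute)
      qed
    qed simp
    then show ?thesis by (simp add: prob_space)
  qed
  have Bi: "integrable M (B n)" "integrable M (\<lambda>\<omega>. (B n \<omega>)\<^sup>2)" "integrable M (\<lambda>\<omega>. B n \<omega> ^ 6)"
    "(\<integral>\<omega>. B n \<omega> \<partial>M) = 0" "(\<integral>\<omega>. (B n \<omega>)\<^sup>2 \<partial>M) = h n" "(\<integral>\<omega>. B n \<omega> ^ 6 \<partial>M) = 15 * h n ^ 3" for n
    using increment_moments[OF t1'(1)[of n] t(4)[of n]] increment_moments(1)[OF t1'(1)[of n] t(4)[of n], of 1]
    by (simp_all add: B_def[abs_def] h_def)
  have Ri: "integrable M (R n)" for n
  proof (rule Bochner_Integration.integrable_bound[of M "\<lambda>\<omega>. G * h n * E \<omega>"])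
    show "AE \<omega> in M. norm (R n \<omega>) \<le> norm (G * h n * E \<omega>)"
      using Rb G0 h(1)[of n] E1 by (intro AE_I2) (simp add: abs_mult mult_ac order_trans[OF zero_le_one])
  qed (auto intro!: Eint Rm)
  \<comment> \<open>What the drift adds to the square of the displacement; it is negligible against
    \<open>h n\<close>, so the limiting second moment comes from \<open>B\<close> alone.\<close>
  define S where "S n \<omega> = 2 * c * B n \<omega> * R n \<omega> + (R n \<omega>)\<^sup>2" for n \<omega>
  define CS where "CS = 2 * \<bar>c\<bar> * G\<^sup>2 + T * G\<^sup>2"
  have CS0: "CS \<ge> 0" using T by (simp add: CS_def)
  have Sb: "\<bar>S n \<omega> / h n\<bar> \<le> CS * E \<omega> ^ 2" if \<omega>: "\<omega> \<in> space M" for n \<omega>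
  proof -
    have GE: "G * E \<omega> \<ge> 0" using G0 E1[of \<omega>] by simp
    have "\<bar>R n \<omega> / h n\<bar> \<le> G * E \<omega>" using Rb[OF \<omega>, of n] h(1)[of n] by (simp add: divide_le_eq)
    moreover have "\<bar>2 * c * B n \<omega> + R n \<omega>\<bar> \<le> 2 * \<bar>c\<bar> * (G * E \<omega>) + T * (G * E \<omega>)"
    proof -
      have "\<bar>R n \<omega>\<bar> \<le> G * E \<omega> * T" using Rb[OF \<omega>, of n] mult_left_mono[OF h(2)[of n] GE] by linarith
      moreover have "\<bar>2 * c * B n \<omega>\<bar> \<le> 2 * \<bar>c\<bar> * (G * E \<omega>)"
        using Bb[OF \<omega>, of n] by (simp add: abs_mult mult_left_mono)
      ultimately show ?thesis by (simp add: mult.commute[of T])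
    qed
    ultimately have "\<bar>2 * c * B n \<omega> + R n \<omega>\<bar> * \<bar>R n \<omega> / h n\<bar> \<le> (2 * \<bar>c\<bar> * (G * E \<omega>) + T * (G * E \<omega>)) * (G * E \<omega>)"
      using GE T by (intro mult_mono) auto
    also have "\<dots> = CS * E \<omega> ^ 2" by (simp add: CS_def power2_eq_square algebra_simps)
    also have "\<bar>2 * c * B n \<omega> + R n \<omega>\<bar> * \<bar>R n \<omega> / h n\<bar> = \<bar>S n \<omega> / h n\<bar>"
      by (simp add: S_def abs_mult[symmetric] power2_eq_square algebra_simps)
    finally show ?thesis .
  qed
  have Sm: "S n \<in> borel_measurable M" for n unfolding S_def using Bm[of n] Rm[of n] by measurable
  have Si: "integrable M (\<lambda>\<omega>. S n \<omega> / h n)" for n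
  proof (rule Bochner_Integration.integrable_bound[of M "\<lambda>\<omega>. CS * E \<omega> ^ 2"])
    show "AE \<omega> in M. norm (S n \<omega> / h n) \<le> norm (CS * E \<omega> ^ 2)"
      using Sb CS0 by (intro AE_I2) simp
    show "(\<lambda>\<omega>. S n \<omega> / h n) \<in> borel_measurable M" using Sm[of n] by measurable
  qed (auto intro!: Epow)
  have Si': "integrable M (S n)" for n
    using integrable_mult_right[OF Si[of n], of "h n"] h(1)[of n] by simp
  have dsq: "(Y n \<omega> - x)\<^sup>2 = c\<^sup>2 * (B n \<omega>)\<^sup>2 + S n \<omega>" if "\<omega> \<in> space M" for n \<omega>
    unfolding dec[OF that] by (simp add: S_def power2_eq_square algebra_simps)
  have Y1i: "integrable M (\<lambda>\<omega>. Y n \<omega> - x)" and Y1: "(\<integral>\<omega>. Y n \<omega> - x \<partial>M) = (\<integral>\<omega>. R n \<omega> \<partial>M)" for n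
  proof -
    have "integrable M (\<lambda>\<omega>. c * B n \<omega> + R n \<omega>)" using Bi(1) Ri by auto
    then show "integrable M (\<lambda>\<omega>. Y n \<omega> - x)"
      by (rule Bochner_Integration.integrable_cong[THEN iffD1, rotated 2]) (auto simp: dec)
    have "(\<integral>\<omega>. Y n \<omega> - x \<partial>M) = (\<integral>\<omega>. c * B n \<omega> + R n \<omega> \<partial>M)"
      by (rule Bochner_Integration.integral_cong) (auto simp: dec)
    also have "\<dots> = (\<integral>\<omega>. R n \<omega> \<partial>M)" using Bi(1,4)[of n] Ri[of n] by simp
    finally show "(\<integral>\<omega>. Y n \<omega> - x \<partial>M) = (\<integral>\<omega>. R n \<omega> \<partial>M)" .
  qed
  have Y2i: "integrable M (\<lambda>\<omega>. (Y n \<omega> - x)\<^sup>2)" and Y2: "(\<integral>\<omega>. (Y n \<omega> - x)\<^sup>2 \<partial>M) = c\<^sup>2 * h n + (\<integral>\<omega>. S n \<omega> \<partial>M)" for n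
  proof -
    have "integrable M (\<lambda>\<omega>. c\<^sup>2 * (B n \<omega>)\<^sup>2 + S n \<omega>)" using Bi(2) Si' by auto
    then show "integrable M (\<lambda>\<omega>. (Y n \<omega> - x)\<^sup>2)"
      by (rule Bochner_Integration.integrable_cong[THEN iffD1, rotated 2]) (auto simp: dsq)
    have "(\<integral>\<omega>. (Y n \<omega> - x)\<^sup>2 \<partial>M) = (\<integral>\<omega>. c\<^sup>2 * (B n \<omega>)\<^sup>2 + S n \<omega> \<partial>M)"
      by (rule Bochner_Integration.integral_cong) (auto simp: dsq)
    also have "\<dots> = c\<^sup>2 * h n + (\<integral>\<omega>. S n \<omega> \<partial>M)" using Bi(2,5)[of n] Si'[of n] by simp
    finally show "(\<integral>\<omega>. (Y n \<omega> - x)\<^sup>2 \<partial>M) = c\<^sup>2 * h n + (\<integral>\<omega>. S n \<omega> \<partial>M)" .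
  qed
  have lim1: "(\<lambda>n. (\<integral>\<omega>. Y n \<omega> - x \<partial>M) / h n) \<longlonglongrightarrow> a + b * x"
  proof -
    have "(\<lambda>n. \<integral>\<omega>. R n \<omega> / h n \<partial>M) \<longlonglongrightarrow> (\<integral>\<omega>. a + b * x \<partial>M)"
    proof (rule integral_dominated_convergence[where w = "\<lambda>\<omega>. G * E \<omega>"])
      show "integrable M (\<lambda>\<omega>. G * E \<omega>)" by (intro integrable_mult_right Eint)
      show "(\<lambda>\<omega>. R n \<omega> / h n) \<in> borel_measurable M" for n using Rm[of n] by measurable
      show "AE \<omega> in M. (\<lambda>n. R n \<omega> / h n) \<longlonglongrightarrow> a + b * x"
        using Rlim by (intro AE_I2) (simp add: divide_inverse_commute)
      show "AE \<omega> in M. norm (R n \<omega> / h n) \<le> G * E \<omega>" for n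
        using Rb h(1)[of n] by (intro AE_I2) (simp add: divide_le_eq)
    qed simp
    then show ?thesis by (simp add: Y1 prob_space)
  qed
  have lim2: "(\<lambda>n. (\<integral>\<omega>. (Y n \<omega> - x)\<^sup>2 \<partial>M) / h n) \<longlonglongrightarrow> c\<^sup>2"
  proof -
    have "(\<lambda>n. \<integral>\<omega>. S n \<omega> / h n \<partial>M) \<longlonglongrightarrow> (\<integral>\<omega>. 0 \<partial>M)"
    proof (rule integral_dominated_convergence[where w = "\<lambda>\<omega>. CS * E \<omega> ^ 2"])
      show "integrable M (\<lambda>\<omega>. CS * E \<omega> ^ 2)" by (intro integrable_mult_right Epow) simp
      show "(\<lambda>\<omega>. S n \<omega> / h n) \<in> borel_measurable M" for n using Sm[of n] by measurable
      show "AE \<omega> in M. norm (S n \<omega> / h n) \<le> CS * E \<omega> ^ 2" for n using Sb by (intro AE_I2) simp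
      show "AE \<omega> in M. (\<lambda>n. S n \<omega> / h n) \<longlonglongrightarrow> 0"
      proof (rule AE_I2)
        fix \<omega> assume \<omega>: "\<omega> \<in> space M"
        have "(\<lambda>n. (2 * c * B n \<omega> + R n \<omega>) * (R n \<omega> /\<^sub>R h n)) \<longlonglongrightarrow> (2 * c * 0 + 0) * (a + b * x)"
          by (intro tendsto_intros Blim[OF \<omega>] Rlim[OF \<omega>] scale0[OF Rlim[OF \<omega>]])
        moreover have "(\<lambda>n. (2 * c * B n \<omega> + R n \<omega>) * (R n \<omega> /\<^sub>R h n)) = (\<lambda>n. S n \<omega> / h n)"
          by (simp add: fun_eq_iff S_def power2_eq_square divide_inverse algebra_simps)
        ultimately show "(\<lambda>n. S n \<omega> / h n) \<longlonglongrightarrow> 0" by simp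
      qed
    qed simp
    then have "(\<lambda>n. c\<^sup>2 + (\<integral>\<omega>. S n \<omega> / h n \<partial>M)) \<longlonglongrightarrow> c\<^sup>2 + 0" by (intro tendsto_intros) simp
    moreover have "c\<^sup>2 + (\<integral>\<omega>. S n \<omega> / h n \<partial>M) = (\<integral>\<omega>. (Y n \<omega> - x)\<^sup>2 \<partial>M) / h n" for n
      using h(1)[of n] by (simp add: Y2 add_divide_distrib)
    ultimately show ?thesis by simp
  qed
  define Rem where "Rem n \<omega> = f (t2 n) (Y n \<omega>) - f (t2 n) x - (Y n \<omega> - x) *\<^sub>R nderiv 1 (f (t2 n)) x
      - ((Y n \<omega> - x)\<^sup>2 / 2) *\<^sub>R nderiv 2 (f (t2 n)) x" for n \<omega>
  have Remi: "integrable M (Rem n)" for n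
  proof -
    have "integrable M (\<lambda>\<omega>. (Y n \<omega> - x) *\<^sub>R nderiv 1 (f (t2 n)) x)"
      by (rule integrable_scaleR_left) (rule Y1i)
    moreover have "integrable M (\<lambda>\<omega>. ((Y n \<omega> - x)\<^sup>2 / 2) *\<^sub>R nderiv 2 (f (t2 n)) x)"
      by (rule integrable_scaleR_left) (intro integrable_divide Y2i)
    moreover have "integrable M (\<lambda>\<omega>. f (t2 n) (Y n \<omega>) - f (t2 n) x)"
      by (intro Bochner_Integration.integrable_diff fi) simp
    ultimately show ?thesis unfolding Rem_def by (intro Bochner_Integration.integrable_diff fi) simp_all
  qed
  have fY: "(\<integral>\<omega>. f (t2 n) (Y n \<omega>) - f (t2 n) x \<partial>M) = (\<integral>\<omega>. Y n \<omega> - x \<partial>M) *\<^sub>R nderiv 1 (f (t2 n)) x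
      + ((\<integral>\<omega>. (Y n \<omega> - x)\<^sup>2 \<partial>M) / 2) *\<^sub>R nderiv 2 (f (t2 n)) x + (\<integral>\<omega>. Rem n \<omega> \<partial>M)" for n
  proof -
    have "(\<integral>\<omega>. f (t2 n) (Y n \<omega>) - f (t2 n) x \<partial>M) =
        (\<integral>\<omega>. ((Y n \<omega> - x) *\<^sub>R nderiv 1 (f (t2 n)) x + ((Y n \<omega> - x)\<^sup>2 / 2) *\<^sub>R nderiv 2 (f (t2 n)) x) + Rem n \<omega> \<partial>M)"
      by (simp add: Rem_def)
    also have "\<dots> = (\<integral>\<omega>. (Y n \<omega> - x) *\<^sub>R nderiv 1 (f (t2 n)) x + ((Y n \<omega> - x)\<^sup>2 / 2) *\<^sub>R nderiv 2 (f (t2 n)) x \<partial>M) + (\<integral>\<omega>. Rem n \<omega> \<partial>M)"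
      using Y1i[of n] Y2i[of n] Remi[of n]
      by (intro Bochner_Integration.integral_add Bochner_Integration.integrable_add integrable_scaleR_left integrable_divide) auto
    also have "(\<integral>\<omega>. (Y n \<omega> - x) *\<^sub>R nderiv 1 (f (t2 n)) x + ((Y n \<omega> - x)\<^sup>2 / 2) *\<^sub>R nderiv 2 (f (t2 n)) x \<partial>M)
        = (\<integral>\<omega>. (Y n \<omega> - x) *\<^sub>R nderiv 1 (f (t2 n)) x \<partial>M) + (\<integral>\<omega>. ((Y n \<omega> - x)\<^sup>2 / 2) *\<^sub>R nderiv 2 (f (t2 n)) x \<partial>M)"
      using Y1i[of n] Y2i[of n]
      by (intro Bochner_Integration.integral_add integrable_scaleR_left integrable_divide) auto
    also have "(\<integral>\<omega>. (Y n \<omega> - x) *\<^sub>R nderiv 1 (f (t2 n)) x \<partial>M) = (\<integral>\<omega>. Y n \<omega> - x \<partial>M) *\<^sub>R nderiv 1 (f (t2 n)) x"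
      using Y1i[of n] by (intro integral_scaleR_left) auto
    also have "(\<integral>\<omega>. ((Y n \<omega> - x)\<^sup>2 / 2) *\<^sub>R nderiv 2 (f (t2 n)) x \<partial>M) = (\<integral>\<omega>. (Y n \<omega> - x)\<^sup>2 / 2 \<partial>M) *\<^sub>R nderiv 2 (f (t2 n)) x"
      using Y2i[of n] by (intro integral_scaleR_left integrable_divide) auto
    finally show ?thesis by simp
  qed
  have lim3: "(\<lambda>n. (\<integral>\<omega>. Rem n \<omega> \<partial>M) /\<^sub>R h n) \<longlonglongrightarrow> 0"
  proof -
    \<comment> \<open>The exponent of the growth bound on the third derivative is chosen so small
      that the bound along the path costs a single factor \<open>E\<close>.\<close>
    obtain l B' where l: "l > 0" "B' \<ge> 0" "\<And>\<omega> t s x. \<omega> \<in> space M \<Longrightarrow> t \<in> {0..T} \<Longrightarrow> s \<in> {0..T} \<Longrightarrow>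
         exp (l * (X \<omega> t x s)\<^sup>2) \<le> B' * exp (e1 * (x\<^sup>2 + (Z \<omega>)\<^sup>2))"
      using exp_X_square_bound[OF e1] by blast
    obtain C where C: "C \<ge> 0" "\<And>t y. t \<in> {0..T} \<Longrightarrow> norm (nderiv 3 (f t) y) \<le> C * exp (l * y\<^sup>2)"
      using f_bound[OF l(1)] by blast
    define C3 where "C3 = C * (exp (l * x\<^sup>2) * (B' * exp (e1 * x\<^sup>2)))"
    have C30: "C3 \<ge> 0" using C(1) l(2) by (simp add: C3_def)
    define C4 where "C4 = 4 * C3 * (\<bar>c\<bar> ^ 3 + G ^ 3)"
    have C40: "C4 \<ge> 0" using C30 G0 by (simp add: C4_def)
    \<comment> \<open>\<open>h^(3/2)\<close> is the natural size of the cube of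
      \<open>B\<close>.\<close>
    define \<kappa> where "\<kappa> n = h n * sqrt (h n)" for n
    have \<kappa>: "\<kappa> n > 0" "(\<kappa> n)\<^sup>2 = h n ^ 3" for n using h(1)[of n] by (auto simp: \<kappa>_def power_mult_distrib power3_eq_cube power2_eq_square)
    define J where "J n \<omega> = C4 * (\<kappa> n * (B n \<omega> ^ 6 / h n ^ 3 + E \<omega> ^ 2) + h n ^ 3 * E \<omega> ^ 4)" for n \<omega>
    have Remb: "norm (Rem n \<omega>) \<le> J n \<omega>" if \<omega>: "\<omega> \<in> space M" for n \<omega>
    proof -
      have "norm (Rem n \<omega>) \<le> (C3 * E \<omega>) * \<bar>Y n \<omega> - x\<bar> ^ 3"
      proof -
        have "norm (nderiv 0 (f (t2 n)) (Y n \<omega>) - nderiv 0 (f (t2 n)) x - (Y n \<omega> - x) *\<^sub>R nderiv 1 (f (t2 n)) x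
            - ((Y n \<omega> - x)\<^sup>2 / 2) *\<^sub>R nderiv 2 (f (t2 n)) x) \<le> (C3 * E \<omega>) * \<bar>Y n \<omega> - x\<bar> ^ 3"
        proof (rule vector_taylor2_bound[where D = "\<lambda>k. nderiv k (f (t2 n))"])
          show "(nderiv k (f (t2 n)) has_vector_derivative nderiv (Suc k) (f (t2 n)) y) (at y)" for k y
            by (rule f_has_vector_derivative[OF t(3)])
          fix y assume "y \<in> closed_segment x (Y n \<omega>)"
          then have "\<bar>y\<bar> \<le> \<bar>x\<bar> \<or> \<bar>y\<bar> \<le> \<bar>Y n \<omega>\<bar>" by (auto simp: closed_segment_eq_real_ivl split: if_splits)
          then have "y\<^sup>2 \<le> x\<^sup>2 \<or> y\<^sup>2 \<le> (Y n \<omega>)\<^sup>2" by (simp add: abs_le_square_iff)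
          then have "y\<^sup>2 \<le> x\<^sup>2 + (Y n \<omega>)\<^sup>2" using zero_le_power2[of x] zero_le_power2[of "Y n \<omega>"] by linarith
          then have "exp (l * y\<^sup>2) \<le> exp (l * x\<^sup>2) * exp (l * (Y n \<omega>)\<^sup>2)"
            using l(1) by (simp add: exp_add[symmetric] distrib_left[symmetric])
          also have "\<dots> \<le> exp (l * x\<^sup>2) * (B' * exp (e1 * (x\<^sup>2 + (Z \<omega>)\<^sup>2)))"
            unfolding Y_def using t by (intro mult_left_mono l(3) \<omega>) auto
          also have "\<dots> = (exp (l * x\<^sup>2) * (B' * exp (e1 * x\<^sup>2))) * E \<omega>"
            by (simp add: E_def distrib_left exp_add)
          finally have "C * exp (l * y\<^sup>2) \<le> C * ((exp (l * x\<^sup>2) * (B' * exp (e1 * x\<^sup>2))) * E \<omega>)"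
            using C(1) by (intro mult_left_mono) auto
          then show "norm (nderiv 3 (f (t2 n)) y) \<le> C3 * E \<omega>"
            using C(2)[OF t(3)[of n], of y] by (simp add: C3_def mult.assoc)
        qed
        then show ?thesis by (simp add: Rem_def)
      qed
      also have "\<dots> \<le> (C3 * E \<omega>) * (4 * ((\<bar>c\<bar> * \<bar>B n \<omega>\<bar>) ^ 3 + (G * E \<omega> * h n) ^ 3))"
      proof (intro mult_left_mono)
        define p r where "p = \<bar>c\<bar> * \<bar>B n \<omega>\<bar>" and "r = G * E \<omega> * h n"
        have pr: "p \<ge> 0" "r \<ge> 0" using G0 E1[of \<omega>] h(1)[of n] by (auto simp: p_def r_def)
        have "\<bar>Y n \<omega> - x\<bar> \<le> p + r"
          using Rb[OF \<omega>, of n] abs_triangle_ineq[of "c * B n \<omega>" "R n \<omega>"] unfolding dec[OF \<omega>] by (simp add: p_def r_def abs_mult)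
        then have "\<bar>Y n \<omega> - x\<bar> ^ 3 \<le> (p + r) ^ 3" by (intro power_mono) auto
        also have "\<dots> \<le> 4 * (p ^ 3 + r ^ 3)"
        proof -
          have "0 \<le> 3 * (p + r) * (p - r)\<^sup>2" using pr by simp
          also have "\<dots> = 4 * (p ^ 3 + r ^ 3) - (p + r) ^ 3" by (simp add: power2_eq_square power3_eq_cube algebra_simps)
          finally show ?thesis by simp
        qed
        finally show "\<bar>Y n \<omega> - x\<bar> ^ 3 \<le> 4 * ((\<bar>c\<bar> * \<bar>B n \<omega>\<bar>) ^ 3 + (G * E \<omega> * h n) ^ 3)" by (simp add: p_def r_def)
      qed (use C30 E1[of \<omega>] in auto)
      also have "\<dots> = 4 * C3 * (\<bar>c\<bar> ^ 3 * (\<bar>B n \<omega>\<bar> ^ 3 * E \<omega>) + G ^ 3 * (h n ^ 3 * E \<omega> ^ 4))"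
        by (simp add: power_mult_distrib algebra_simps power3_eq_cube power4_eq_xxxx)
      also have "\<dots> \<le> 4 * C3 * (\<bar>c\<bar> ^ 3 * (\<kappa> n * (B n \<omega> ^ 6 / h n ^ 3 + E \<omega> ^ 2)) + G ^ 3 * (h n ^ 3 * E \<omega> ^ 4))"
      proof (intro mult_left_mono add_right_mono)
        \<comment> \<open>The cube of \<open>B\<close> normalised to unit size, so that
          \<open>y * E <= y^2 + E^2\<close> is a balanced estimate; the mean of \<open>y^2\<close>
          is 15, whatever \<open>n\<close> is.\<close>
        define y where "y = \<bar>B n \<omega>\<bar> ^ 3 / \<kappa> n"
        have "0 \<le> y" using \<kappa>(1)[of n] by (simp add: y_def)
        then have "0 \<le> y * E \<omega>" using E1[of \<omega>] by simp
        moreover have "2 * (y * E \<omega>) \<le> y\<^sup>2 + E \<omega> ^ 2"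
          using sum_squares_bound[of y "E \<omega>"] by (simp add: mult.assoc)
        ultimately have "y * E \<omega> \<le> y\<^sup>2 + E \<omega> ^ 2" by linarith
        moreover have "y\<^sup>2 = B n \<omega> ^ 6 / h n ^ 3"
          by (simp add: y_def power_divide \<kappa>(2) power_mult[symmetric] power_even_abs)
        ultimately have "\<kappa> n * (y * E \<omega>) \<le> \<kappa> n * (B n \<omega> ^ 6 / h n ^ 3 + E \<omega> ^ 2)"
          using \<kappa>(1)[of n] by (intro mult_left_mono) auto
        then show "\<bar>B n \<omega>\<bar> ^ 3 * E \<omega> \<le> \<kappa> n * (B n \<omega> ^ 6 / h n ^ 3 + E \<omega> ^ 2)"
          using \<kappa>(1)[of n] by (simp add: y_def)
      qed (use C30 in auto)
      also have "\<dots> \<le> J n \<omega>"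
      proof -
        define p r where "p = \<kappa> n * (B n \<omega> ^ 6 / h n ^ 3 + E \<omega> ^ 2)" and "r = h n ^ 3 * E \<omega> ^ 4"
        have pr: "p \<ge> 0" "r \<ge> 0" using \<kappa>(1)[of n] h(1)[of n] by (auto simp: p_def r_def)
        have "\<bar>c\<bar> ^ 3 * p + G ^ 3 * r \<le> (\<bar>c\<bar> ^ 3 + G ^ 3) * (p + r)" using pr G0 by (simp add: algebra_simps)
        then have "4 * C3 * (\<bar>c\<bar> ^ 3 * p + G ^ 3 * r) \<le> 4 * C3 * ((\<bar>c\<bar> ^ 3 + G ^ 3) * (p + r))"
          using C30 by (intro mult_left_mono) auto
        then show ?thesis by (simp add: J_def C4_def p_def r_def mult.assoc)
      qed
      finally show ?thesis .
    qed
    define j2 j4 where "j2 = (\<integral>\<omega>. E \<omega> ^ 2 \<partial>M)" and "j4 = (\<integral>\<omega>. E \<omega> ^ 4 \<partial>M)"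
    have Ji: "integrable M (J n)" for n
      unfolding J_def using Bi(3)[of n] Epow[of 2] Epow[of 4]
      by (intro integrable_mult_right Bochner_Integration.integrable_add integrable_divide) auto
    have Jint: "(\<integral>\<omega>. J n \<omega> \<partial>M) = C4 * (\<kappa> n * (15 + j2) + h n ^ 3 * j4)" for n
      unfolding J_def j2_def j4_def using Bi(3,6)[of n] Epow[of 2] Epow[of 4] h(1)[of n] by simp
    \<comment> \<open>Dividing \<open>h^(3/2)\<close> by \<open>h\<close> leaves
      \<open>sqrt h\<close>, which still tends to 0.\<close>
    have nb: "norm ((\<integral>\<omega>. Rem n \<omega> \<partial>M) /\<^sub>R h n) \<le> C4 * (sqrt (h n) * (15 + j2) + h n ^ 2 * j4)" for n
    proof -
      have "norm (\<integral>\<omega>. Rem n \<omega> \<partial>M) \<le> (\<integral>\<omega>. norm (Rem n \<omega>) \<partial>M)" by (rule integral_norm_bound)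
      also have "\<dots> \<le> (\<integral>\<omega>. J n \<omega> \<partial>M)" by (intro integral_mono integrable_norm Remi Ji Remb)
      also have "\<dots> = h n * (C4 * (sqrt (h n) * (15 + j2) + h n ^ 2 * j4))"
        unfolding Jint by (simp add: \<kappa>_def power2_eq_square power3_eq_cube algebra_simps)
      finally show ?thesis using h(1)[of n] by (simp add: divide_le_eq divide_inverse_commute[symmetric] mult.commute)
    qed
    have "(\<lambda>n. C4 * (sqrt (h n) * (15 + j2) + h n ^ 2 * j4)) \<longlonglongrightarrow> C4 * (sqrt 0 * (15 + j2) + 0 ^ 2 * j4)"
      by (intro tendsto_intros h0)
    also have "C4 * (sqrt 0 * (15 + j2) + 0 ^ 2 * j4) = 0" by simp
    finally show ?thesis by (rule Lim_null_comparison[OF always_eventually[OF allI[OF nb]]])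
  qed
  have alg: "A /\<^sub>R r + (((m1 / r) *\<^sub>R D1 + (m2 / r / 2) *\<^sub>R D2) + D3 /\<^sub>R r) =
      (A + (m1 *\<^sub>R D1 + (m2 / 2) *\<^sub>R D2 + D3)) /\<^sub>R r" for A D1 D2 D3 :: complex and m1 m2 r :: real
  proof -
    have "(m / r) *\<^sub>R D = (m *\<^sub>R D) /\<^sub>R r" for m and D :: complex by (simp add: divide_inverse_commute)
    moreover have "m2 / r / 2 = (m2 / 2) / r" by simp
    ultimately show ?thesis by (simp only: scaleR_add_right)
  qed
  have "(\<lambda>n. (\<integral>\<omega>. (exp (I n \<omega>) - 1) * f (t2 n) (Y n \<omega>) \<partial>M) /\<^sub>R h n
      + ((((\<integral>\<omega>. Y n \<omega> - x \<partial>M) / h n) *\<^sub>R nderiv 1 (f (t2 n)) x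
      + ((\<integral>\<omega>. (Y n \<omega> - x)\<^sup>2 \<partial>M) / h n / 2) *\<^sub>R nderiv 2 (f (t2 n)) x) + (\<integral>\<omega>. Rem n \<omega> \<partial>M) /\<^sub>R h n))
     \<longlonglongrightarrow> V 0 t x * f t x + (((a + b * x) *\<^sub>R nderiv 1 (f t) x + (c\<^sup>2 / 2) *\<^sub>R nderiv 2 (f t) x) + 0)"
    by (intro tendsto_add limA tendsto_scaleR lim1 tendsto_divide lim2 tendsto_const lim3 fcont) simp
  moreover have "(\<integral>\<omega>. (exp (I n \<omega>) - 1) * f (t2 n) (Y n \<omega>) \<partial>M) /\<^sub>R h n
      + ((((\<integral>\<omega>. Y n \<omega> - x \<partial>M) / h n) *\<^sub>R nderiv 1 (f (t2 n)) x
      + ((\<integral>\<omega>. (Y n \<omega> - x)\<^sup>2 \<partial>M) / h n / 2) *\<^sub>R nderiv 2 (f (t2 n)) x) + (\<integral>\<omega>. Rem n \<omega> \<partial>M) /\<^sub>R h n)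
      = (f (t1 n) x - f (t2 n) x) /\<^sub>R (t2 n - t1 n)" for n
    unfolding split fY h_def[symmetric] by (rule alg)
  ultimately show ?thesis by (simp add: add.assoc)
qed

text \<open>A difference quotient does not change when its two points are exchanged, so each pair is
  put in order first. Approach from the left, from the right or alternating is then covered by the
  same limit.\<close>

lemma f_time_derivative:
  assumes t: "t \<in> {0..T}"
  shows "((\<lambda>s. f s x) has_vector_derivative
    - (V 0 t x * f t x + (a + b * x) *\<^sub>R nderiv 1 (f t) x + (c\<^sup>2 / 2) *\<^sub>R nderiv 2 (f t) x)) (at t within {0..T})"
  unfolding has_vector_derivative_iff_sequentially
proof (intro allI impI)
  fix s assume s: "\<forall>n. s n \<in> {0..T} - {t}" and lim: "s \<longlonglongrightarrow> t"
  define t1 t2 where "t1 n = min (s n) t" and "t2 n = max (s n) t" for n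
  have m1: "t1 n \<in> {0..T}" and m2: "t2 n \<in> {0..T}" and lt: "t1 n < t2 n" for n
    using s[rule_format, of n] t by (auto simp: t1_def t2_def)
  have "(\<lambda>n. min (s n) t) \<longlonglongrightarrow> min t t" "(\<lambda>n. max (s n) t) \<longlonglongrightarrow> max t t"
    by (intro tendsto_min tendsto_max lim tendsto_const)+
  then have "t1 \<longlonglongrightarrow> t" "t2 \<longlonglongrightarrow> t" by (simp_all add: t1_def[abs_def] t2_def[abs_def])
  from tendsto_minus[OF f_generator_limit[OF t m1 m2 lt this, of x]]
  have "(\<lambda>n. - ((f (t1 n) x - f (t2 n) x) /\<^sub>R (t2 n - t1 n))) \<longlonglongrightarrow>
    - (V 0 t x * f t x + (a + b * x) *\<^sub>R nderiv 1 (f t) x + (c\<^sup>2 / 2) *\<^sub>R nderiv 2 (f t) x)" .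
  moreover have "- ((f (t1 n) x - f (t2 n) x) /\<^sub>R (t2 n - t1 n)) = (f (s n) x - f t x) /\<^sub>R (s n - t)" for n
  proof (cases "s n \<le> t")
    case True
    then have "- ((f (t1 n) x - f (t2 n) x) /\<^sub>R (t2 n - t1 n)) = (f (s n) x - f t x) /\<^sub>R (- (t - s n))"
      by (simp only: t1_def t2_def min_absorb1 max_absorb2 inverse_minus_eq scaleR_minus_left)
    then show ?thesis by simp
  qed (simp add: t1_def t2_def scaleR_diff_right)
  ultimately show "(\<lambda>n. (f (s n) x - f t x) /\<^sub>R (s n - t)) \<longlonglongrightarrow>
    - (V 0 t x * f t x + (a + b * x) *\<^sub>R nderiv 1 (f t) x + (c\<^sup>2 / 2) *\<^sub>R nderiv 2 (f t) x)" by simp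
qed

end

section \<open>The logarithm\<close>

text \<open>Near \<open>x\<close> the branch is \<open>l x + Ln (F y / F x)\<close>: the quotient is
  close to 1, where \<open>Ln\<close> is holomorphic, and by continuity \<open>l\<close> moves by
  less than 1, hence by less than \<open>pi\<close> in the imaginary part, so no other branch can
  interfere.\<close>

lemma log_branch_has_vector_derivative:
  fixes l F :: "real \<Rightarrow> complex"
  assumes l: "continuous (at x within S) l" and x: "x \<in> S"
    and e: "\<And>y. y \<in> S \<Longrightarrow> exp (l y) = F y"
    and F: "(F has_vector_derivative D) (at x within S)"
  shows "(l has_vector_derivative D / F x) (at x within S)"
proof -
  have Fx: "F x \<noteq> 0" using e[OF x] by (metis exp_not_eq_zero)
  obtain d where d: "d > 0" "\<And>y. y \<in> S \<Longrightarrow> dist y x < d \<Longrightarrow> dist (l y) (l x) < 1"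
    using l[unfolded continuous_within_eps_delta, rule_format, of 1] by auto
  have "((\<lambda>y. F y / F x) has_vector_derivative D / F x) (at x within S)"
    using F by (rule has_vector_derivative_divide)
  moreover have "(Ln has_field_derivative 1) (at ((\<lambda>y. F y / F x) x) within (\<lambda>y. F y / F x) ` S)"
    using has_field_derivative_Ln[of 1] Fx by (auto intro: has_field_derivative_at_within)
  ultimately have "((Ln \<circ> (\<lambda>y. F y / F x)) has_vector_derivative D / F x * 1) (at x within S)"
    by (rule field_vector_diff_chain_within)
  then have "((\<lambda>y. l x + Ln (F y / F x)) has_vector_derivative 0 + D / F x) (at x within S)"
    by (intro has_vector_derivative_add has_vector_derivative_const) (simp add: o_def)
  then have "((\<lambda>y. l x + Ln (F y / F x)) has_vector_derivative D / F x) (at x within S)" by simp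
  then show ?thesis
  proof (rule has_vector_derivative_transform_within[OF _ d(1) x])
    fix y assume y: "y \<in> S" "dist y x < d"
    have "\<bar>Im (l y - l x)\<bar> < 1"
      using d(2)[OF y] abs_Im_le_cmod[of "l y - l x"] by (simp add: dist_norm)
    then have "Ln (exp (l y - l x)) = l y - l x" using pi_gt3 by (intro Ln_exp) auto
    then show "l x + Ln (F y / F x) = l y" using e[OF y(1)] e[OF x] by (simp add: exp_diff)
  qed
qed

text \<open>\<open>g k\<close> is the \<open>k\<close>-th derivative divided by \<open>k!\<close>.
  In this scaling products become plain \<open>conv\<close> without binomial coefficients, and
  evaluation at 0 gives the unknowns of the system directly.\<close>

definition taylor_chain :: "(nat \<Rightarrow> real \<Rightarrow> complex) \<Rightarrow> bool" where
  "taylor_chain g \<longleftrightarrow> (\<forall>k x. (g k has_vector_derivative of_nat (Suc k) * g (Suc k) x) (at x))"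

lemma taylor_chainD: "taylor_chain g \<Longrightarrow> (g k has_vector_derivative of_nat (Suc k) * g (Suc k) x) (at x)"
  by (simp add: taylor_chain_def)

lemma taylor_chainI:
  assumes "\<And>k x. (D k has_vector_derivative D (Suc k) x) (at x)"
  shows "taylor_chain (\<lambda>k x. D k x / fact k)"
  unfolding taylor_chain_def
proof (intro allI)
  fix k x
  have "((\<lambda>x. D k x / fact k) has_vector_derivative D (Suc k) x / fact k) (at x)"
    by (rule has_vector_derivative_divide[OF assms])
  also have "D (Suc k) x / fact k = of_nat (Suc k) * (D (Suc k) x / fact (Suc k))"
    by (simp add: field_simps del: of_nat_Suc)
  finally show "((\<lambda>x. D k x / fact k) has_vector_derivative of_nat (Suc k) * (D (Suc k) x / fact (Suc k))) (at x)" .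
qed

lemma taylor_chain_nderiv:
  assumes "taylor_chain g"
  shows "nderiv k (g 0) x = fact k * g k x"
proof -
  have "nderiv k ((\<lambda>k x. fact k * g k x) 0) = (\<lambda>k x. fact k * g k x) k"
  proof (rule nderiv_eqI)
    fix k x
    have "((\<lambda>x. fact k * g k x) has_vector_derivative fact k * (of_nat (Suc k) * g (Suc k) x)) (at x)"
      by (intro has_vector_derivative_mult_right taylor_chainD assms)
    then show "((\<lambda>x. fact k * g k x) has_vector_derivative fact (Suc k) * g (Suc k) x) (at x)"
      by (simp add: mult_ac)
  qed
  then show ?thesis by (simp add: fun_eq_iff)
qed

lemma taylor_chain_add:
  assumes "taylor_chain g" "taylor_chain h"
  shows "taylor_chain (\<lambda>k x. g k x + h k x)"
  using assms unfolding taylor_chain_def by (auto intro!: has_vector_derivative_add simp: distrib_left simp del: of_nat_Suc)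

lemma taylor_chain_cmult:
  assumes "taylor_chain g"
  shows "taylor_chain (\<lambda>k x. z * g k x)"
  unfolding taylor_chain_def
proof (intro allI)
  fix k x
  have "((\<lambda>x. z * g k x) has_vector_derivative z * (of_nat (Suc k) * g (Suc k) x)) (at x)"
    by (intro has_vector_derivative_mult_right taylor_chainD assms)
  then show "((\<lambda>x. z * g k x) has_vector_derivative of_nat (Suc k) * (z * g (Suc k) x)) (at x)"
    by (simp only: mult.left_commute)
qed

lemma taylor_chain_shift:
  assumes "taylor_chain g"
  shows "taylor_chain (\<lambda>k x. of_nat (k + 1) * g (k + 1) x)"
  unfolding taylor_chain_def
proof (intro allI)
  fix k x
  show "((\<lambda>x. of_nat (k + 1) * g (k + 1) x) has_vector_derivative of_nat (Suc k) * (of_nat (Suc k + 1) * g (Suc k + 1) x)) (at x)"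
    using has_vector_derivative_mult_right[OF taylor_chainD[OF assms, of "k + 1" x], of "of_nat (k + 1)"] by simp
qed

text \<open>Differentiating the convolution and shifting the index puts the weights
  \<open>k + 1 - l\<close> and \<open>l\<close> on the same product; they add up to
  \<open>k + 1\<close>.\<close>

lemma taylor_chain_mult:
  assumes g: "taylor_chain g" and h: "taylor_chain h"
  shows "taylor_chain (\<lambda>k x. conv (\<lambda>l. g l x) (\<lambda>l. h l x) k)"
  unfolding taylor_chain_def
proof (intro allI)
  fix k x
  have "((\<lambda>x. \<Sum>l\<le>k. g l x * h (k - l) x) has_vector_derivative
      (\<Sum>l\<le>k. g l x * (of_nat (Suc (k - l)) * h (Suc (k - l)) x) + of_nat (Suc l) * g (Suc l) x * h (k - l) x)) (at x)"
    by (intro has_vector_derivative_sum has_vector_derivative_mult taylor_chainD g h)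
  also have "(\<Sum>l\<le>k. g l x * (of_nat (Suc (k - l)) * h (Suc (k - l)) x) + of_nat (Suc l) * g (Suc l) x * h (k - l) x)
     = of_nat (Suc k) * conv (\<lambda>l. g l x) (\<lambda>l. h l x) (Suc k)"
  proof -
    have "(\<Sum>l\<le>k. of_nat (Suc l) * g (Suc l) x * h (k - l) x) = (\<Sum>l\<le>Suc k. of_nat l * (g l x * h (Suc k - l) x))"
      by (subst sum.atMost_Suc_shift) (simp add: mult.assoc del: of_nat_Suc)
    moreover have "(\<Sum>l\<le>k. g l x * (of_nat (Suc (k - l)) * h (Suc (k - l)) x)) = (\<Sum>l\<le>Suc k. of_nat (Suc k - l) * (g l x * h (Suc k - l) x))"
      unfolding sum.atMost_Suc
      by (auto simp: mult.left_commute Suc_diff_le simp del: of_nat_Suc of_nat_diff intro!: sum.cong)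
    ultimately have "(\<Sum>l\<le>k. g l x * (of_nat (Suc (k - l)) * h (Suc (k - l)) x) + of_nat (Suc l) * g (Suc l) x * h (k - l) x)
        = (\<Sum>l\<le>Suc k. of_nat (Suc k - l) * (g l x * h (Suc k - l) x) + of_nat l * (g l x * h (Suc k - l) x))"
      by (simp only: sum.distrib)
    also have "\<dots> = (\<Sum>l\<le>Suc k. of_nat (Suc k) * (g l x * h (Suc k - l) x))"
    proof (intro sum.cong refl)
      fix l assume "l \<in> {..Suc k}"
      then have "of_nat (Suc k - l) + of_nat l = (of_nat (Suc k) :: complex)" unfolding of_nat_add[symmetric] by simp
      then show "of_nat (Suc k - l) * (g l x * h (Suc k - l) x) + of_nat l * (g l x * h (Suc k - l) x)
          = of_nat (Suc k) * (g l x * h (Suc k - l) x)"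
        unfolding distrib_right[symmetric] by simp
    qed
    finally show ?thesis by (simp only: conv_def sum_distrib_left)
  qed
  finally show "((\<lambda>x. conv (\<lambda>l. g l x) (\<lambda>l. h l x) k) has_vector_derivative
      of_nat (Suc k) * conv (\<lambda>l. g l x) (\<lambda>l. h l x) (Suc k)) (at x)" by (simp only: conv_def)
qed

lemma taylor_chain_ident: "taylor_chain (\<lambda>k x. if k = 0 then complex_of_real x else if k = 1 then 1 else 0)"
  unfolding taylor_chain_def
proof (intro allI)
  fix k :: nat and x :: real
  have "((\<lambda>x::real. complex_of_real x) has_vector_derivative of_real 1) (at x)"
    by (rule has_vector_derivative_of_real) (rule DERIV_ident)
  then show "((\<lambda>x. if k = 0 then complex_of_real x else if k = 1 then 1 else 0) has_vector_derivative
      of_nat (Suc k) * (if Suc k = 0 then complex_of_real x else if Suc k = 1 then 1 else 0)) (at x)"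
    by auto
qed

section \<open>The logarithm of \<open>f\<close>, its equation and its Taylor coefficients\<close>

locale fk_log = fk +
  fixes L :: "real \<Rightarrow> real \<Rightarrow> complex"
  assumes L_continuous: "continuous_on ({0..T} \<times> UNIV) (\<lambda>(t, x). L t x)"
    and exp_L: "\<And>t x. t \<in> {0..T} \<Longrightarrow> exp (L t x) = f t x"
    and L_T_0: "L T 0 = v * of_real (q 0)"
begin

lemma f_nonzero: "t \<in> {0..T} \<Longrightarrow> f t x \<noteq> 0"
  using exp_L by (metis exp_not_eq_zero)

text \<open>With \<open>1 / f\<close> among the generators, the algebra contains the logarithmic
  derivative and is closed under differentiation. Constants and the identity are there for the
  coefficients of the equation.\<close>

definition log_gens :: "(real \<Rightarrow> real \<Rightarrow> complex) set" where
  "log_gens = range (\<lambda>k t. nderiv k (f t)) \<union> range V \<union> range (\<lambda>z t x. z)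
     \<union> {\<lambda>t x. inverse (f t x), \<lambda>t x. of_real x}"

lemma log_gensI:
  "(\<lambda>t. nderiv k (f t)) \<in> fun_alg log_gens" "(\<lambda>t x. nderiv k (f t) x) \<in> fun_alg log_gens"
  "V j \<in> fun_alg log_gens" "(\<lambda>t x. z) \<in> fun_alg log_gens"
  "(\<lambda>t x. inverse (f t x)) \<in> fun_alg log_gens" "(\<lambda>t x. of_real x) \<in> fun_alg log_gens"
  by (auto intro!: fun_alg.gen simp: log_gens_def)

lemma log_gens_derivative:
  assumes "g \<in> log_gens"
  shows "\<exists>g'\<in>fun_alg log_gens. \<forall>t\<in>{0..T}. \<forall>x. (g t has_vector_derivative g' t x) (at x)"
proof -
  consider k where "g = (\<lambda>t. nderiv k (f t))" | j where "g = V j" | z where "g = (\<lambda>t x. z)"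
    | "g = (\<lambda>t x. inverse (f t x))" | "g = (\<lambda>t x. of_real x)"
    using assms by (auto simp: log_gens_def)
  then show ?thesis
  proof cases
    case 1
    then show ?thesis by (intro bexI[OF _ log_gensI(1)[of "Suc k"]]) (auto intro: f_has_vector_derivative)
  next
    case 2
    then show ?thesis by (intro bexI[OF _ log_gensI(3)[of "Suc j"]]) (auto intro: V_has_vector_derivative)
  next
    case 3
    then show ?thesis by (intro bexI[OF _ log_gensI(4)[of 0]]) auto
  next
    case 4
    have "(g t has_vector_derivative (- 1) * (nderiv 1 (f t) x * (inverse (f t x) * inverse (f t x)))) (at x)"
      if t: "t \<in> {0..T}" for t x
    proof -
      have "(f t has_vector_derivative nderiv 1 (f t) x) (at x)"
        using f_has_vector_derivative[OF t, of 0 x] by simp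
      moreover have "(inverse has_field_derivative - (inverse (f t x) * inverse (f t x))) (at (f t x))"
        using DERIV_inverse[OF f_nonzero[OF t, of x]] by simp
      ultimately have "((inverse \<circ> f t) has_vector_derivative nderiv 1 (f t) x * - (inverse (f t x) * inverse (f t x))) (at x)"
        by (rule field_vector_diff_chain_at)
      then show ?thesis by (simp add: 4 o_def)
    qed
    moreover have "(\<lambda>t x. (- 1) * (nderiv 1 (f t) x * (inverse (f t x) * inverse (f t x)))) \<in> fun_alg log_gens"
      by (intro fun_alg.mult log_gensI)
    ultimately show ?thesis by (intro bexI) auto
  next
    case 5
    have "((\<lambda>x. of_real x :: complex) has_vector_derivative 1) (at x)" for x :: real
    proof -
      have "((\<lambda>x. of_real x :: complex) has_vector_derivative of_real 1) (at x)"
        by (rule has_vector_derivative_of_real) (rule DERIV_ident)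
      then show ?thesis by simp
    qed
    then show ?thesis using 5 by (intro bexI[OF _ log_gensI(4)[of 1]]) auto
  qed
qed

lemma log_alg_continuous:
  assumes "g \<in> fun_alg log_gens"
  shows "continuous_on ({0..T} \<times> UNIV) (\<lambda>(t, x). g t x)"
  using assms
proof induction
  case (gen g)
  then consider k where "g = (\<lambda>t. nderiv k (f t))" | j where "g = V j" | z where "g = (\<lambda>t x. z)"
    | "g = (\<lambda>t x. inverse (f t x))" | "g = (\<lambda>t x. of_real x)"
    by (auto simp: log_gens_def)
  then show ?case
  proof cases
    case 1
    then show ?thesis using f_continuous by simp
  next
    case 2
    then show ?thesis unfolding case_prod_beta' by (auto intro!: continuous_on_V continuous_intros)
  next
    case 4
    then show ?thesis using f_continuous[of 0] f_nonzero unfolding case_prod_beta'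
      by (auto intro!: continuous_on_inverse)
  next
    case 3
    then show ?thesis by (simp add: case_prod_beta')
  next
    case 5
    then show ?thesis unfolding case_prod_beta' by (simp only:) (intro continuous_intros)
  qed
next
  case (add g h)
  then show ?case unfolding case_prod_beta' by (intro continuous_intros)
next
  case (mult g h)
  then show ?case unfolding case_prod_beta' by (intro continuous_intros)
qed

definition L1 :: "real \<Rightarrow> real \<Rightarrow> complex" where
  "L1 t x = nderiv 1 (f t) x * inverse (f t x)"

lemma L_has_vector_derivative:
  assumes t: "t \<in> {0..T}"
  shows "(L t has_vector_derivative L1 t x) (at x)"
proof -
  have pc: "continuous_on UNIV (\<lambda>y::real. (t, y))" by (intro continuous_intros)
  have "(\<lambda>y::real. (t, y)) ` UNIV \<subseteq> {0..T} \<times> UNIV" using t by auto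
  from continuous_on_compose2[OF L_continuous pc this] have "continuous_on UNIV (\<lambda>y. L t y)" by simp
  then have "continuous (at x within UNIV) (L t)" by (simp add: continuous_on_eq_continuous_within)
  then have "(L t has_vector_derivative nderiv 1 (f t) x / f t x) (at x within UNIV)"
    using f_has_vector_derivative[OF t, of 0 x] exp_L[OF t]
    by (intro log_branch_has_vector_derivative) auto
  then show ?thesis by (simp add: L1_def divide_inverse)
qed

lemma L_derivatives:
  obtains D where "D 0 = L" "\<And>k. D (Suc k) \<in> fun_alg log_gens"
    "\<And>k t x. t \<in> {0..T} \<Longrightarrow> (D k t has_vector_derivative D (Suc k) t x) (at x)"
    "\<And>k t. t \<in> {0..T} \<Longrightarrow> nderiv k (L t) = D k t"
    "D 1 = L1"
proof -
  have L1: "L1 \<in> fun_alg log_gens" unfolding L1_def by (intro fun_alg.mult log_gensI)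
  obtain D where D: "D 0 = L1" "\<And>k. D k \<in> fun_alg log_gens"
    "\<And>k t x. t \<in> {0..T} \<Longrightarrow> (D k t has_vector_derivative D (Suc k) t x) (at x)"
    "\<And>k t. t \<in> {0..T} \<Longrightarrow> nderiv k (L1 t) = D k t"
    by (rule fun_alg_derivatives[OF log_gens_derivative L1]) (assumption, blast)
  \<comment> \<open>The branch \<open>L\<close> is put in front of derivatives from the algebra;
    algebra membership is claimed only from order one on.\<close>
  define D' where "D' k = (case k of 0 \<Rightarrow> L | Suc k \<Rightarrow> D k)" for k
  have d: "(D' k t has_vector_derivative D' (Suc k) t x) (at x)" if "t \<in> {0..T}" for k t x
    using D(3)[OF that] L_has_vector_derivative[OF that] D(1) by (cases k) (auto simp: D'_def)
  have "nderiv k (L t) = D' k t" if "t \<in> {0..T}" for k t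
    using nderiv_eqI[of "\<lambda>k. D' k t", OF d[OF that]] by (simp add: D'_def)
  then show thesis
    by (intro that[of D'] d) (auto simp: D'_def D(1,2))
qed

lemma L_nderiv_has_vector_derivative:
  assumes "t \<in> {0..T}"
  shows "(nderiv k (L t) has_vector_derivative nderiv (Suc k) (L t) x) (at x)"
  using L_derivatives assms by metis

definition KL :: "real \<Rightarrow> real \<Rightarrow> complex" where
  "KL t x = V 0 t x + (of_real a + of_real b * of_real x) * nderiv 1 (L t) x
     + of_real (c\<^sup>2 / 2) * (nderiv 2 (L t) x + nderiv 1 (L t) x * nderiv 1 (L t) x)"

lemma KL_derivatives:
  obtains E where "\<And>t x. t \<in> {0..T} \<Longrightarrow> E 0 t x = KL t x" "\<And>k. E k \<in> fun_alg log_gens"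
    "\<And>k t x. t \<in> {0..T} \<Longrightarrow> (E k t has_vector_derivative E (Suc k) t x) (at x)"
    "\<And>k t. t \<in> {0..T} \<Longrightarrow> nderiv k (KL t) = E k t"
proof -
  obtain D where D: "D 0 = L" "\<And>k. D (Suc k) \<in> fun_alg log_gens"
    "\<And>k t x. t \<in> {0..T} \<Longrightarrow> (D k t has_vector_derivative D (Suc k) t x) (at x)"
    "\<And>k t. t \<in> {0..T} \<Longrightarrow> nderiv k (L t) = D k t" "D 1 = L1"
    by (rule L_derivatives) blast
  \<comment> \<open>\<open>nderiv\<close> of \<open>L\<close> is controlled on \<open>[0, T]\<close>
    only. The member of the algebra is therefore built from \<open>D\<close> and identified with
    \<open>KL\<close> there.\<close>
  define g where "g t x = V 0 t x + (of_real a + of_real b * of_real x) * D 1 t x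
     + of_real (c\<^sup>2 / 2) * (D 2 t x + D 1 t x * D 1 t x)" for t x
  have D12: "D 1 \<in> fun_alg log_gens" "D 2 \<in> fun_alg log_gens" using D(2)[of 0] D(2)[of 1] by (simp_all add: numeral_2_eq_2)
  have ga: "g \<in> fun_alg log_gens" unfolding g_def
    by (intro fun_alg.add fun_alg.mult log_gensI D12)
  obtain E where E: "E 0 = g" "\<And>k. E k \<in> fun_alg log_gens"
    "\<And>k t x. t \<in> {0..T} \<Longrightarrow> (E k t has_vector_derivative E (Suc k) t x) (at x)"
    "\<And>k t. t \<in> {0..T} \<Longrightarrow> nderiv k (g t) = E k t"
    by (rule fun_alg_derivatives[OF log_gens_derivative ga]) (assumption, blast)
  have g: "g t = KL t" if "t \<in> {0..T}" for t by (simp add: fun_eq_iff g_def KL_def D(4)[OF that])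
  show thesis
    by (rule that[of E]) (use E g in auto)
qed

lemma L_time_derivative:
  assumes t: "t \<in> {0..T}"
  shows "((\<lambda>s. L s x) has_vector_derivative - KL t x) (at t within {0..T})"
proof -
  have d1: "(nderiv 1 (L t) has_vector_derivative nderiv 2 (L t) x) (at x)" for x
    using L_nderiv_has_vector_derivative[OF t, of 1 x] by (simp add: numeral_2_eq_2)
  have n1: "nderiv 1 (L t) x = L1 t x" for x
    using L_has_vector_derivative[OF t, of x] by (simp add: nderiv_Suc vector_derivative_at)
  have "nderiv 1 (L t) x * f t x = nderiv 1 (f t) x" for x
    unfolding n1 L1_def using f_nonzero[OF t, of x] by simp
  then have f1: "nderiv 1 (f t) = (\<lambda>x. nderiv 1 (L t) x * f t x)" by (intro ext) (rule sym)
  have df: "(f t has_vector_derivative nderiv 1 (f t) x) (at x)" using f_has_vector_derivative[OF t, of 0 x] by simp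
  have "(nderiv 1 (f t) has_vector_derivative nderiv 1 (L t) x * nderiv 1 (f t) x + nderiv 2 (L t) x * f t x) (at x)"
    by (subst f1) (intro has_vector_derivative_mult d1 df)
  moreover have "(nderiv 1 (f t) has_vector_derivative nderiv 2 (f t) x) (at x)"
    using f_has_vector_derivative[OF t, of 1 x] by (simp add: numeral_2_eq_2)
  \<comment> \<open>The first derivative is \<open>L'\<close> times \<open>f\<close>; the product
    rule computes the second derivative of \<open>f\<close> again, and uniqueness of derivatives
    produces the square of \<open>L'\<close>.\<close>
  ultimately have f2: "nderiv 2 (f t) x = (nderiv 2 (L t) x + nderiv 1 (L t) x * nderiv 1 (L t) x) * f t x"
    using vector_derivative_unique_at f1 by (fastforce simp: algebra_simps)
  have pc: "continuous_on {0..T} (\<lambda>s. (s, x))" by (intro continuous_intros)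
  have "(\<lambda>s. (s, x)) ` {0..T} \<subseteq> {0..T} \<times> UNIV" by auto
  from continuous_on_compose2[OF L_continuous pc this] have "continuous_on {0..T} (\<lambda>s. L s x)" by simp
  then have "continuous (at t within {0..T}) (\<lambda>s. L s x)" using t by (simp add: continuous_on_eq_continuous_within)
  then have "((\<lambda>s. L s x) has_vector_derivative
      - (V 0 t x * f t x + (a + b * x) *\<^sub>R nderiv 1 (f t) x + (c\<^sup>2 / 2) *\<^sub>R nderiv 2 (f t) x) / f t x) (at t within {0..T})"
    by (rule log_branch_has_vector_derivative[OF _ t exp_L f_time_derivative[OF t]])
  also have "- (V 0 t x * f t x + (a + b * x) *\<^sub>R nderiv 1 (f t) x + (c\<^sup>2 / 2) *\<^sub>R nderiv 2 (f t) x) / f t x = - KL t x"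
  proof -
    have "V 0 t x * f t x + (a + b * x) *\<^sub>R nderiv 1 (f t) x + (c\<^sup>2 / 2) *\<^sub>R nderiv 2 (f t) x = KL t x * f t x"
      unfolding f2 KL_def by (subst f1) (simp add: scaleR_conv_of_real algebra_simps)
    then show ?thesis using f_nonzero[OF t] by simp
  qed
  finally show ?thesis .
qed

text \<open>Integrating the equation in time and differentiating under the integral sign exchanges
  \<open>\<partial>\<^sub>t\<close> and \<open>\<partial>\<^sub>x\<^sup>k\<close>.\<close>

lemma nderiv_L_time_derivative:
  assumes t: "t \<in> {0..T}"
  shows "((\<lambda>s. nderiv k (L s) x) has_vector_derivative - nderiv k (KL t) x) (at t within {0..T})"
proof -
  obtain E where E: "\<And>t x. t \<in> {0..T} \<Longrightarrow> E 0 t x = KL t x" "\<And>k. E k \<in> fun_alg log_gens"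
    "\<And>k t x. t \<in> {0..T} \<Longrightarrow> (E k t has_vector_derivative E (Suc k) t x) (at x)"
    "\<And>k t. t \<in> {0..T} \<Longrightarrow> nderiv k (KL t) = E k t"
    by (rule KL_derivatives) blast
  have Ec: "continuous_on S (\<lambda>p. E k (s p) (y p))" if "continuous_on S s" "continuous_on S y" "\<And>p. p \<in> S \<Longrightarrow> s p \<in> {0..T}"
    for S :: "'z::topological_space set" and s y k
    using continuous_on_compose2[OF log_alg_continuous[OF E(2)[of k]] continuous_on_Pair[OF that(1,2)]] that(3) by force
  have Tm: "T \<in> {0..T}" using T by simp
  have int: "nderiv k (L t) x = nderiv k (L T) x + integral {t..T} (\<lambda>s. E k s x)" if t: "t \<in> {0..T}" for k t x
  proof (induction k arbitrary: x)
    case 0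
    have "((\<lambda>s. - E 0 s x) has_integral L T x - L t x) {t..T}"
    proof (rule fundamental_theorem_of_calculus)
      fix s assume s: "s \<in> {t..T}"
      then have "((\<lambda>s. L s x) has_vector_derivative - KL s x) (at s within {0..T})"
        using t by (intro L_time_derivative) auto
      moreover have "E 0 s x = KL s x" using s t by (intro E(1)) auto
      ultimately show "((\<lambda>s. L s x) has_vector_derivative - E 0 s x) (at s within {t..T})"
        using t by (auto intro: has_vector_derivative_within_subset)
    qed (use t in auto)
    from integral_unique[OF this] show ?case by (simp add: algebra_simps)
  next
    case (Suc k)
    have "((\<lambda>x. integral (cbox t T) (\<lambda>s. E k s x)) has_vector_derivative integral (cbox t T) (\<lambda>s. E (Suc k) s x)) (at x within UNIV)"
    proof (rule leibniz_rule_vector_derivative)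
      show "((\<lambda>x. E k s x) has_vector_derivative E (Suc k) s x) (at x within UNIV)" if "s \<in> cbox t T" for s x
        using E(3)[of s k x] that t by simp
      show "(\<lambda>s. E k s x) integrable_on cbox t T" for x
        by (rule integrable_continuous) (rule Ec, use t in \<open>auto intro!: continuous_intros\<close>)
      show "continuous_on (UNIV \<times> cbox t T) (\<lambda>(x, s). E (Suc k) s x)"
        unfolding case_prod_beta' by (rule Ec) (use t in \<open>auto intro!: continuous_intros\<close>)
    qed auto
    then have "((\<lambda>x. nderiv k (L T) x + integral {t..T} (\<lambda>s. E k s x)) has_vector_derivative
        nderiv (Suc k) (L T) x + integral {t..T} (\<lambda>s. E (Suc k) s x)) (at x)"
      by (intro has_vector_derivative_add L_nderiv_has_vector_derivative[OF Tm]) simp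
    moreover have "(\<lambda>x. nderiv k (L T) x + integral {t..T} (\<lambda>s. E k s x)) = nderiv k (L t)"
      using Suc by (simp add: fun_eq_iff)
    ultimately show ?case
      using vector_derivative_unique_at[OF L_nderiv_has_vector_derivative[OF t, of k x]] by simp
  qed
  \<comment> \<open>The integral over \<open>[s, T]\<close> is written as a difference so that
    \<open>s\<close> becomes an upper limit.\<close>
  have "((\<lambda>s. nderiv k (L T) x + (integral {0..T} (\<lambda>r. E k r x) - integral {0..s} (\<lambda>r. E k r x))) has_vector_derivative
      0 + (0 - E k t x)) (at t within {0..T})"
    by (intro has_vector_derivative_add has_vector_derivative_diff has_vector_derivative_const integral_has_vector_derivative t Ec)
       (auto intro!: continuous_intros)
  then have "((\<lambda>s. nderiv k (L T) x + (integral {0..T} (\<lambda>r. E k r x) - integral {0..s} (\<lambda>r. E k r x))) has_vector_derivative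
      - nderiv k (KL t) x) (at t within {0..T})" by (simp add: E(4)[OF t])
  then show ?thesis
  proof (rule has_vector_derivative_transform[OF t, rotated 1])
    fix s assume s: "s \<in> {0..T}"
    have "(\<lambda>r. E k r x) integrable_on {0..T}"
      by (rule integrable_continuous_real) (rule Ec, auto intro!: continuous_intros)
    from Henstock_Kurzweil_Integration.integral_combine[OF _ _ this, of s] s
    have "integral {0..T} (\<lambda>r. E k r x) - integral {0..s} (\<lambda>r. E k r x) = integral {s..T} (\<lambda>r. E k r x)"
      by (auto simp: algebra_simps)
    then show "nderiv k (L s) x = nderiv k (L T) x + (integral {0..T} (\<lambda>r. E k r x) - integral {0..s} (\<lambda>r. E k r x))"
      by (simp add: int[OF s])
  qed
qed

lemma L_taylor_chain: "t \<in> {0..T} \<Longrightarrow> taylor_chain (\<lambda>k x. nderiv k (L t) x / fact k)"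
  by (rule taylor_chainI) (rule L_nderiv_has_vector_derivative)

text \<open>Every ingredient of \<open>KL\<close> is the head of a Taylor chain: \<open>m1\<close>
  and \<open>m2\<close> for the first two derivatives of \<open>L\<close>, \<open>id'\<close> for
  the variable. So \<open>KL\<close> has the chain \<open>g\<close>, which is read off at 0 without
  differentiating the product terms by hand.\<close>

lemma nderiv_KL_0:
  assumes t: "t \<in> {0..T}"
  defines "\<phi> \<equiv> \<lambda>k. nderiv k (L t) 0 / fact k"
  shows "nderiv k (KL t) 0 / fact k = (\<Sum>i<m. u i t * of_real (P i k)) + of_real (b * real k) * \<phi> k
     + of_real (a * real (k + 1)) * \<phi> (k + 1) + of_real (c\<^sup>2 * real (k + 2) * real (k + 1) / 2) * \<phi> (k + 2)
     + of_real (c\<^sup>2 / 2) * conv (\<lambda>l. of_nat (l + 1) * \<phi> (l + 1)) (\<lambda>l. of_nat (l + 1) * \<phi> (l + 1)) k"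
proof -
  define l where "l k x = nderiv k (L t) x / fact k" for k x
  define m1 where "m1 k x = of_nat (k + 1) * l (k + 1) x" for k x
  define m2 where "m2 k x = of_nat (k + 1) * m1 (k + 1) x" for k x
  define id' where "id' k x = (if k = 0 then of_real x else if k = 1 then 1 else (0::complex))" for k :: nat and x :: real
  define w where "w k x = V k t x / fact k" for k x
  have l: "taylor_chain l" unfolding l_def by (rule L_taylor_chain[OF t])
  have m1: "taylor_chain m1" unfolding m1_def by (rule taylor_chain_shift[OF l])
  have m2: "taylor_chain m2" unfolding m2_def by (rule taylor_chain_shift[OF m1])
  have w: "taylor_chain w" unfolding w_def by (rule taylor_chainI) (rule V_has_vector_derivative)
  have id': "taylor_chain id'" unfolding id'_def by (rule taylor_chain_ident)
  define g where "g k x = w k x + (of_real a * m1 k x + of_real b * conv (\<lambda>l. id' l x) (\<lambda>l. m1 l x) k)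
     + of_real (c\<^sup>2 / 2) * (m2 k x + conv (\<lambda>l. m1 l x) (\<lambda>l. m1 l x) k)" for k x
  have g: "taylor_chain g" unfolding g_def
    by (intro taylor_chain_add taylor_chain_cmult taylor_chain_mult w m1 m2 id')
  have "g 0 = KL t"
    by (simp add: fun_eq_iff g_def KL_def w_def m1_def m2_def l_def id'_def conv_def algebra_simps numeral_2_eq_2)
  then have "nderiv k (KL t) 0 / fact k = g k 0"
    using taylor_chain_nderiv[OF g, of k 0] by simp
  moreover have "w k 0 = (\<Sum>i<m. u i t * of_real (P i k))"
    by (simp add: w_def V_def pser_0 funpow_diffs_0 sum_divide_distrib)
  \<comment> \<open>At 0 only the entry with index 1 of the identity chain survives. Multiplication
    by \<open>x\<close> thus shifts \<open>m1\<close> by one, which yields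
    \<open>k * \<phi> k\<close>.\<close>
  moreover have "conv (\<lambda>l. id' l 0) (\<lambda>l. m1 l 0) k = of_nat k * \<phi> k"
  proof (cases k)
    case 0
    then show ?thesis by (simp add: conv_def id'_def)
  next
    case (Suc n)
    have "conv (\<lambda>l. id' l 0) (\<lambda>l. m1 l 0) k = (\<Sum>l\<in>{1}. id' l 0 * m1 (k - l) 0)"
      unfolding conv_def by (rule sum.mono_neutral_right) (use Suc in \<open>auto simp: id'_def\<close>)
    also have "\<dots> = m1 n 0" using Suc by (simp add: id'_def)
    finally show ?thesis using Suc by (simp add: m1_def l_def \<phi>_def)
  qed
  moreover have "m1 k 0 = of_nat (k + 1) * \<phi> (k + 1)" for k by (simp add: m1_def l_def \<phi>_def)
  moreover have "m2 k 0 = of_nat (k + 1) * (of_nat (k + 2) * \<phi> (k + 2))"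
    by (simp add: m2_def m1_def l_def \<phi>_def)
  ultimately show ?thesis
    by (simp add: g_def algebra_simps)
qed

text \<open>\<open>L T\<close> and \<open>Q 0\<close> are both smooth logarithms of
  \<open>f T\<close>, so their derivatives agree and they differ by a constant; the normalisation at
  \<open>(T, 0)\<close> makes it 0.\<close>

lemma L_T: "L T x = Q 0 x"
proof -
  have Tm: "T \<in> {0..T}" using T by simp
  have fT: "f T y = exp (Q 0 y)" for y by (simp add: f_def H_def prob_space)
  have dL: "(L T has_vector_derivative nderiv 1 (f T) y / f T y) (at y within UNIV)" for y
    using L_has_vector_derivative[OF Tm, of y] by (simp add: L1_def divide_inverse)
  have dQ: "(Q 0 has_vector_derivative nderiv 1 (f T) y / f T y) (at y within UNIV)" for y
  proof (rule log_branch_has_vector_derivative)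
    show "continuous (at y within UNIV) (Q 0)"
      by (rule has_vector_derivative_continuous) (rule Q_has_vector_derivative)
    show "(f T has_vector_derivative nderiv 1 (f T) y) (at y within UNIV)"
      using f_has_vector_derivative[OF Tm, of 0 y] by simp
  qed (auto simp: fT)
  have "((\<lambda>y. L T y - Q 0 y) has_vector_derivative 0) (at y within UNIV)" for y
    using has_vector_derivative_diff[OF dL dQ] by simp
  then obtain C where "\<And>y. L T y - Q 0 y = C"
    using has_vector_derivative_zero_constant[of UNIV "\<lambda>y. L T y - Q 0 y"] by auto
  from this[of x] this[of 0] show ?thesis by (simp add: L_T_0 Q_def pser_0)
qed

lemma nderiv_L_T_0: "nderiv k (L T) 0 / fact k = v * of_real (q k)"
proof -
  have "L T = Q 0" by (rule ext) (rule L_T)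
  then have "nderiv k (L T) = Q k" using nderiv_eqI[of Q, OF Q_has_vector_derivative] by simp
  then show ?thesis by (simp add: Q_def pser_0 funpow_diffs_0)
qed

end

section \<open>Translation to the functional of the theorem\<close>

lemma (in fk) fk_fun_eq:
  assumes t: "t \<in> {0..T}"
  shows "f t x = (\<integral>\<omega>. (let X = ou_path a b c (\<lambda>s. W s \<omega>) t x in
     exp (integral {t..T} (\<lambda>s. \<Sum>i<m. u i s * of_real (pser (P i) (X s))) + v * of_real (pser q (X T)))) \<partial>M)"
  unfolding f_def Let_def
proof (rule Bochner_Integration.integral_cong[OF refl])
  fix \<omega> assume "\<omega> \<in> space M"
  then have p: "ou_path a b c (\<lambda>s. W s \<omega>) t x = (\<lambda>s. X \<omega> t x (max s t))"
    using ou_path_eq[OF W_continuous, of \<omega> t] t by (simp add: X_def)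
  have "integral {t..T} (\<lambda>s. \<Sum>i<m. u i s * of_real (pser (P i) (X \<omega> t x (max s t)))) = integral {t..T} (\<lambda>s. V 0 s (X \<omega> t x s))"
    by (rule integral_cong) (simp add: V_def max_absorb1)
  then show "exp (H 0 t x \<omega>) = exp (integral {t..T} (\<lambda>s. \<Sum>i<m. u i s * of_real (pser (P i) (ou_path a b c (\<lambda>s. W s \<omega>) t x s)))
      + v * of_real (pser q (ou_path a b c (\<lambda>s. W s \<omega>) t x T)))"
    using t unfolding p by (simp add: H_def Q_def max_absorb1)
qed

text \<open>\<open>vector_derivative\<close> has a value even where no derivative exists. The first
  conjunct certifies that the iterated derivatives in \<open>\<phi>\<close> are genuine, so that the
  system is about actual Taylor coefficients. At the ends of \<open>[0, T]\<close> the time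
  derivative is one-sided.\<close>

theorem theorem6p12:
  fixes M :: "'w measure" and W :: "real \<Rightarrow> 'w \<Rightarrow> real"
    and a b c T :: real
    and u1 u2 u3 v :: "real \<Rightarrow> complex"
    and p p1 p2 p3 q :: "nat \<Rightarrow> real"
    and L :: "real \<Rightarrow> real \<Rightarrow> complex"
  assumes BM: "brownian_motion M W"
    and c: "c \<noteq> 0" and T: "T > 0"
    and cont: "continuous_on {0..T} u1" "continuous_on {0..T} u2"
              "continuous_on {0..T} u3" "continuous_on {0..T} v"
    and re: "\<forall>s\<in>{0..T}. Re (u1 s) \<le> 0 \<and> Re (u2 s) = 0 \<and> Re (u3 s) = 0 \<and> Re (v s) = 0"
    and p1: "p1 = conv p p"
    and negl: "negligible_dfact p" "negligible_dfact p2" "negligible_dfact p3" "negligible_dfact q"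
    and nonvan: "\<forall>t\<in>{0..T}. \<forall>x. fk_fun M W a b c T u1 u2 u3 v p1 p2 p3 q t x \<noteq> 0"
    and Lcont: "continuous_on ({0..T} \<times> UNIV) (\<lambda>(t, x). L t x)"
    and Lexp: "\<forall>t\<in>{0..T}. \<forall>x. exp (L t x) = fk_fun M W a b c T u1 u2 u3 v p1 p2 p3 q t x"
    and LT0: "L T 0 = v T * of_real (q 0)"
  defines "\<phi> \<equiv> (\<lambda>k t. nderiv k (\<lambda>x. L (T - t) x) 0 / of_nat (fact k))"
  shows "(\<forall>k. \<forall>t\<in>{0..T}. \<forall>x.
            (nderiv k (\<lambda>y. L (T - t) y) has_vector_derivative nderiv (Suc k) (\<lambda>y. L (T - t) y) x) (at x))
       \<and> (\<forall>k. \<forall>t\<in>{0..T}.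
            (\<phi> k has_vector_derivative
               (u1 (T - t) * of_real (p1 k) + u2 (T - t) * of_real (p2 k) + u3 (T - t) * of_real (p3 k)
                + of_real (b * real k) * \<phi> k t
                + of_real (a * real (k + 1)) * \<phi> (k + 1) t
                + of_real (c\<^sup>2 * real (k + 2) * real (k + 1) / 2) * \<phi> (k + 2) t
                + of_real (c\<^sup>2 / 2) * conv (\<lambda>l. of_nat (l + 1) * \<phi> (l + 1) t)
                                           (\<lambda>l. of_nat (l + 1) * \<phi> (l + 1) t) k))
            (at t within {0..T}))
       \<and> (\<forall>k. \<phi> k 0 = v T * of_real (q k))"
proof -
  interpret brownian M W
    using BM by (simp add: brownian_def brownian_axioms_def brownian_motion_def)
  obtain Z e0 where Z: "e0 > 0" "Z \<in> borel_measurable M" "integrable M (\<lambda>\<omega>. exp (e0 * (Z \<omega>)\<^sup>2))"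
    "\<And>\<omega> r. \<omega> \<in> space M \<Longrightarrow> r \<in> {0..T} \<Longrightarrow> \<bar>W r \<omega>\<bar> \<le> Z \<omega>"
    by (rule sup_W_dominated[OF T]) blast
  define u where "u i = [u1, u2, u3] ! i" for i
  define P where "P i = [p1, p2, p3] ! i" for i
  note N = negligible_dfact_imp_subgauss_coeffs
  have sum3: "(\<Sum>i<3. G i) = G 0 + G 1 + G 2" for G :: "nat \<Rightarrow> complex"
    by (simp add: numeral_3_eq_3 numeral_2_eq_2)
  have P: "subgauss_coeffs p1" "subgauss_coeffs p2" "subgauss_coeffs p3" "subgauss_coeffs q"
    unfolding p1 by (intro subgauss_coeffs_conv N negl)+
  have cases3: "i = 0 \<or> i = 1 \<or> i = 2" if "i < 3" for i :: nat using that by auto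
  interpret fk M W a b c T 3 u P "v T" q Z e0
  proof
    show "0 < T" by (rule T)
    show "continuous_on {0..T} (u i)" if "i < 3" for i
      using cases3[OF that] cont by (auto simp: u_def numeral_2_eq_2)
    show "subgauss_coeffs (P i)" if "i < 3" for i
      using cases3[OF that] P by (auto simp: P_def numeral_2_eq_2)
    show "subgauss_coeffs q" by (rule P)
    show "Re (\<Sum>i<3. u i s * of_real (pser (P i) x)) \<le> 0" if "s \<in> {0..T}" for s x
    proof -
      \<comment> \<open>As a square this is nonnegative, so the sign of \<open>Re (u1 s)\<close>
        decides; the other two terms are purely imaginary.\<close>
      have "pser p1 x = (pser p x)\<^sup>2" unfolding p1 using pser_conv[OF N N, OF negl(1,1)] by (simp add: power2_eq_square)
      then have "Re (u1 s) * pser p1 x \<le> 0" using re that by (simp add: mult_nonpos_nonneg)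
      then show ?thesis using re that by (simp add: sum3 u_def P_def numeral_2_eq_2)
    qed
    show "Re (v T) = 0" using re T by simp
  qed (use Z in auto)
  have fk_fun: "fk_fun M W a b c T u1 u2 u3 v p1 p2 p3 q t x = f t x" if "t \<in> {0..T}" for t x
    unfolding fk_fun_def fk_fun_eq[OF that] by (simp add: sum3 u_def P_def numeral_2_eq_2)
  interpret fk_log M W a b c T 3 u P "v T" q Z e0 L
  proof
    show "continuous_on ({0..T} \<times> UNIV) (\<lambda>(t, x). L t x)" by (rule Lcont)
    show "exp (L t x) = f t x" if "t \<in> {0..T}" for t x using Lexp that by (simp add: fk_fun)
    show "L T 0 = v T * of_real (q 0)" by (rule LT0)
  qed
  have \<phi>: "\<phi> = (\<lambda>k t. nderiv k (L (T - t)) 0 / fact k)" by (simp add: \<phi>_def)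
  show ?thesis
  proof (intro conjI allI ballI)
    fix k t x assume "t \<in> {0..T}"
    then show "(nderiv k (\<lambda>y. L (T - t) y) has_vector_derivative nderiv (Suc k) (\<lambda>y. L (T - t) y) x) (at x)"
      by (intro L_nderiv_has_vector_derivative) auto
  next
    fix k t assume "t \<in> {0..T}"
    then have t: "T - t \<in> {0..T}" by auto
    have im: "(\<lambda>t. T - t) ` {0..T} = {0..T}" by (simp add: image_diff_atLeastAtMost)
    have "((\<lambda>t. T - t) has_vector_derivative - 1) (at t within {0..T})"
      by (auto intro!: derivative_eq_intros)
    moreover have "((\<lambda>s. nderiv k (L s) 0 / fact k) has_vector_derivative - nderiv k (KL (T - t)) 0 / fact k)
        (at (T - t) within (\<lambda>t. T - t) ` {0..T})"
      unfolding im by (rule has_vector_derivative_divide[OF nderiv_L_time_derivative[OF t]])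
    \<comment> \<open>Time reversal contributes a minus sign that cancels the one of the backward
      equation.\<close>
    ultimately have "(((\<lambda>s. nderiv k (L s) 0 / fact k) \<circ> (\<lambda>t. T - t)) has_vector_derivative
        (- 1) *\<^sub>R (- nderiv k (KL (T - t)) 0 / fact k)) (at t within {0..T})"
      by (rule vector_diff_chain_within)
    then have "(\<phi> k has_vector_derivative nderiv k (KL (T - t)) 0 / fact k) (at t within {0..T})"
      by (simp add: \<phi> o_def)
    then show "(\<phi> k has_vector_derivative
               (u1 (T - t) * of_real (p1 k) + u2 (T - t) * of_real (p2 k) + u3 (T - t) * of_real (p3 k)
                + of_real (b * real k) * \<phi> k t
                + of_real (a * real (k + 1)) * \<phi> (k + 1) t
                + of_real (c\<^sup>2 * real (k + 2) * real (k + 1) / 2) * \<phi> (k + 2) t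
                + of_real (c\<^sup>2 / 2) * conv (\<lambda>l. of_nat (l + 1) * \<phi> (l + 1) t)
                                           (\<lambda>l. of_nat (l + 1) * \<phi> (l + 1) t) k))
            (at t within {0..T})"
      unfolding nderiv_KL_0[OF t] \<phi> sum3 by (simp only: u_def P_def) (simp only: nth_Cons_0 nth_Cons_Suc One_nat_def numeral_2_eq_2)
  next
    fix k show "\<phi> k 0 = v T * of_real (q k)" using nderiv_L_T_0[of k] by (simp add: \<phi>)
  qed
qed

end
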